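(* Let $S$ be a countable right LCM semigroup and $N$ be a scale on $S$ such that for any $s\in S$ and $t\in\ker N$ we have $sS\cap tS=rS$ for some $r\in s(\ker N)$. Then there exists an affine homeomorphism between the states on $C^*(\ker N)$ and the ground states on $C^*(S)$ with respect to $\sigma^N$. Namely, the ground state corresponding to a state $\psi$ on $C^*(\ker N)$ is $\psi\circ E$, where $E\colon C^*(S)\to C^*(\ker N)$ is the conditional expectation such that $E(v_sv_t^* )=v_sv_t^*$ if $s,t\in\ker N$ and $E(v_sv_t^* )=0$ otherwise.
   Context: A right LCM semigroup is a left cancellative semigroup $S$ with identity element $e$ such that for all $s,t\in S$ either $sS\cap tS=\emptyset$ or $sS\cap tS=rS$ for some $r\in S$. A scale on $S$ is a semigroup homomorphism $N\colon S\to([1,+\infty),\cdot)$; $\ker N:=N^{-1}(1)$. For a right LCM semigroup $S$, $C^*(S)$ is the (universal) C$^*$-algebra generated by isometries $v_s$, $s\in S$, with relations $v_e=1$, $v_sv_t=v_{st}$, and $v_sv_s^*v_tv_t^*=v_rv_r^*$ if $sS\cap tS=rS$, $v_sv_s^*v_tv_t^*=0$ if $sS\cap tS=\emptyset$. The dynamics $\sigma^N$ is given by $\sigma^N_t(v_s)=N(s)^{it}v_s$. A ground state is a state $\varphi$ on $C^*(S)$ such that for all $\sigma^N$-analytic $a,b$ the function $z\mapsto\varphi(a\sigma^N_z(b))$ is bounded on the upper half-plane. State spaces carry the weak$^*$ topology. Under the assumption on $N$, $\ker N$ is a right LCM semigroup and the natural $*$-homomorphism $C^*(\ker N)\to C^*(S)$,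 $v_s\mapsto v_s$, is injective, so $C^*(\ker N)$ is regarded as a C$^*$-subalgebra of $C^*(S)$; the conditional expectation $E$ with the stated property exists. *)

theory Defs
  imports "HOL-Analysis.Analysis" "HOL-Algebra.Group" "HOL-Library.Poly_Mapping"
begin

section \<open>Unital C*-algebras\<close>

text \<open>
  The library norm class \<open>real_normed_algebra_1\<close> contains \<open>norm 1 = 1\<close>, so these are the
  nonzero unital C*-algebras.
\<close>

class cstar_algebra = real_normed_algebra_1 + banach +
  fixes scaleC :: "complex \<Rightarrow> 'a \<Rightarrow> 'a" (infixr \<open>*\<^sub>C\<close> 75)
    and star :: "'a \<Rightarrow> 'a"
  assumes scaleC_add_right: "c *\<^sub>C (x + y) = c *\<^sub>C x + c *\<^sub>C y"
    and scaleC_add_left: "(c + d) *\<^sub>C x = c *\<^sub>C x + d *\<^sub>C x"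
    and scaleC_scaleC: "c *\<^sub>C (d *\<^sub>C x) = (c * d) *\<^sub>C x"
    and scaleC_of_real: "of_real r *\<^sub>C x = r *\<^sub>R x"
    and scaleC_mult_left: "(c *\<^sub>C x) * y = c *\<^sub>C (x * y)"
    and scaleC_mult_right: "x * (c *\<^sub>C y) = c *\<^sub>C (x * y)"
    and norm_scaleC: "norm (c *\<^sub>C x) = cmod c * norm x"
    and star_add: "star (x + y) = star x + star y"
    and star_scaleC: "star (c *\<^sub>C x) = cnj c *\<^sub>C star x"
    and star_mult: "star (x * y) = star y * star x"
    and star_star: "star (star x) = x"
    and cstar_identity: "norm (star x * x) = (norm x)\<^sup>2"

instantiation complex :: cstar_algebra
begin
definition "scaleC_complex = ((*) :: complex \<Rightarrow> complex \<Rightarrow> complex)"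
definition "star_complex = cnj"
instance
  by standard
    (simp_all add: scaleC_complex_def star_complex_def algebra_simps norm_mult power2_eq_square
       scaleR_conv_of_real)
end

definition clinear_map :: "('a::cstar_algebra \<Rightarrow> 'b::cstar_algebra) \<Rightarrow> bool" where
  "clinear_map f \<longleftrightarrow> (\<forall>x y. f (x + y) = f x + f y) \<and> (\<forall>c x. f (c *\<^sub>C x) = c *\<^sub>C f x)"

definition star_hom :: "('a::cstar_algebra \<Rightarrow> 'b::cstar_algebra) \<Rightarrow> bool" where
  "star_hom f \<longleftrightarrow> clinear_map f \<and> f 1 = 1 \<and>
     (\<forall>x y. f (x * y) = f x * f y) \<and> (\<forall>x. f (star x) = star (f x))"

definition states :: "('a::cstar_algebra \<Rightarrow> complex) set" where
  "states = {\<phi>. clinear_map \<phi> \<and> (\<forall>x. \<phi> (star x * x) \<in> \<real>\<^sub>\<ge>\<^sub>0) \<and> \<phi> 1 = 1}"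

definition weak_star_topology :: "('a \<Rightarrow> complex) set \<Rightarrow> ('a \<Rightarrow> complex) topology" where
  "weak_star_topology X = subtopology (product_topology (\<lambda>_. euclidean) UNIV) X"

definition affine_on :: "('a \<Rightarrow> complex) set \<Rightarrow> (('a \<Rightarrow> complex) \<Rightarrow> ('b \<Rightarrow> complex)) \<Rightarrow> bool" where
  "affine_on X F \<longleftrightarrow> (\<forall>\<phi>\<in>X. \<forall>\<psi>\<in>X. \<forall>t::real. 0 \<le> t \<and> t \<le> 1 \<longrightarrow>
     F (\<lambda>x. of_real t * \<phi> x + of_real (1 - t) * \<psi> x) =
       (\<lambda>y. of_real t * F \<phi> y + of_real (1 - t) * F \<psi> y))"

text \<open>
  The subalgebra is given as the image of an embedding \<open>\<iota>\<close> of the C*-algebra \<open>'b\<close> into \<open>'a\<close>.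
  Positivity is meant in \<open>'b\<close>, whose positive elements are those of the form \<open>star y * y\<close>.
\<close>

definition conditional_expectation ::
    "('b::cstar_algebra \<Rightarrow> 'a::cstar_algebra) \<Rightarrow> ('a \<Rightarrow> 'b) \<Rightarrow> bool" where
  "conditional_expectation \<iota> E \<longleftrightarrow>
     clinear_map E \<and>
     (\<forall>x. \<exists>y. E (star x * x) = star y * y) \<and>
     (\<forall>x. norm (E x) \<le> norm x) \<and>
     (\<forall>b. E (\<iota> b) = b) \<and>
     (\<forall>b x c. E (\<iota> b * x * \<iota> c) = b * E x * c)"

section \<open>Dynamics and ground states\<close>

definition entire_map :: "(complex \<Rightarrow> 'a::cstar_algebra) \<Rightarrow> bool" where
  "entire_map f \<longleftrightarrow> (\<forall>z. \<exists>D. ((\<lambda>h. inverse h *\<^sub>C (f (z + h) - f z)) \<longlongrightarrow> D) (at 0))"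

text \<open>
  \<open>analytic_extension \<sigma> b f\<close> says that \<open>f z\<close> is \<open>\<sigma>\<^sub>z(b)\<close>; such an \<open>f\<close> is unique, being an entire
  function with prescribed values on the real line.
\<close>

definition analytic_extension ::
    "(real \<Rightarrow> 'a \<Rightarrow> 'a) \<Rightarrow> 'a::cstar_algebra \<Rightarrow> (complex \<Rightarrow> 'a) \<Rightarrow> bool" where
  "analytic_extension \<sigma> b f \<longleftrightarrow> entire_map f \<and> (\<forall>t. f (of_real t) = \<sigma> t b)"

definition analytic_element :: "(real \<Rightarrow> 'a \<Rightarrow> 'a) \<Rightarrow> 'a::cstar_algebra \<Rightarrow> bool" where
  "analytic_element \<sigma> b \<longleftrightarrow> (\<exists>f. analytic_extension \<sigma> b f)"

definition ground_states :: "(real \<Rightarrow> 'a \<Rightarrow> 'a) \<Rightarrow> ('a::cstar_algebra \<Rightarrow> complex) set" where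
  "ground_states \<sigma> = {\<phi>\<in>states. \<forall>a b f. analytic_element \<sigma> a \<longrightarrow> analytic_extension \<sigma> b f \<longrightarrow>
     bounded ((\<lambda>z. \<phi> (a * f z)) ` {z. Im z > 0})}"

section \<open>Universal C*-algebras\<close>

text \<open>
  The free unital *-algebra on generators of type \<open>'s\<close>: finite complex combinations of words in
  the generators and their formal adjoints. The product of \<open>\<Rightarrow>\<^sub>0\<close> is the convolution coming from
  the (additively written) monoid of words.
\<close>

datatype 's letter = Gen 's | Adj 's

datatype 's star_word = Word "'s letter list"

instantiation star_word :: (type) monoid_add
begin
definition "0 = Word []"
fun plus_star_word :: "'a star_word \<Rightarrow> 'a star_word \<Rightarrow> 'a star_word" where
  "plus_star_word (Word k) (Word l) = Word (k @ l)"
instance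
proof
  fix a b c :: "'a star_word"
  show "a + b + c = a + (b + c)" by (cases a; cases b; cases c) simp
  show "0 + a = a" by (cases a) (simp add: zero_star_word_def)
  show "a + 0 = a" by (cases a) (simp add: zero_star_word_def)
qed
end

type_synonym 's free_star_algebra = "'s star_word \<Rightarrow>\<^sub>0 complex"

definition gen :: "'s \<Rightarrow> 's free_star_algebra" where
  "gen s = Poly_Mapping.single (Word [Gen s]) 1"

definition fscale :: "complex \<Rightarrow> 's free_star_algebra \<Rightarrow> 's free_star_algebra" where
  "fscale c x = Poly_Mapping.map ((*) c) x"

fun letter_star :: "'s letter \<Rightarrow> 's letter" where
  "letter_star (Gen s) = Adj s"
| "letter_star (Adj s) = Gen s"

fun word_star :: "'s star_word \<Rightarrow> 's star_word" where
  "word_star (Word l) = Word (map letter_star (rev l))"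

definition fstar :: "'s free_star_algebra \<Rightarrow> 's free_star_algebra" where
  "fstar x = (\<Sum>w\<in>Poly_Mapping.keys x.
     Poly_Mapping.single (word_star w) (cnj (Poly_Mapping.lookup x w)))"

definition free_on :: "'s set \<Rightarrow> 's free_star_algebra set" where
  "free_on X = {x. \<forall>w\<in>Poly_Mapping.keys x. set_star_word w \<subseteq> X}"

fun eval_letter :: "('s \<Rightarrow> 'a::cstar_algebra) \<Rightarrow> 's letter \<Rightarrow> 'a" where
  "eval_letter v (Gen s) = v s"
| "eval_letter v (Adj s) = star (v s)"

fun eval_word :: "('s \<Rightarrow> 'a::cstar_algebra) \<Rightarrow> 's star_word \<Rightarrow> 'a" where
  "eval_word v (Word l) = prod_list (map (eval_letter v) l)"

definition eval_free :: "('s \<Rightarrow> 'a::cstar_algebra) \<Rightarrow> 's free_star_algebra \<Rightarrow> 'a" where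
  "eval_free v x = (\<Sum>w\<in>Poly_Mapping.keys x. Poly_Mapping.lookup x w *\<^sub>C eval_word v w)"

definition cstar_seminorm_on :: "'s set \<Rightarrow> ('s free_star_algebra \<Rightarrow> real) \<Rightarrow> bool" where
  "cstar_seminorm_on X p \<longleftrightarrow>
     (\<forall>x\<in>free_on X. 0 \<le> p x) \<and>
     (\<forall>x\<in>free_on X. \<forall>y\<in>free_on X. p (x + y) \<le> p x + p y) \<and>
     (\<forall>c. \<forall>x\<in>free_on X. p (fscale c x) = cmod c * p x) \<and>
     (\<forall>x\<in>free_on X. \<forall>y\<in>free_on X. p (x * y) \<le> p x * p y) \<and>
     (\<forall>x\<in>free_on X. p (fstar x * x) = (p x)\<^sup>2)"

text \<open>
  \<open>'a\<close> with the elements \<open>v x\<close> (\<open>x \<in> X\<close>) is the universal C*-algebra with generators \<open>X\<close> and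
  relations \<open>r = 0\<close> (\<open>r \<in> R\<close>): the Hausdorff completion of the free *-algebra on \<open>X\<close> with respect
  to its greatest C*-seminorm vanishing on \<open>R\<close>. HOL cannot quantify over all target C*-algebras
  inside a definition, whereas C*-seminorms involve no further type; the universal property with
  respect to an arbitrary target type is theorem \<open>universal_property\<close> below.
\<close>

definition universal_cstar ::
    "'s set \<Rightarrow> 's free_star_algebra set \<Rightarrow> ('s \<Rightarrow> 'a::cstar_algebra) \<Rightarrow> bool" where
  "universal_cstar X R v \<longleftrightarrow>
     (\<forall>r\<in>R. eval_free v r = 0) \<and>
     closure (eval_free v ` free_on X) = UNIV \<and>
     (\<forall>p. cstar_seminorm_on X p \<and> (\<forall>r\<in>R. p r = 0) \<longrightarrow>
        (\<forall>x\<in>free_on X. p x \<le> norm (eval_free v x)))"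

subsection \<open>The universal property\<close>

lemma scaleC_zero [simp]: "0 *\<^sub>C (x::'a::cstar_algebra) = 0"
  using scaleC_of_real[of 0 x] by simp

lemma scaleC_one [simp]: "1 *\<^sub>C (x::'a::cstar_algebra) = x"
  using scaleC_of_real[of 1 x] by simp

lemma scaleC_zero_right [simp]: "c *\<^sub>C (0::'a::cstar_algebra) = 0"
  using scaleC_add_right[of c 0 "0::'a"] by simp

lemma star_zero [simp]: "star (0::'a::cstar_algebra) = 0"
  using star_add[of 0 "0::'a"] by simp

lemma star_one [simp]: "star (1::'a::cstar_algebra) = 1"
  using star_mult[of "star 1" "1::'a"] by (simp add: star_star)

lemma star_diff: "star (x - y) = star x - star (y::'a::cstar_algebra)"
  using star_add[of "x - y" y] by (simp add: algebra_simps)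

lemma star_scaleR: "star (r *\<^sub>R x) = r *\<^sub>R star (x::'a::cstar_algebra)"
  using star_scaleC[of "of_real r" x] by (simp add: scaleC_of_real)

lemma norm_star [simp]: "norm (star x) = norm (x::'a::cstar_algebra)"
proof -
  have le: "norm y \<le> norm (star y)" for y :: 'a
  proof (cases "y = 0")
    case False
    have "(norm y)\<^sup>2 \<le> norm (star y) * norm y"
      by (metis cstar_identity norm_mult_ineq)
    then show ?thesis using False by (simp add: power2_eq_square)
  qed simp
  show ?thesis using le[of x] le[of "star x"] by (simp add: star_star)
qed

lemma continuous_star: "continuous_on A (star :: 'a \<Rightarrow> 'a::cstar_algebra)"
proof -
  have "dist (star x) (star y) = dist x y" for x y :: 'a
    by (simp add: dist_norm flip: star_diff)
  then show ?thesis by (metis continuous_on_iff)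
qed

lemma eval_free_superset:
  assumes "finite K" "Poly_Mapping.keys x \<subseteq> K"
  shows "eval_free v x = (\<Sum>w\<in>K. Poly_Mapping.lookup x w *\<^sub>C eval_word v w)"
  unfolding eval_free_def
  by (rule sum.mono_neutral_left) (use assms in \<open>auto simp: in_keys_iff\<close>)

lemma eval_free_add: "eval_free v (x + y) = eval_free v x + eval_free v y"
proof -
  let ?K = "Poly_Mapping.keys x \<union> Poly_Mapping.keys y"
  show ?thesis
    using keys_add[of x y]
    by (simp add: eval_free_superset[of ?K] lookup_add scaleC_add_left sum.distrib)
qed

lemma eval_free_zero [simp]: "eval_free v 0 = 0"
  by (simp add: eval_free_def)

lemma eval_free_diff: "eval_free v (x - y) = eval_free v x - eval_free v y"
  using eval_free_add[of v "x - y" y] by (simp add: algebra_simps)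

lemma eval_free_single [simp]: "eval_free v (Poly_Mapping.single w c) = c *\<^sub>C eval_word v w"
  by (cases "c = 0") (simp_all add: eval_free_def)

lemma eval_free_sum: "eval_free v (sum f A) = (\<Sum>i\<in>A. eval_free v (f i))"
  by (induction A rule: infinite_finite_induct) (simp_all add: eval_free_add)

lemma eval_word_add: "eval_word v (a + b) = eval_word v a * eval_word v b"
  by (cases a; cases b) simp

lemma eval_free_one [simp]: "eval_free v 1 = 1"
  by (simp only: single_one[symmetric] eval_free_single) (simp add: zero_star_word_def)

lemma poly_mapping_decomp:
  "x = (\<Sum>w\<in>Poly_Mapping.keys x. Poly_Mapping.single w (Poly_Mapping.lookup x w))"
  by (rule poly_mapping_eqI)
    (simp add: lookup_sum lookup_single when_def in_keys_iff)

lemma eval_free_mult: "eval_free v (x * y) = eval_free v x * eval_free v y"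
proof -
  have "eval_free v (x * y) =
      eval_free v ((\<Sum>w\<in>Poly_Mapping.keys x. Poly_Mapping.single w (Poly_Mapping.lookup x w)) *
        (\<Sum>w\<in>Poly_Mapping.keys y. Poly_Mapping.single w (Poly_Mapping.lookup y w)))"
    by (intro arg_cong[where f = "eval_free v"] arg_cong2[where f = "(*)"] poly_mapping_decomp)
  also have "\<dots> = (\<Sum>i\<in>Poly_Mapping.keys x. \<Sum>j\<in>Poly_Mapping.keys y.
      (Poly_Mapping.lookup x i * Poly_Mapping.lookup y j) *\<^sub>C (eval_word v i * eval_word v j))"
    by (simp add: sum_product mult_single eval_free_sum eval_word_add)
  also have "\<dots> = eval_free v x * eval_free v y"
    by (simp add: eval_free_def sum_product scaleC_mult_left scaleC_mult_right scaleC_scaleC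
        mult.commute)
  finally show ?thesis .
qed

lemma eval_free_fscale: "eval_free v (fscale c x) = c *\<^sub>C eval_free v x"
  unfolding fscale_def mult_map_scale_conv_mult
  by (simp add: eval_free_mult scaleC_mult_left zero_star_word_def)

lemma star_prod_list: "star (prod_list l) = prod_list (map star (rev (l::'a::cstar_algebra list)))"
  by (induction l) (simp_all add: star_mult)

lemma eval_word_star: "eval_word v (word_star w) = star (eval_word v w)"
proof -
  have "eval_letter v (letter_star l) = star (eval_letter v l)" for l
    by (cases l) (simp_all add: star_star)
  then show ?thesis by (cases w) (simp add: star_prod_list rev_map comp_def)
qed

lemma star_sum: "star (sum f A) = (\<Sum>i\<in>A. star (f i :: 'a::cstar_algebra))"
  by (induction A rule: infinite_finite_induct) (simp_all add: star_add)

lemma eval_free_fstar: "eval_free v (fstar x) = star (eval_free v x)"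
  by (simp add: fstar_def eval_free_sum eval_word_star star_sum star_scaleC)
    (simp add: eval_free_def star_sum star_scaleC)

lemma eval_free_gen [simp]: "eval_free v (gen s) = v s"
  by (simp add: gen_def)

lemma set_star_word_add: "set_star_word (a + b) = set_star_word a \<union> set_star_word b"
  by (cases a; cases b) simp

lemma set_star_word_star: "set_star_word (word_star w) = set_star_word w"
proof -
  have "set_letter (letter_star l) = set_letter l" for l :: "'a letter"
    by (cases l) simp_all
  then show ?thesis by (cases w) simp
qed

lemma free_on_add: "x \<in> free_on X \<Longrightarrow> y \<in> free_on X \<Longrightarrow> x + y \<in> free_on X"
  using keys_add[of x y] unfolding free_on_def by blast

lemma free_on_diff: "x \<in> free_on X \<Longrightarrow> y \<in> free_on X \<Longrightarrow> x - y \<in> free_on X"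
  using keys_diff[of x y] unfolding free_on_def by blast

lemma free_on_mult:
  assumes "x \<in> free_on X" "y \<in> free_on X" shows "x * y \<in> free_on X"
  using keys_mult[of x y] assms unfolding free_on_def
  by (fastforce simp: set_star_word_add)

lemma free_on_single: "set_star_word w \<subseteq> X \<Longrightarrow> Poly_Mapping.single w c \<in> free_on X"
  by (cases "c = 0") (simp_all add: free_on_def)

lemma free_on_one: "1 \<in> free_on X"
  by (simp add: free_on_def zero_star_word_def)

lemma free_on_gen: "s \<in> X \<Longrightarrow> gen s \<in> free_on X"
  unfolding gen_def by (rule free_on_single) simp

lemma free_on_fscale: "x \<in> free_on X \<Longrightarrow> fscale c x \<in> free_on X"
  unfolding fscale_def mult_map_scale_conv_mult
  by (intro free_on_mult free_on_single) (simp_all add: zero_star_word_def)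

lemma free_on_sum: "(\<And>i. i \<in> A \<Longrightarrow> f i \<in> free_on X) \<Longrightarrow> sum f A \<in> free_on X"
proof (induction A rule: infinite_finite_induct)
  case (insert a A)
  then show ?case by (simp add: free_on_add)
qed (simp_all add: free_on_def)

lemma free_on_fstar: "x \<in> free_on X \<Longrightarrow> fstar x \<in> free_on X"
  unfolding fstar_def
  by (intro free_on_sum free_on_single) (auto simp: free_on_def set_star_word_star)

lemma cstar_seminorm_eval: "cstar_seminorm_on X (\<lambda>x. norm (eval_free v x))"
  by (simp add: cstar_seminorm_on_def eval_free_add eval_free_mult eval_free_fstar
      eval_free_fscale norm_triangle_ineq norm_mult_ineq norm_scaleC cstar_identity)

lemma sqrt_one_minus:
  fixes h :: "'a::cstar_algebra"
  assumes "star h = h" "norm h < 1"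
  obtains k where "star k = k" "k * k = 1 - h" "\<And>g. g * h = h * g \<Longrightarrow> k * g = g * k"
proof -
  define r where "r = 1 - sqrt (1 - norm h)"
  have r: "0 \<le> r" "r < 1" "norm h + r\<^sup>2 = 2 * r"
    using assms(2) by (auto simp: r_def power2_eq_square algebra_simps)
  define C where "C = {g. g * h = h * g}"
  define M where "M = {y. norm y \<le> r \<and> star y = y} \<inter> (\<Inter>g\<in>C. {y. y * g = g * y})"
  define f where "f y = (1/2) *\<^sub>R (h + y * y)" for y
  have "closed M"
    unfolding M_def
    by (intro closed_Int closed_INT ballI closed_Collect_conj closed_Collect_le closed_Collect_eq
        continuous_intros continuous_star)
  then have "complete M" by (simp add: complete_eq_closed)
  moreover have "0 \<in> M" by (simp add: M_def r)
  moreover have "f y \<in> M" if "y \<in> M" for y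
  proof -
    have y: "norm y \<le> r" "star y = y" "\<And>g. g \<in> C \<Longrightarrow> y * g = g * y"
      using that by (auto simp: M_def)
    have "norm (y * y) \<le> r\<^sup>2"
      using norm_mult_ineq[of y y] mult_mono[OF y(1) y(1)] r(1)
      by (simp add: power2_eq_square)
    then have "norm (f y) \<le> r"
      using norm_triangle_ineq[of h "y * y"] r(3) by (simp add: f_def)
    moreover have "f y * g = g * f y" if "g \<in> C" for g
    proof -
      have "y * y * g = g * (y * y)"
        using y(3)[OF that] by (metis mult.assoc)
      then show ?thesis using that by (simp add: f_def C_def algebra_simps)
    qed
    moreover have "star (f y) = f y"
      using y(2) assms(1) by (simp add: f_def star_scaleR star_add star_mult)
    ultimately show ?thesis by (simp add: M_def)
  qed
  moreover have "dist (f y) (f z) \<le> r * dist y z" if "y \<in> M" "z \<in> M" for y z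
  proof -
    have *: "f y - f z = (1/2) *\<^sub>R (y * (y - z) + (y - z) * z)"
      by (simp add: f_def algebra_simps)
    have "norm (y * (y - z)) \<le> r * norm (y - z)" "norm ((y - z) * z) \<le> r * norm (y - z)"
      using that norm_mult_ineq[of y "y - z"] norm_mult_ineq[of "y - z" z]
        mult_right_mono[of "norm y" r "norm (y - z)"] mult_right_mono[of "norm z" r "norm (y - z)"]
      by (auto simp: M_def mult.commute)
    then show ?thesis
      using norm_triangle_ineq[of "y * (y - z)" "(y - z) * z"] by (simp add: dist_norm *)
  qed
  ultimately obtain y where y: "y \<in> M" "f y = y"
    using Banach_fix[of M r f] r by blast
  have "h + y * y = 2 *\<^sub>R y"
    using arg_cong[OF y(2), of "scaleR 2"] by (simp add: f_def)
  then have "(1 - y) * (1 - y) = 1 - h"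
    by (simp add: algebra_simps scaleR_2)
  moreover have "star (1 - y) = 1 - y"
    using y(1) by (simp add: M_def star_diff)
  moreover have "(1 - y) * g = g * (1 - y)" if "g * h = h * g" for g
    using y(1) that by (simp add: M_def C_def algebra_simps)
  ultimately show thesis using that by blast
qed

lemma star_hom_diff: "star_hom f \<Longrightarrow> f (x - y) = f x - f y"
  unfolding star_hom_def clinear_map_def by (metis add_diff_cancel diff_add_cancel)

lemma star_hom_norm:
  fixes f :: "'a::cstar_algebra \<Rightarrow> 'b::cstar_algebra"
  assumes f: "star_hom f"
  shows "norm (f x) \<le> norm x"
proof -
  have scale: "f (c *\<^sub>C x) = c *\<^sub>C f x" and mult: "f (x * y) = f x * f y"
    and star: "f (star x) = star (f x)" and one: "f 1 = 1" for c x y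
    using f by (auto simp: star_hom_def clinear_map_def)
  have lt: "norm (f x) \<le> 1" if "norm x < 1" for x
  proof -
    define h where "h = star x * x"
    have h: "star h = h" "norm h < 1"
      using that by (simp_all add: h_def star_mult star_star cstar_identity power_less_one_iff)
    have "norm (h * h) < 1"
      using cstar_identity[of h] h by (simp add: power_less_one_iff)
    moreover have "star (h * h) = h * h" using h by (simp add: star_mult)
    ultimately obtain k where k: "star k = k" "k * k = 1 - h * h"
        "\<And>g. g * (h * h) = h * h * g \<Longrightarrow> k * g = g * k"
      using sqrt_one_minus[of "h * h"] by metis
    have kh: "f k * f h = f h * f k" using k(3)[of h] by (metis mult mult.assoc)
    have fh: "star (f h) = f h" and fk: "star (f k) = f k" using h k star by metis+
    have sum1: "f h * f h + f k * f k = 1"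
      using k(2) f by (simp add: star_hom_diff one flip: mult)
    define u where "u = f h + \<i> *\<^sub>C f k"
    have su: "star u = f h + (- \<i>) *\<^sub>C f k"
      by (simp add: u_def star_add star_scaleC fh fk)
    have cancel: "\<i> *\<^sub>C z + (- \<i>) *\<^sub>C z = 0" for z :: 'b
      by (simp flip: scaleC_add_left)
    have "star u * u = f h * f h + f k * f k + (\<i> *\<^sub>C (f h * f k) + (- \<i>) *\<^sub>C (f h * f k))"
      unfolding su unfolding u_def
      by (simp add: distrib_left distrib_right scaleC_mult_left scaleC_mult_right scaleC_scaleC kh
          scaleC_add_right)
    then have "(norm u)\<^sup>2 = 1"
      using cstar_identity[of u] by (simp add: sum1 cancel)
    then have nu: "norm u = 1"
      using norm_ge_zero[of u] by (simp add: power2_eq_1_iff)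
    have "u + star u = 2 *\<^sub>R f h"
      unfolding su unfolding u_def using cancel[of "f k"] by (simp add: algebra_simps scaleR_2)
    then have "2 * norm (f h) = norm (u + star u)" by simp
    also have "\<dots> \<le> 2" using norm_triangle_ineq[of u "star u"] nu by simp
    finally have "norm (f h) \<le> 1" by simp
    then have "(norm (f x))\<^sup>2 \<le> 1"
      using cstar_identity[of "f x"] by (simp add: h_def mult star)
    then show ?thesis by (simp add: power_le_one_iff)
  qed
  have scaleR: "f (r *\<^sub>R x) = r *\<^sub>R f x" for r x
    using scale[of "of_real r" x] by (simp add: scaleC_of_real)
  show ?thesis
  proof (rule field_le_epsilon)
    fix e :: real assume "0 < e"
    then have pos: "norm x + e > 0" by (simp add: add_nonneg_pos)
    have "norm ((1 / (norm x + e)) *\<^sub>R x) < 1"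
      using pos \<open>0 < e\<close> by (simp add: field_simps)
    from lt[OF this] show "norm (f x) \<le> norm x + e"
      using pos by (simp add: scaleR field_simps)
  qed
qed

lemma star_hom_eval:
  fixes v :: "'s \<Rightarrow> 'a::cstar_algebra"
  assumes "star_hom f"
  shows "f (eval_free v x) = eval_free (\<lambda>s. f (v s)) x"
proof -
  have add: "f (x + y) = f x + f y" and scale: "f (c *\<^sub>C x) = c *\<^sub>C f x"
    and mult: "f (x * y) = f x * f y" and star: "f (star x) = star (f x)"
    and one: "f 1 = 1" for c x y
    using assms by (auto simp: star_hom_def clinear_map_def)
  have zero: "f 0 = 0" using star_hom_diff[OF assms, of 0 0] by simp
  have letter: "f (eval_letter v l) = eval_letter (\<lambda>s. f (v s)) l" for l
    by (cases l) (simp_all add: star)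
  have list: "f (prod_list (map (eval_letter v) l)) = prod_list (map (eval_letter (\<lambda>s. f (v s))) l)"
    for l by (induction l) (simp_all add: one mult letter)
  have word: "f (eval_word v w) = eval_word (\<lambda>s. f (v s)) w" for w
    by (cases w) (simp add: list)
  have sum: "f (sum g A) = (\<Sum>i\<in>A. f (g i))" for g and A :: "'s star_word set"
    by (induction A rule: infinite_finite_induct) (simp_all add: zero add)
  show ?thesis by (simp add: eval_free_def sum scale word)
qed

lemma eval_free_cong:
  assumes "x \<in> free_on X" "\<And>s. s \<in> X \<Longrightarrow> v s = w s"
  shows "eval_free v x = eval_free w x"
proof -
  have letter: "eval_letter v l = eval_letter w l" if "set_letter l \<subseteq> X" for l
    using that assms(2) by (cases l) auto
  have "eval_word v u = eval_word w u" if "set_star_word u \<subseteq> X" for u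
  proof (cases u)
    case (Word l)
    then have "map (eval_letter v) l = map (eval_letter w) l"
      using that by (intro map_cong refl letter) auto
    then show ?thesis by (simp only: Word eval_word.simps)
  qed
  then show ?thesis
    using assms(1) by (auto simp: eval_free_def free_on_def intro!: sum.cong)
qed

lemma isCont_scaleC: "isCont (\<lambda>x::'a::cstar_algebra. c *\<^sub>C x) a"
proof -
  have "bounded_linear (\<lambda>x::'a. c *\<^sub>C x)"
  proof (rule bounded_linear_intro[where K = "cmod c"])
    show "c *\<^sub>C (r *\<^sub>R x) = r *\<^sub>R (c *\<^sub>C x)" for r and x :: 'a
      by (simp add: scaleC_scaleC mult.commute flip: scaleC_of_real)
  qed (simp_all add: scaleC_add_right norm_scaleC mult.commute)
  then show ?thesis by (simp add: linear_continuous_at)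
qed

lemma isCont_star: "isCont star (a::'a::cstar_algebra)"
  using continuous_star[of "UNIV :: 'a set"] by (simp add: continuous_on_eq_continuous_at)

theorem universal_property:
  fixes v :: "'s \<Rightarrow> 'a::cstar_algebra" and w :: "'s \<Rightarrow> 'b::cstar_algebra"
  assumes u: "universal_cstar X R v" and rel: "\<forall>r\<in>R. eval_free w r = 0"
  shows "\<exists>!f. star_hom f \<and> (\<forall>s\<in>X. f (v s) = w s)"
proof -
  let ?D = "eval_free v ` free_on X"
  have le: "norm (eval_free w x) \<le> norm (eval_free v x)" if "x \<in> free_on X" for x
    using u cstar_seminorm_eval[of X w] rel that unfolding universal_cstar_def by auto
  have dense: "closure ?D = UNIV" using u by (simp add: universal_cstar_def)
  define g where "g y = eval_free w (SOME x. x \<in> free_on X \<and> eval_free v x = y)" for y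
  have g: "g (eval_free v x) = eval_free w x" if "x \<in> free_on X" for x
  proof -
    define z where "z = (SOME z. z \<in> free_on X \<and> eval_free v z = eval_free v x)"
    have z: "z \<in> free_on X \<and> eval_free v z = eval_free v x"
      unfolding z_def by (rule someI[of _ x]) (use that in simp)
    then have "norm (eval_free w (z - x)) \<le> 0"
      using le[of "z - x"] that by (simp add: free_on_diff eval_free_diff)
    then show ?thesis by (simp add: g_def eval_free_diff flip: z_def)
  qed
  have "dist (g y) (g z) \<le> dist y z" if "y \<in> ?D" "z \<in> ?D" for y z
  proof -
    from that obtain a b where ab: "a \<in> free_on X" "b \<in> free_on X"
        "y = eval_free v a" "z = eval_free v b"
      by blast
    then show ?thesis
      using le[OF free_on_diff[OF ab(1,2)]] by (simp add: g dist_norm eval_free_diff)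
  qed
  then have "uniformly_continuous_on ?D g"
    unfolding uniformly_continuous_on_def by (metis order_le_less_trans)
  from uniformly_continuous_on_extension_on_closure[OF this] obtain f where
      uc: "uniformly_continuous_on UNIV f" and fg: "\<And>y. y \<in> ?D \<Longrightarrow> g y = f y"
    unfolding dense by metis
  have cont: "isCont f y" for y
    using uniformly_continuous_imp_continuous[OF uc] by (simp add: continuous_on_eq_continuous_at)
  have f: "f (eval_free v x) = eval_free w x" if "x \<in> free_on X" for x
    using g[OF that] fg[of "eval_free v x"] that by simp
  have "\<exists>x. (\<forall>n. x n \<in> free_on X) \<and> (\<lambda>n. eval_free v (x n)) \<longlonglongrightarrow> y" for y
  proof -
    obtain s where s: "\<And>n. s n \<in> ?D" "s \<longlonglongrightarrow> y"
      using closure_sequential[of y ?D] dense by auto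
    then have "\<forall>n. \<exists>x. x \<in> free_on X \<and> s n = eval_free v x" by blast
    from choice[OF this] obtain x where x: "\<forall>n. x n \<in> free_on X \<and> s n = eval_free v (x n)" ..
    then have "s = (\<lambda>n. eval_free v (x n))" by blast
    then show ?thesis using s(2) x by blast
  qed
  then have "\<forall>y. \<exists>x. (\<forall>n. x n \<in> free_on X) \<and> (\<lambda>n. eval_free v (x n)) \<longlonglongrightarrow> y" by blast
  from choice[OF this] obtain a where
    a: "\<And>y n. a y n \<in> free_on X" "\<And>y. (\<lambda>n. eval_free v (a y n)) \<longlonglongrightarrow> y"
    by blast
  have lim: "(\<lambda>n. eval_free w (a y n)) \<longlonglongrightarrow> f y" for y
    using isCont_tendsto_compose[OF cont a(2)] f a(1) by simp
  have "f (x + y) = f x + f y" for x y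
  proof -
    have "(\<lambda>n. f (eval_free v (a x n + a y n))) \<longlonglongrightarrow> f (x + y)"
      by (simp add: eval_free_add) (intro isCont_tendsto_compose[OF cont] tendsto_add a)
    moreover have "(\<lambda>n. f (eval_free v (a x n + a y n))) \<longlonglongrightarrow> f x + f y"
      by (simp add: f free_on_add a(1)) (simp add: eval_free_add tendsto_add lim)
    ultimately show ?thesis by (rule LIMSEQ_unique)
  qed
  moreover have "f (x * y) = f x * f y" for x y
  proof -
    have "(\<lambda>n. f (eval_free v (a x n * a y n))) \<longlonglongrightarrow> f (x * y)"
      by (simp add: eval_free_mult) (intro isCont_tendsto_compose[OF cont] tendsto_mult a)
    moreover have "(\<lambda>n. f (eval_free v (a x n * a y n))) \<longlonglongrightarrow> f x * f y"
      by (simp add: f free_on_mult a(1)) (simp add: eval_free_mult tendsto_mult lim)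
    ultimately show ?thesis by (rule LIMSEQ_unique)
  qed
  moreover have "f (c *\<^sub>C x) = c *\<^sub>C f x" for c x
  proof -
    have "(\<lambda>n. f (eval_free v (fscale c (a x n)))) \<longlonglongrightarrow> f (c *\<^sub>C x)"
      by (simp add: eval_free_fscale)
        (intro isCont_tendsto_compose[OF cont] isCont_tendsto_compose[OF isCont_scaleC] a)
    moreover have "(\<lambda>n. f (eval_free v (fscale c (a x n)))) \<longlonglongrightarrow> c *\<^sub>C f x"
      by (simp add: f free_on_fscale a(1))
        (simp add: eval_free_fscale isCont_tendsto_compose[OF isCont_scaleC] lim)
    ultimately show ?thesis by (rule LIMSEQ_unique)
  qed
  moreover have "f (star x) = star (f x)" for x
  proof -
    have "(\<lambda>n. f (eval_free v (fstar (a x n)))) \<longlonglongrightarrow> f (star x)"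
      by (simp add: eval_free_fstar)
        (intro isCont_tendsto_compose[OF cont] isCont_tendsto_compose[OF isCont_star] a)
    moreover have "(\<lambda>n. f (eval_free v (fstar (a x n)))) \<longlonglongrightarrow> star (f x)"
      by (simp add: f free_on_fstar a(1))
        (simp add: eval_free_fstar isCont_tendsto_compose[OF isCont_star] lim)
    ultimately show ?thesis by (rule LIMSEQ_unique)
  qed
  moreover have "f 1 = 1" using f[OF free_on_one] by simp
  moreover have "f (v s) = w s" if "s \<in> X" for s
    using f[OF free_on_gen[OF that]] by simp
  ultimately have ex: "star_hom f \<and> (\<forall>s\<in>X. f (v s) = w s)"
    by (simp add: star_hom_def clinear_map_def)
  moreover have "h = f" if h: "star_hom h" "\<forall>s\<in>X. h (v s) = w s" for h
  proof
    fix y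
    have "dist (h a) (h b) \<le> dist a b" for a b
      using star_hom_norm[OF h(1), of "a - b"] by (simp add: dist_norm star_hom_diff[OF h(1)])
    then have conth: "isCont h y"
      unfolding continuous_at_eps_delta by (metis order_le_less_trans)
    have eq: "h (eval_free v x) = eval_free w x" if "x \<in> free_on X" for x
      using star_hom_eval[OF h(1), of v x] eval_free_cong[OF that, of "\<lambda>s. h (v s)" w] h(2)
      by simp
    have "(\<lambda>n. eval_free w (a y n)) \<longlonglongrightarrow> h y"
      using isCont_tendsto_compose[OF conth a(2)[of y]] by (simp add: eq a(1))
    then show "h y = f y" using lim[of y] by (rule LIMSEQ_unique)
  qed
  ultimately show ?thesis by blast
qed

section \<open>Right LCM semigroups\<close>

definition principal_right_ideal :: "('s, 'm) monoid_scheme \<Rightarrow> 's \<Rightarrow> 's set" where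
  "principal_right_ideal S s = (\<lambda>x. s \<otimes>\<^bsub>S\<^esub> x) ` carrier S"

locale right_LCM_semigroup = monoid S for S :: "('s, 'm) monoid_scheme" (structure) +
  assumes left_cancel:
      "\<lbrakk>x \<in> carrier S; s \<in> carrier S; t \<in> carrier S; x \<otimes> s = x \<otimes> t\<rbrakk> \<Longrightarrow> s = t"
    and right_LCM:
      "\<lbrakk>s \<in> carrier S; t \<in> carrier S\<rbrakk> \<Longrightarrow>
        principal_right_ideal S s \<inter> principal_right_ideal S t = {} \<or>
        (\<exists>r\<in>carrier S.
          principal_right_ideal S s \<inter> principal_right_ideal S t = principal_right_ideal S r)"

definition semigroup_scale :: "('s, 'm) monoid_scheme \<Rightarrow> ('s \<Rightarrow> real) \<Rightarrow> bool" where
  "semigroup_scale S N \<longleftrightarrow> (\<forall>s\<in>carrier S. 1 \<le> N s) \<and>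
     (\<forall>s\<in>carrier S. \<forall>t\<in>carrier S. N (s \<otimes>\<^bsub>S\<^esub> t) = N s * N t)"

definition scale_kernel :: "('s, 'm) monoid_scheme \<Rightarrow> ('s \<Rightarrow> real) \<Rightarrow> ('s, 'm) monoid_scheme" where
  "scale_kernel S N = S\<lparr>carrier := {s \<in> carrier S. N s = 1}\<rparr>"

definition lcm_relators :: "('s, 'm) monoid_scheme \<Rightarrow> 's free_star_algebra set" where
  "lcm_relators S =
     {gen \<one>\<^bsub>S\<^esub> - 1} \<union>
     {gen s * gen t - gen (s \<otimes>\<^bsub>S\<^esub> t) | s t. s \<in> carrier S \<and> t \<in> carrier S} \<union>
     {fstar (gen s) * gen s - 1 | s. s \<in> carrier S} \<union>
     {gen s * fstar (gen s) * gen t * fstar (gen t) - gen r * fstar (gen r) | s t r.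
        s \<in> carrier S \<and> t \<in> carrier S \<and> r \<in> carrier S \<and>
        principal_right_ideal S s \<inter> principal_right_ideal S t = principal_right_ideal S r} \<union>
     {gen s * fstar (gen s) * gen t * fstar (gen t) | s t.
        s \<in> carrier S \<and> t \<in> carrier S \<and>
        principal_right_ideal S s \<inter> principal_right_ideal S t = {}}"

lemma lcm_relators_iff:
  fixes v :: "'s \<Rightarrow> 'a::cstar_algebra"
  shows "(\<forall>r\<in>lcm_relators S. eval_free v r = 0) \<longleftrightarrow>
    v \<one>\<^bsub>S\<^esub> = 1 \<and>
    (\<forall>s\<in>carrier S. \<forall>t\<in>carrier S. v s * v t = v (s \<otimes>\<^bsub>S\<^esub> t)) \<and>
    (\<forall>s\<in>carrier S. star (v s) * v s = 1) \<and>
    (\<forall>s\<in>carrier S. \<forall>t\<in>carrier S. \<forall>r\<in>carrier S.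
      principal_right_ideal S s \<inter> principal_right_ideal S t = principal_right_ideal S r \<longrightarrow>
      v s * star (v s) * v t * star (v t) = v r * star (v r)) \<and>
    (\<forall>s\<in>carrier S. \<forall>t\<in>carrier S.
      principal_right_ideal S s \<inter> principal_right_ideal S t = {} \<longrightarrow>
      v s * star (v s) * v t * star (v t) = 0)"
proof -
  have Un: "(\<forall>r\<in>A \<union> B. P r) \<longleftrightarrow> (\<forall>r\<in>A. P r) \<and> (\<forall>r\<in>B. P r)"
    for A B :: "'s free_star_algebra set" and P by blast
  have C2: "(\<forall>r\<in>{f s t | s t. Q s t}. P r) \<longleftrightarrow> (\<forall>s t. Q s t \<longrightarrow> P (f s t))"
    for f :: "'s \<Rightarrow> 's \<Rightarrow> 's free_star_algebra" and Q P by blast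
  have C1: "(\<forall>r\<in>{f s | s. Q s}. P r) \<longleftrightarrow> (\<forall>s. Q s \<longrightarrow> P (f s))"
    for f :: "'s \<Rightarrow> 's free_star_algebra" and Q P by blast
  have C3: "(\<forall>r\<in>{f s t u | s t u. Q s t u}. P r) \<longleftrightarrow> (\<forall>s t u. Q s t u \<longrightarrow> P (f s t u))"
    for f :: "'s \<Rightarrow> 's \<Rightarrow> 's \<Rightarrow> 's free_star_algebra" and Q P by blast
  have sing: "(\<forall>r\<in>{a}. P r) \<longleftrightarrow> P a" for a :: "'s free_star_algebra" and P by blast
  show ?thesis
    unfolding lcm_relators_def Un C1 C2 C3 sing eval_free_diff eval_free_mult eval_free_fstar
      eval_free_gen eval_free_one right_minus_eq
    by (simp add: Ball_def conj_assoc imp_conjL)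
qed

definition lcm_cstar :: "('s, 'm) monoid_scheme \<Rightarrow> ('s \<Rightarrow> 'a::cstar_algebra) \<Rightarrow> bool" where
  "lcm_cstar S v \<longleftrightarrow> universal_cstar (carrier S) (lcm_relators S) v"

definition dynamics ::
    "('s, 'm) monoid_scheme \<Rightarrow> ('s \<Rightarrow> real) \<Rightarrow> ('s \<Rightarrow> 'a::cstar_algebra) \<Rightarrow> real \<Rightarrow> 'a \<Rightarrow> 'a" where
  "dynamics S N v t =
     (THE f. star_hom f \<and> (\<forall>s\<in>carrier S. f (v s) = (of_real (N s) powr (\<i> * of_real t)) *\<^sub>C v s))"

lemma dynamics_well_defined:
  fixes v :: "'s \<Rightarrow> 'a::cstar_algebra"
  assumes S: "right_LCM_semigroup S" and N: "semigroup_scale S N" and v: "lcm_cstar S v"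
  shows "\<exists>!f. star_hom f \<and>
    (\<forall>s\<in>carrier S. f (v s) = (of_real (N s) powr (\<i> * of_real t)) *\<^sub>C v s)"
proof -
  interpret right_LCM_semigroup S by (rule S)
  define c where "c s = of_real (N s) powr (\<i> * complex_of_real t)" for s
  have N1: "N s \<ge> 1" if "s \<in> carrier S" for s
    using N that by (simp add: semigroup_scale_def)
  have c_exp: "c s = exp (\<i> * of_real (t * ln (N s)))" if "s \<in> carrier S" for s
    using N1[OF that] by (simp add: c_def powr_def Ln_of_real algebra_simps)
  have "N \<one>\<^bsub>S\<^esub> = N \<one>\<^bsub>S\<^esub> * N \<one>\<^bsub>S\<^esub>"
    using N by (metis semigroup_scale_def one_closed l_one)
  then have "N \<one>\<^bsub>S\<^esub> = 1" using N1[OF one_closed] by simp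
  then have c1: "c \<one>\<^bsub>S\<^esub> = 1" by (simp add: c_exp)
  have cmult: "c s * c u = c (s \<otimes>\<^bsub>S\<^esub> u)" if su: "s \<in> carrier S" "u \<in> carrier S" for s u
  proof -
    have "N (s \<otimes>\<^bsub>S\<^esub> u) = N s * N u" using N su by (simp add: semigroup_scale_def)
    then have "ln (N (s \<otimes>\<^bsub>S\<^esub> u)) = ln (N s) + ln (N u)"
      using N1[OF su(1)] N1[OF su(2)] by (simp add: ln_mult)
    then show ?thesis using su by (simp add: c_exp exp_add[symmetric] algebra_simps)
  qed
  have ccnj: "cnj (c s) * c s = 1" "c s * cnj (c s) = 1" if "s \<in> carrier S" for s
  proof -
    have "cmod (c s) = 1" using that by (simp add: c_exp)
    then show "c s * cnj (c s) = 1" by (simp flip: complex_norm_square)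
    then show "cnj (c s) * c s = 1" by (simp add: mult.commute)
  qed
  have proj: "c s *\<^sub>C v s * star (c s *\<^sub>C v s) = v s * star (v s)" if "s \<in> carrier S" for s
    using ccnj[OF that]
    by (simp add: star_scaleC scaleC_mult_left scaleC_mult_right scaleC_scaleC)
  have proj2: "c s *\<^sub>C v s * star (c s *\<^sub>C v s) * c u *\<^sub>C v u * star (c u *\<^sub>C v u) =
      v s * star (v s) * v u * star (v u)" if "s \<in> carrier S" "u \<in> carrier S" for s u
    using that by (simp add: proj mult.assoc[of "v s * star (v s)"])
  have rel: "\<forall>r\<in>lcm_relators S. eval_free v r = 0"
    and u: "universal_cstar (carrier S) (lcm_relators S) v"
    using v by (auto simp: lcm_cstar_def universal_cstar_def)
  have "\<forall>r\<in>lcm_relators S. eval_free (\<lambda>s. c s *\<^sub>C v s) r = 0"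
    unfolding lcm_relators_iff
  proof (intro conjI ballI impI)
    show "c \<one>\<^bsub>S\<^esub> *\<^sub>C v \<one>\<^bsub>S\<^esub> = 1"
      using rel unfolding lcm_relators_iff by (simp add: c1)
  next
    fix s u assume su: "s \<in> carrier S" "u \<in> carrier S"
    show "c s *\<^sub>C v s * c u *\<^sub>C v u = c (s \<otimes>\<^bsub>S\<^esub> u) *\<^sub>C v (s \<otimes>\<^bsub>S\<^esub> u)"
      using rel su unfolding lcm_relators_iff
      by (simp add: scaleC_mult_left scaleC_mult_right scaleC_scaleC cmult mult.commute[of "c u"])
  next
    fix s assume s: "s \<in> carrier S"
    show "star (c s *\<^sub>C v s) * c s *\<^sub>C v s = 1"
      using rel s ccnj[OF s] unfolding lcm_relators_iff
      by (simp add: star_scaleC scaleC_mult_left scaleC_mult_right scaleC_scaleC)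
  next
    fix s u r assume "s \<in> carrier S" "u \<in> carrier S" "r \<in> carrier S"
      "principal_right_ideal S s \<inter> principal_right_ideal S u = principal_right_ideal S r"
    then show "c s *\<^sub>C v s * star (c s *\<^sub>C v s) * c u *\<^sub>C v u * star (c u *\<^sub>C v u) =
        c r *\<^sub>C v r * star (c r *\<^sub>C v r)"
      using rel unfolding lcm_relators_iff
      by (simp add: proj2) (simp add: proj)
  next
    fix s u assume "s \<in> carrier S" "u \<in> carrier S"
      "principal_right_ideal S s \<inter> principal_right_ideal S u = {}"
    then show "c s *\<^sub>C v s * star (c s *\<^sub>C v s) * c u *\<^sub>C v u * star (c u *\<^sub>C v u) = 0"
      using rel unfolding lcm_relators_iff
      by (simp add: proj2)
  qed
  from universal_property[OF u this] show ?thesis by (simp add: c_def)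
qed

end

theory Submission
  imports Defs "HOL-Complex_Analysis.Conformal_Mappings"
begin

text \<open>
  Let \<open>K\<close> be the kernel of the scale, and let \<open>v\<close> and \<open>w\<close> be the generating isometries of the algebras
  of \<open>S\<close> and \<open>K\<close>.

  The expectation \<open>E\<close> comes from an induced module over the algebra of \<open>K\<close>. Its vectors are
  finite sums of symbols \<open>v s * b\<close> with \<open>s\<close> in \<open>S\<close> and \<open>b\<close> in the algebra of \<open>K\<close>, and the inner product of
  \<open>v s\<close> and \<open>v t\<close> is \<open>w x * star (w y)\<close> if \<open>s x = t y\<close> is a least common multiple with \<open>x\<close> and \<open>y\<close> in \<open>K\<close>, and
  \<open>0\<close> otherwise. These inner products form a kernel of partial isometries with commuting range
  projections (\<open>partial_isometry_kernel_G\<close>), and such kernels are positive definite: relative to a chosen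
  index, the kernel splits into a square and a kernel of the same type on fewer indices
  (\<open>partial_isometry_kernel_pos\<close>). Left multiplication by \<open>S\<close> acts by adjointable isometries that satisfy
  the defining relations up to null vectors (\<open>opnorm_relators\<close>), so the operator norm is a C*-seminorm
  below the norm of the universal algebra of \<open>S\<close>. Therefore the vector functional at the unit of \<open>S\<close>
  extends to a contraction \<open>E\<close>. It is a conditional expectation with the stated values, and as a left
  inverse it shows that the canonical map \<open>\<iota>\<close> from the algebra of \<open>K\<close> is injective.

  Inner products of \<open>v s\<close> and \<open>v t\<close> vanish unless \<open>N s = N t\<close>. Hence multiplying \<open>v s\<close> by
  \<open>N s\<close> to the power \<open>\<i> z\<close> is a contraction of the module for \<open>Im z \<ge> 0\<close>. This operator implements the
  dynamics on the orbit of the unit vector, which gives \<open>norm (E (a * \<sigma>\<^sub>z b)) \<le> norm a * norm b\<close> in the upper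
  half-plane (\<open>norm_E_twist\<close>), first for \<open>b\<close> in the *-algebra generated by \<open>v\<close> and then for all analytic
  \<open>b\<close>. So \<open>\<psi> \<circ> E\<close> is a ground state for every state \<open>\<psi>\<close>.

  Conversely, boundedness of \<open>\<phi> (v s * \<sigma>\<^sub>z (star (v t)))\<close> forces a ground state \<open>\<phi>\<close> to vanish at
  \<open>v s * star (v t)\<close> unless \<open>s\<close> and \<open>t\<close> are in \<open>K\<close> (\<open>ground_state_vanishes\<close>). Since these elements span a dense
  subspace, \<open>\<phi> = \<phi> \<circ> \<iota> \<circ> E\<close>. Thus composition with \<open>E\<close> and composition with \<open>\<iota>\<close> are mutually inverse, and
  both are continuous for the weak* topologies.

  Positivity in C*-algebras, including that \<open>star x * x\<close> has a self-adjoint square root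
  (\<open>pos_elem_star_mult_self\<close>), is developed from the C*-identity by estimates of norms.
\<close>

section \<open>Positive elements of a C*-algebra\<close>

text \<open>
  Positivity is expressed by self-adjoint square roots; no spectrum is used. For self-adjoint \<open>h\<close> an equivalent
  condition is \<open>norm (of_real t - h) \<le> t\<close> with \<open>t = norm h\<close> (\<open>pos_elem_iff\<close>), from which the positive
  elements are seen to form a closed cone, and \<open>h = star y * y\<close> (\<open>pos_elem_iff_star_mult\<close>) is Kaplansky's
  theorem.
\<close>

definition pos_elem :: "'a::cstar_algebra \<Rightarrow> bool" where
  "pos_elem h \<longleftrightarrow> (\<exists>k. star k = k \<and> h = k * k)"

text \<open>
  The square root is \<open>1 - z\<close> where \<open>z\<close> is the limit of the iteration \<open>y \<mapsto> ((1 - h) + y * y) / 2\<close>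
  from \<open>0\<close>. In the borderline case \<open>norm (1 - h) = 1\<close> this map need not be a strict contraction;
  convergence follows because the increments are dominated by those of the same iteration for
  real numbers with \<open>1\<close> in place of \<open>1 - h\<close>, which is increasing and bounded.
\<close>

lemma sqrt_of_near_one:
  fixes h :: "'a::cstar_algebra"
  assumes h: "star h = h" "norm (1 - h) \<le> 1"
  obtains k where "star k = k" "k * k = h" "norm (1 - k) \<le> 1" "\<And>g. g * h = h * g \<Longrightarrow> g * k = k * g"
proof -
  define f where "f y = (1/2) *\<^sub>R ((1 - h) + y * y)" for y
  define F where "F r = (1 + r * r) / 2" for r :: real
  define y where "y n = (f ^^ n) 0" for n
  define Y where "Y n = (F ^^ n) 0" for n
  have y0: "y 0 = 0" "y (Suc n) = f (y n)" and Y0: "Y 0 = 0" "Y (Suc n) = F (Y n)" for n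
    by (simp_all add: y_def Y_def)
  have Yb: "0 \<le> Y n \<and> Y n \<le> 1" for n
  proof (induction n)
    case (Suc n)
    then have "Y n * Y n \<le> 1" by (simp add: mult_le_one)
    then show ?case by (simp add: Y0 F_def)
  qed (simp add: Y0)
  have ny: "norm (y n) \<le> Y n" for n
  proof (induction n)
    case (Suc n)
    have "norm (y n * y n) \<le> Y n * Y n"
      using norm_mult_ineq[of "y n" "y n"] mult_mono[OF Suc Suc] Yb[of n] by simp
    then show ?case
      using norm_triangle_ineq[of "1 - h" "y n * y n"] h(2) by (simp add: y0 Y0 f_def F_def)
  qed (simp add: y0 Y0)
  have step: "norm (y (Suc n) - y n) \<le> Y (Suc n) - Y n" for n
  proof (induction n)
    case 0
    show ?case using h(2) by (simp add: y0 Y0 f_def F_def)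
  next
    case (Suc n)
    let ?d = "y (Suc n) - y n" and ?D = "Y (Suc n) - Y n"
    have "y (Suc (Suc n)) - y (Suc n) = (1/2) *\<^sub>R (?d * y (Suc n) + y n * ?d)"
    proof -
      have "y (Suc (Suc n)) - y (Suc n) = f (y (Suc n)) - f (y n)" by (simp only: y0)
      then show ?thesis by (simp add: f_def algebra_simps)
    qed
    moreover have "norm (?d * y (Suc n)) \<le> ?D * Y (Suc n)"
      using norm_mult_ineq[of ?d "y (Suc n)"] mult_mono[OF Suc ny[of "Suc n"]]
        order_trans[OF norm_ge_zero Suc] by simp
    moreover have "norm (y n * ?d) \<le> Y n * ?D"
      using norm_mult_ineq[of "y n" ?d] mult_mono[OF ny[of n] Suc] Yb[of n] by simp
    ultimately have "norm (y (Suc (Suc n)) - y (Suc n)) \<le> (?D * Y (Suc n) + Y n * ?D) / 2"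
      using norm_triangle_ineq[of "?d * y (Suc n)" "y n * ?d"] by simp
    also have "\<dots> = Y (Suc (Suc n)) - Y (Suc n)"
    proof -
      have "Y (Suc (Suc n)) - Y (Suc n) = F (Y (Suc n)) - F (Y n)" by (simp only: Y0)
      then show ?thesis by (simp add: F_def field_simps)
    qed
    finally show ?case .
  qed
  have "incseq Y"
  proof (rule incseq_SucI)
    show "Y n \<le> Y (Suc n)" for n using order_trans[OF norm_ge_zero step[of n]] by simp
  qed
  moreover have "\<And>n. Y n \<le> 1" using Yb by blast
  ultimately have "convergent Y"
    using incseq_convergent[of Y 1] by (blast intro: convergentI)
  then have CY: "Cauchy Y" by (rule convergent_Cauchy)
  have diff: "norm (y (n + k) - y n) \<le> Y (n + k) - Y n" for n k
  proof (induction k)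
    case (Suc k)
    have "norm (y (n + Suc k) - y n) \<le> norm (y (Suc (n + k)) - y (n + k)) + norm (y (n + k) - y n)"
      using norm_triangle_ineq[of "y (Suc (n + k)) - y (n + k)" "y (n + k) - y n"] by simp
    then show ?case using step[of "n + k"] Suc by simp
  qed simp
  have dist: "dist (y m) (y n) \<le> dist (Y m) (Y n)" for m n
  proof (rule linorder_le_cases[of m n])
    assume "m \<le> n"
    then show ?thesis using diff[of m "n - m"] by (simp add: dist_norm norm_minus_commute)
  next
    assume "n \<le> m"
    then show ?thesis using diff[of n "m - n"] by (simp add: dist_norm)
  qed
  have "Cauchy y"
    using CY dist unfolding Cauchy_def by (meson order_le_less_trans)
  then obtain z where z: "y \<longlonglongrightarrow> z" by (auto simp: Cauchy_convergent_iff convergent_def)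
  \<comment> \<open>The iterates are polynomials in \<open>h\<close>, so they are self-adjoint and commute with its commutant.\<close>
  have inv: "star (y n) = y n \<and> (\<forall>g. g * h = h * g \<longrightarrow> g * y n = y n * g)" for n
  proof (induction n)
    case (Suc n)
    have "g * f (y n) = f (y n) * g" if g: "g * h = h * g" for g
    proof -
      have "g * y n = y n * g" using Suc g by blast
      then have "g * (y n * y n) = y n * y n * g" by (metis mult.assoc)
      then show ?thesis by (simp add: f_def algebra_simps g)
    qed
    moreover have "star (f (y n)) = f (y n)"
    proof -
      have "star (y n) = y n" using Suc by blast
      then show ?thesis by (simp add: f_def star_scaleR star_add star_mult star_diff h(1))
    qed
    ultimately show ?case by (simp only: y0) blast
  qed (simp add: y0)
  have inv1: "star (y n) = y n" for n using inv[of n] by blast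
  have inv2: "g * y n = y n * g" if "g * h = h * g" for g n using inv[of n] that by blast
  have "(\<lambda>n. f (y n)) \<longlonglongrightarrow> f z" unfolding f_def by (intro tendsto_intros z)
  moreover have "(\<lambda>n. f (y n)) \<longlonglongrightarrow> z" using LIMSEQ_Suc[OF z] by (simp add: y0)
  ultimately have "f z = z" by (rule LIMSEQ_unique)
  then have "(1 - h) + z * z = 2 *\<^sub>R z"
    using arg_cong[of "f z" z "\<lambda>x. 2 *\<^sub>R x"] unfolding f_def scaleR_scaleR by simp
  then have "(1 - z) * (1 - z) = h" by (simp add: algebra_simps scaleR_2)
  moreover have "star (1 - z) = 1 - z"
  proof -
    have "(\<lambda>n. star (y n)) \<longlonglongrightarrow> star z" by (rule isCont_tendsto_compose[OF isCont_star z])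
    then have "y \<longlonglongrightarrow> star z" by (simp only: inv1)
    then have "star z = z" by (metis LIMSEQ_unique z)
    then show ?thesis by (simp add: star_diff)
  qed
  moreover have "norm (1 - (1 - z)) \<le> 1"
  proof -
    have "norm (y n) \<le> 1" for n using ny[of n] Yb[of n] by linarith
    then show ?thesis using LIMSEQ_le_const2[OF tendsto_norm[OF z], of 1] by simp
  qed
  moreover have "g * (1 - z) = (1 - z) * g" if "g * h = h * g" for g
  proof -
    have "(\<lambda>n. g * y n) \<longlonglongrightarrow> g * z" "(\<lambda>n. y n * g) \<longlonglongrightarrow> z * g"
      by (intro tendsto_intros z)+
    then have "g * z = z * g" unfolding inv2[OF that] by (rule LIMSEQ_unique)
    then show ?thesis by (simp add: algebra_simps)
  qed
  ultimately show thesis using that by blast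
qed

text \<open>The element \<open>a + ib\<close> below is unitary and \<open>a\<close> is its real part.\<close>

lemma norm_le_one_of_squares:
  fixes a b :: "'a::cstar_algebra"
  assumes a: "star a = a" and b: "star b = b" and comm: "a * b = b * a" and one: "a * a + b * b = 1"
  shows "norm a \<le> 1"
proof -
  define u where "u = a + \<i> *\<^sub>C b"
  have su: "star u = a + (- \<i>) *\<^sub>C b" by (simp add: u_def star_add star_scaleC a b)
  have cancel: "\<i> *\<^sub>C z + (- \<i>) *\<^sub>C z = 0" for z :: 'a
    by (simp flip: scaleC_add_left)
  have "star u * u = a * a + b * b + (\<i> *\<^sub>C (a * b) + (- \<i>) *\<^sub>C (a * b))"
    unfolding su unfolding u_def
    by (simp add: distrib_left distrib_right scaleC_mult_left scaleC_mult_right scaleC_scaleC comm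
        scaleC_add_right)
  then have "(norm u)\<^sup>2 = 1"
    using cstar_identity[of u] by (simp add: one cancel)
  then have nu: "norm u = 1"
    using norm_ge_zero[of u] by (simp add: power2_eq_1_iff)
  have "u + star u = 2 *\<^sub>R a"
    unfolding su unfolding u_def using cancel[of b] by (simp add: algebra_simps scaleR_2)
  then have "2 * norm a = norm (u + star u)" by simp
  also have "\<dots> \<le> 2" using norm_triangle_ineq[of u "star u"] nu by simp
  finally show ?thesis by simp
qed

lemma norm_one_minus_square:
  fixes k :: "'a::cstar_algebra"
  assumes "star k = k" "norm k \<le> 1"
  shows "norm (1 - k * k) \<le> 1"
proof -
  have "norm (k * k) \<le> 1"
    using norm_mult_ineq[of k k] assms(2) by (meson mult_le_one norm_ge_zero order_trans)
  then have "norm (1 - (1 - k * k)) \<le> 1" by simp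
  moreover have "star (1 - k * k) = 1 - k * k" using assms by (simp add: star_diff star_mult)
  ultimately obtain m where m: "star m = m" "m * m = 1 - k * k"
    "\<And>g. g * (1 - k * k) = (1 - k * k) * g \<Longrightarrow> g * m = m * g"
    using sqrt_of_near_one by blast
  have "k * m = m * k" by (rule m(3)) (simp add: algebra_simps)
  then have "norm m \<le> 1"
    by (intro norm_le_one_of_squares[of m k]) (simp_all add: m(1,2) assms(1))
  then show ?thesis
    unfolding m(2)[symmetric] using norm_mult_ineq[of m m] by (meson mult_le_one norm_ge_zero order_trans)
qed

lemma star_of_real [simp]: "star (of_real t) = (of_real t :: 'a::cstar_algebra)"
  by (simp add: of_real_def star_scaleR)

lemma of_real_commute: "of_real t * x = x * (of_real t :: 'a::real_algebra_1)"
  by (simp add: of_real_def)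

lemma pos_elem_star: "pos_elem h \<Longrightarrow> star h = h"
  by (auto simp: pos_elem_def star_mult)

lemma pos_elem_scaleR: "pos_elem h \<Longrightarrow> 0 \<le> r \<Longrightarrow> pos_elem (r *\<^sub>R h)"
proof -
  assume "pos_elem h" "0 \<le> r"
  then obtain k where "star k = k" "h = k * k" by (auto simp: pos_elem_def)
  then have "star (sqrt r *\<^sub>R k) = sqrt r *\<^sub>R k" "r *\<^sub>R h = (sqrt r *\<^sub>R k) * (sqrt r *\<^sub>R k)"
    using \<open>0 \<le> r\<close> by (simp_all add: star_scaleR)
  then show ?thesis unfolding pos_elem_def by blast
qed

lemma pos_elem_zero [simp]: "pos_elem 0"
  unfolding pos_elem_def by (rule exI[of _ 0]) simp

lemma pos_elem_square: "star k = k \<Longrightarrow> pos_elem (k * k)"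
  by (auto simp: pos_elem_def)

lemma sqrt_of_near_real:
  assumes h: "star h = h" and t: "norm (of_real t - h) \<le> t"
  obtains k where "star k = k" "k * k = h" "pos_elem k" "\<And>g. g * h = h * g \<Longrightarrow> g * k = k * g"
proof (cases "t = 0")
  case True
  then have "h = 0" using t by simp
  then show thesis using that[of 0] by simp
next
  case False
  then have t0: "t > 0" using order_trans[OF norm_ge_zero t] by simp
  have eq: "1 - (1/t) *\<^sub>R h = (1/t) *\<^sub>R (of_real t - h)"
    using t0 by (simp add: of_real_def algebra_simps)
  have "norm (1 - (1/t) *\<^sub>R h) \<le> 1"
    unfolding eq using t t0 by simp
  moreover have "star ((1/t) *\<^sub>R h) = (1/t) *\<^sub>R h" by (simp add: star_scaleR h)
  ultimately obtain k where k: "star k = k" "k * k = (1/t) *\<^sub>R h" "norm (1 - k) \<le> 1"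
    "\<And>g. g * ((1/t) *\<^sub>R h) = ((1/t) *\<^sub>R h) * g \<Longrightarrow> g * k = k * g"
    using sqrt_of_near_one by blast
  obtain m where "star m = m" "m * m = k" by (rule sqrt_of_near_one[OF k(1,3)])
  then have "pos_elem k" by (auto simp: pos_elem_def)
  show thesis
  proof (rule that[of "sqrt t *\<^sub>R k"])
    show "star (sqrt t *\<^sub>R k) = sqrt t *\<^sub>R k" by (simp add: star_scaleR k(1))
    show "sqrt t *\<^sub>R k * sqrt t *\<^sub>R k = h" using t0 k(2) by (simp)
    show "pos_elem (sqrt t *\<^sub>R k)" using \<open>pos_elem k\<close> t0 by (simp add: pos_elem_scaleR)
    show "g * sqrt t *\<^sub>R k = sqrt t *\<^sub>R k * g" if "g * h = h * g" for g
      using k(4)[of g] that by simp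
  qed
qed

lemma pos_elemI: "star h = h \<Longrightarrow> norm (of_real t - h) \<le> t \<Longrightarrow> pos_elem h"
  by (erule (1) sqrt_of_near_real) (blast intro: pos_elem_square elim: subst)

lemma pos_elem_norm_le:
  assumes "pos_elem h" "norm h \<le> t"
  shows "norm (of_real t - h) \<le> t"
proof (cases "t = 0")
  case False
  then have t0: "t > 0" using order_trans[OF norm_ge_zero assms(2)] by simp
  obtain k where k: "star k = k" "h = k * k" using assms(1) by (auto simp: pos_elem_def)
  define m where "m = (1 / sqrt t) *\<^sub>R k"
  have "(norm k)\<^sup>2 = norm h" using cstar_identity[of k] k by simp
  then have "(norm k)\<^sup>2 \<le> t" using assms(2) by simp
  then have "norm k \<le> sqrt t" by (simp add: real_le_rsqrt)
  then have "norm m \<le> 1" using t0 by (simp add: m_def)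
  moreover have "star m = m" by (simp add: m_def star_scaleR k(1))
  ultimately have "norm (1 - m * m) \<le> 1" by (rule norm_one_minus_square[rotated])
  moreover have "of_real t - h = t *\<^sub>R (1 - m * m)"
    using t0 by (simp add: m_def k of_real_def algebra_simps)
  ultimately show ?thesis using t0 by simp
qed (use assms in simp)

lemma pos_elem_iff: "pos_elem h \<longleftrightarrow> star h = h \<and> norm (of_real (norm h) - h) \<le> norm h"
  using pos_elem_norm_le pos_elem_star pos_elemI by blast

lemma pos_elem_sqrt:
  assumes "pos_elem h"
  obtains k where "star k = k" "k * k = h" "pos_elem k" "\<And>g. g * h = h * g \<Longrightarrow> g * k = k * g"
  using assms unfolding pos_elem_iff[of h] by (meson sqrt_of_near_real)

lemma pos_elem_add:
  assumes "pos_elem h" "pos_elem k" shows "pos_elem (h + k)"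
proof (rule pos_elemI)
  show "star (h + k) = h + k" using assms by (simp add: star_add pos_elem_star)
  have "of_real (norm h + norm k) - (h + k) = (of_real (norm h) - h) + (of_real (norm k) - k)"
    by simp
  then show "norm (of_real (norm h + norm k) - (h + k)) \<le> norm h + norm k"
    using norm_triangle_ineq[of "of_real (norm h) - h" "of_real (norm k) - k"]
      pos_elem_norm_le[OF assms(1) order_refl] pos_elem_norm_le[OF assms(2) order_refl]
    by (simp only:)
qed

lemma closed_pos_elem: "closed {h. pos_elem h}"
proof -
  have "closed {h :: 'a. star h = h}"
    by (intro closed_Collect_eq continuous_star continuous_on_id)
  moreover have "closed {h :: 'a. norm (of_real (norm h) - h) \<le> norm h}"
    by (intro closed_Collect_le continuous_intros)
  ultimately show ?thesis unfolding pos_elem_iff by (rule closed_Collect_conj)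
qed

lemma pos_elem_mult_commute:
  assumes p: "pos_elem p" and q: "pos_elem q" and comm: "p * q = q * p"
  shows "pos_elem (p * q)"
proof -
  obtain m where m: "star m = m" "m * m = p" "\<And>g. g * p = p * g \<Longrightarrow> g * m = m * g"
    using pos_elem_sqrt[OF p] by blast
  have qm: "q * m = m * q" using m(3) comm by simp
  obtain n where n: "star n = n" "n * n = q" "\<And>g. g * q = q * g \<Longrightarrow> g * n = n * g"
    using pos_elem_sqrt[OF q] by blast
  have mn: "m * n = n * m" using n(3) qm by simp
  then have "(m * n) * (m * n) = p * q"
    by (metis m(2) n(2) mult.assoc)
  moreover have "star (m * n) = m * n" by (simp add: star_mult m(1) n(1) mn)
  ultimately show ?thesis by (metis pos_elem_square)
qed

lemma pos_elem_of_real: "0 \<le> t \<Longrightarrow> pos_elem (of_real t)"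
  using pos_elem_scaleR[OF pos_elem_square[of 1], of t] by (simp add: of_real_def)

lemma pos_elem_of_real_norm_diff: "star h = h \<Longrightarrow> norm h \<le> t \<Longrightarrow> pos_elem (of_real t - h)"
  by (rule pos_elemI[of _ t]) (simp_all add: star_diff)

text \<open>
  After scaling, \<open>h\<close> and \<open>1 - h\<close> have commuting self-adjoint square roots, and
  \<open>norm_le_one_of_squares\<close> bounds the first of them.
\<close>

lemma norm_le_of_pos_elem:
  fixes h :: "'a::cstar_algebra"
  assumes h: "pos_elem h" and th: "pos_elem (of_real t - h)" and t: "0 \<le> t"
  shows "norm h \<le> t"
proof -
  \<comment> \<open>Dividing by \<open>s > t\<close> instead of \<open>t\<close> avoids the case \<open>t = 0\<close>.\<close>
  have less: "norm h \<le> s" if s: "t < s" for s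
  proof -
    define g where "g = (1/s) *\<^sub>R h"
    have s0: "s > 0" using s t by simp
    have "of_real s - h = (of_real t - h) + of_real (s - t)" by simp
    then have "pos_elem (of_real s - h)"
      using pos_elem_add[OF th pos_elem_of_real[of "s - t"]] s by simp
    then have "pos_elem ((1/s) *\<^sub>R (of_real s - h))" using s0 by (intro pos_elem_scaleR) auto
    moreover have "(1/s) *\<^sub>R (of_real s - h) = 1 - g"
      using s0 by (simp add: g_def of_real_def algebra_simps)
    ultimately have p1: "pos_elem (1 - g)" by simp
    have p: "pos_elem g" using h s0 by (simp add: g_def pos_elem_scaleR)
    obtain a where a: "star a = a" "a * a = g" "\<And>x. x * g = g * x \<Longrightarrow> x * a = a * x"
      using pos_elem_sqrt[OF p] by blast
    obtain b where b: "star b = b" "b * b = 1 - g" "\<And>x. x * (1 - g) = (1 - g) * x \<Longrightarrow> x * b = b * x"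
      using pos_elem_sqrt[OF p1] by blast
    have "a * g = g * a" unfolding a(2)[symmetric] by (rule mult.assoc[symmetric])
    then have "a * (1 - g) = (1 - g) * a" by (simp add: algebra_simps)
    then have "a * b = b * a" using b(3) by simp
    then have "norm a \<le> 1" by (intro norm_le_one_of_squares[of a b]) (simp_all add: a(1,2) b(1,2))
    then have "norm g \<le> 1"
      using cstar_identity[of a] a(1,2) by (simp add: power_le_one_iff)
    then show ?thesis using s0 by (simp add: g_def field_simps)
  qed
  then show ?thesis by (rule dense_ge)
qed

lemma norm_mono_pos_elem:
  assumes "pos_elem p" "pos_elem (q - p)"
  shows "norm p \<le> norm q"
proof (rule norm_le_of_pos_elem[OF assms(1)])
  have "pos_elem q" using pos_elem_add[OF assms] by simp
  then have "pos_elem (of_real (norm q) - q)"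
    by (intro pos_elem_of_real_norm_diff) (auto simp: pos_elem_star)
  then show "pos_elem (of_real (norm q) - p)"
    using pos_elem_add[OF _ assms(2), of "of_real (norm q) - q"] by simp
qed simp

lemma self_adjoint_square_zero: "star z = z \<Longrightarrow> z * z = 0 \<Longrightarrow> z = (0::'a::cstar_algebra)"
  using cstar_identity[of z] by simp

lemma self_adjoint_parts:
  fixes y :: "'a::cstar_algebra"
  obtains p q where "star p = p" "star q = q" "star y * y + y * star y = 2 *\<^sub>R (p * p + q * q)"
proof
  let ?p = "(1/2) *\<^sub>R (y + star y)" and ?q = "((1/2) * \<i>) *\<^sub>C (star y - y)"
  show "star ?p = ?p" by (simp add: star_scaleR star_add star_star add.commute)
  show "star ?q = ?q"
  proof -
    have "star ?q = - ((1/2) * \<i>) *\<^sub>C (y - star y)"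
      by (simp add: star_scaleC star_diff star_star)
    also have "\<dots> = - ((1/2) * \<i>) *\<^sub>C ((- 1) *\<^sub>C (star y - y))"
      using scaleC_of_real[of "-1" "star y - y"] by simp
    finally show ?thesis by (simp add: scaleC_scaleC)
  qed
  have "?q * ?q = (- 1/4) *\<^sub>R ((star y - y) * (star y - y))"
    using scaleC_of_real[of "-1/4" "(star y - y) * (star y - y)"]
    by (simp add: scaleC_mult_left scaleC_mult_right scaleC_scaleC)
  moreover have "?p * ?p = (1/4) *\<^sub>R ((y + star y) * (y + star y))" by simp
  ultimately have "2 *\<^sub>R (?p * ?p + ?q * ?q) =
      (1/2) *\<^sub>R ((y + star y) * (y + star y) - (star y - y) * (star y - y))"
    by (simp only: scaleR_add_right scaleR_scaleR scaleR_diff_right) simp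
  also have "(y + star y) * (y + star y) - (star y - y) * (star y - y)
     = 2 *\<^sub>R (star y * y + y * star y)"
    by (simp add: algebra_simps scaleR_2)
  finally show "star y * y + y * star y = 2 *\<^sub>R (?p * ?p + ?q * ?q)" by simp
qed

text \<open>
  The heart of Kaplansky's theorem: an element of the form \<open>star y * y\<close> is negative only if it
  vanishes. Write \<open>c = y * star y\<close> and \<open>l = norm d\<close>. Since \<open>star y * y + c\<close> is a sum of squares, \<open>c\<close> is
  positive, and \<open>c * y = - (y * d)\<close> gives \<open>y * (l + d) = (l - c) * y\<close>, hence
  \<open>norm ((l + d) * d * (l + d)) \<le> l ^ 3\<close>. As \<open>norm d = l\<close>, this is impossible unless \<open>l = 0\<close>.
\<close>

lemma negative_star_mult_self:
  fixes y :: "'a::cstar_algebra"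
  assumes d: "pos_elem d" and y: "star y * y = - d"
  shows "d = 0"
proof -
  define c where "c = y * star y"
  define l where "l = norm d"
  have l0: "0 \<le> l" by (simp add: l_def)
  obtain p q where pq: "star p = p" "star q = q" "star y * y + y * star y = 2 *\<^sub>R (p * p + q * q)"
    by (rule self_adjoint_parts)
  have "c = 2 *\<^sub>R (p * p + q * q) + d" using pq(3) y by (simp add: c_def algebra_simps)
  then have c: "pos_elem c"
    using d pq by (simp add: pos_elem_add pos_elem_scaleR pos_elem_square)
  have ny: "(norm y)\<^sup>2 = l" using cstar_identity[of y] y by (simp add: l_def)
  have "norm c = l" using cstar_identity[of "star y"] ny by (simp add: c_def star_star)
  then have cl: "norm (of_real l - c) \<le> l" using pos_elem_norm_le[OF c] by simp
  define e where "e = of_real l + d"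
  have se: "star e = e" by (simp add: e_def star_add pos_elem_star[OF d])
  have "c * y = - (y * d)" by (simp add: c_def mult.assoc y)
  then have ye: "y * e = (of_real l - c) * y"
    by (simp add: e_def algebra_simps of_real_commute)
  have "norm (y * e) \<le> l * norm y"
    using norm_mult_ineq[of "of_real l - c" y] mult_right_mono[OF cl norm_ge_zero[of y]]
    by (simp add: ye)
  then have "(norm (y * e))\<^sup>2 \<le> l\<^sup>2 * (norm y)\<^sup>2"
    by (metis norm_ge_zero power_mono power_mult_distrib)
  moreover have "star (y * e) * (y * e) = - (e * d * e)"
  proof -
    from se have "star (y * e) * (y * e) = e * (star y * y) * e" by (simp add: star_mult mult.assoc)
    then show ?thesis by (simp add: y)
  qed
  ultimately have ned: "norm (e * d * e) \<le> l ^ 3"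
    using cstar_identity[of "y * e"] unfolding ny by (simp add: power3_eq_cube power2_eq_square)
  have ede: "e * d * e = l\<^sup>2 *\<^sub>R d + (2 * l) *\<^sub>R (d * d) + d * d * d"
    by (simp add: e_def algebra_simps of_real_def power2_eq_square) (simp flip: scaleR_left.add)
  have sd: "star d = d" by (rule pos_elem_star[OF d])
  have dd: "pos_elem (d * d)" using sd by (rule pos_elem_square)
  have ddd: "pos_elem (d * d * d)" by (rule pos_elem_mult_commute[OF dd d]) (simp add: mult.assoc)
  \<comment> \<open>Adding \<open>d ^ 3\<close> and \<open>2 * l * (d - l) ^ 2\<close> leaves only terms linear in \<open>d\<close>: \<open>5 * l ^ 2 * d \<le> 3 * l ^ 3\<close>.\<close>
  have "pos_elem (of_real (l^3) - e * d * e)"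
    by (rule pos_elem_of_real_norm_diff) (use ned in \<open>simp_all add: star_mult sd se mult.assoc\<close>)
  moreover have "pos_elem ((2 * l) *\<^sub>R ((d - of_real l) * (d - of_real l)))"
    by (intro pos_elem_scaleR pos_elem_square) (simp_all add: star_diff sd l0)
  ultimately have "pos_elem ((of_real (l^3) - e * d * e) + d * d * d
      + (2 * l) *\<^sub>R ((d - of_real l) * (d - of_real l)))"
    using ddd by (intro pos_elem_add)
  also have "(of_real (l^3) - e * d * e) + d * d * d + (2 * l) *\<^sub>R ((d - of_real l) * (d - of_real l))
      = (3 * l^3) *\<^sub>R 1 - (5 * l\<^sup>2) *\<^sub>R d"
  proof -
    have sq: "(d - of_real l) * (d - of_real l) = d * d - (2 * l) *\<^sub>R d + l\<^sup>2 *\<^sub>R 1"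
      by (simp add: algebra_simps of_real_def power2_eq_square) (simp flip: scaleR_left.add)
    have "(3 * l^3) *\<^sub>R (1::'a) = l^3 *\<^sub>R 1 + (2 * l * l\<^sup>2) *\<^sub>R 1"
      "(5 * l\<^sup>2) *\<^sub>R d = l\<^sup>2 *\<^sub>R d + (2 * l * (2 * l)) *\<^sub>R d"
      by (simp_all add: power2_eq_square power3_eq_cube flip: scaleR_left.add)
    then show ?thesis
      unfolding ede sq by (simp add: of_real_def scaleR_diff_right scaleR_add_right)
  qed
  finally have pp: "pos_elem ((3 * l^3) *\<^sub>R 1 - (5 * l\<^sup>2) *\<^sub>R d)" .
  have "l = 0"
  proof (rule ccontr)
    assume "l \<noteq> 0"
    then have l: "l > 0" using l0 by simp
    have "pos_elem ((1 / (5 * l\<^sup>2)) *\<^sub>R ((3 * l^3) *\<^sub>R 1 - (5 * l\<^sup>2) *\<^sub>R d))"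
      using pp by (rule pos_elem_scaleR) simp
    also have "(1 / (5 * l\<^sup>2)) *\<^sub>R ((3 * l^3) *\<^sub>R 1 - (5 * l\<^sup>2) *\<^sub>R d) = of_real (3/5 * l) - d"
      using l by (simp add: of_real_def scaleR_diff_right power2_eq_square power3_eq_cube)
    finally have "norm d \<le> 3/5 * l" by (rule norm_le_of_pos_elem[OF d]) (use l in simp)
    then show False using l by (simp add: l_def)
  qed
  then show ?thesis by (simp add: l_def)
qed

theorem pos_elem_star_mult_self:
  fixes x :: "'a::cstar_algebra"
  shows "pos_elem (star x * x)"
proof -
  define h where "h = star x * x"
  have h: "star h = h" by (simp add: h_def star_mult star_star)
  have hh: "pos_elem (h * h)" using h by (rule pos_elem_square)
  obtain a where a: "star a = a" "a * a = h * h" "pos_elem a"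
      "\<And>g. g * (h * h) = h * h * g \<Longrightarrow> g * a = a * g"
    using pos_elem_sqrt[OF hh] by blast
  have ha: "h * a = a * h" by (rule a(4)) (simp add: mult.assoc)
  obtain k where k: "star k = k" "k * k = a" "\<And>g. g * a = a * g \<Longrightarrow> g * k = k * g"
    using pos_elem_sqrt[OF a(3)] by blast
  \<comment> \<open>\<open>a\<close> is the absolute value of \<open>h\<close> and \<open>n\<close> its negative part; \<open>x * n\<close> has a negative square.\<close>
  define n where "n = (1/2) *\<^sub>R (a - h)"
  have n: "star n = n" by (simp add: n_def star_scaleR star_diff a(1) h)
  have na: "n * a = a * n" by (simp add: n_def algebra_simps ha)
  have nk: "n * k = k * n" by (rule k(3)[OF na])
  have hn: "h * n = - (a * n)" by (simp add: n_def algebra_simps a(2) ha)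
  have "star (x * n) * (x * n) = n * (h * n)" by (simp add: star_mult n h_def mult.assoc)
  also have "\<dots> = - ((k * n) * (k * n))"
    by (simp add: hn flip: k(2)) (metis nk mult.assoc)
  finally have *: "star (x * n) * (x * n) = - ((k * n) * (k * n))" .
  have skn: "star (k * n) = k * n" by (simp add: star_mult k(1) n nk)
  have "(k * n) * (k * n) = 0" by (rule negative_star_mult_self[OF pos_elem_square[OF skn] *])
  then have "k * n = 0" by (rule self_adjoint_square_zero[OF skn])
  then have "a * n = 0" by (simp flip: k(2) add: mult.assoc)
  then have "a * a = a * h" by (simp add: n_def algebra_simps)
  then have "(a - h) * (a - h) = 0" using a(2) ha by (simp add: algebra_simps)
  then have "a = h" using self_adjoint_square_zero[of "a - h"] by (simp add: star_diff a(1) h)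
  then show ?thesis using a(3) by (simp add: h_def)
qed

lemma pos_elem_iff_star_mult: "pos_elem h \<longleftrightarrow> (\<exists>y. h = star y * y)"
  by (metis pos_elem_def pos_elem_star_mult_self)

lemma pos_elem_conj: "pos_elem h \<Longrightarrow> pos_elem (star x * h * x)"
proof -
  assume "pos_elem h"
  then obtain y where "h = star y * y" by (auto simp: pos_elem_iff_star_mult)
  then have "star x * h * x = star (y * x) * (y * x)" by (simp add: star_mult mult.assoc)
  then show ?thesis by (simp only: pos_elem_star_mult_self)
qed

section \<open>Positive definite kernels of partial isometries\<close>

text \<open>
  Kernels whose entries are partial isometries that compose up to range projections:
  \<open>G i j * G j i\<close> is the range projection of \<open>G i j\<close>, for fixed \<open>i\<close> these projections commute, and
  \<open>G i j * G j k\<close> is \<open>G i k\<close> cut down to the range of \<open>G i j\<close>. The diagonal entries are projections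
  that need not be \<open>1\<close>, which makes the class stable under the cutting operation below.
\<close>

definition partial_isometry_kernel :: "('s \<Rightarrow> 's \<Rightarrow> 'b::cstar_algebra) \<Rightarrow> bool" where
  "partial_isometry_kernel G \<longleftrightarrow>
     (\<forall>i j. star (G i j) = G j i) \<and>
     (\<forall>i j k. G i j * G j k = G i j * G j i * G i k) \<and>
     (\<forall>i j. G i j * G j j = G i j) \<and>
     (\<forall>i j k. (G i j * G j i) * (G i k * G k i) = (G i k * G k i) * (G i j * G j i))"

context
  fixes G :: "'s \<Rightarrow> 's \<Rightarrow> 'b::cstar_algebra"
  assumes G: "partial_isometry_kernel G"
begin

lemma kernel_star: "star (G i j) = G j i"
  by (rule G[unfolded partial_isometry_kernel_def, THEN conjunct1, rule_format])

lemma kernel_compose: "G i j * G j k = G i j * G j i * G i k"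
  by (rule G[unfolded partial_isometry_kernel_def, THEN conjunct2, THEN conjunct1, rule_format])

lemma kernel_diag_right: "G i j * G j j = G i j"
  by (rule G[unfolded partial_isometry_kernel_def, THEN conjunct2, THEN conjunct2, THEN conjunct1, rule_format])

lemma kernel_diag_left: "G i i * G i j = G i j"
  using arg_cong[OF kernel_diag_right[of j i], of star] by (simp add: star_mult kernel_star)

lemma kernel_ranges_commute: "(G i j * G j i) * (G i k * G k i) = (G i k * G k i) * (G i j * G j i)"
  by (rule G[unfolded partial_isometry_kernel_def, THEN conjunct2, THEN conjunct2, THEN conjunct2, rule_format])

lemma kernel_partial_isometry: "G i j * G j i * G i j = G i j"
  using kernel_compose[of i j j] kernel_diag_right[of i j] by simp

lemma kernel_intertwine: "(G i r * G r i) * G i j = G i j * (G j r * G r j)"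
proof -
  have "G i j * (G j r * G r j) = (G i j * G j r) * G r j" by (simp add: mult.assoc)
  also have "\<dots> = (G i j * G j i) * (G i r * G r j)" by (simp add: kernel_compose[of i j r] mult.assoc)
  also have "\<dots> = (G i j * G j i) * (G i r * G r i * G i j)" by (simp add: kernel_compose[of i r j])
  also have "\<dots> = ((G i j * G j i) * (G i r * G r i)) * G i j" by (simp add: mult.assoc)
  also have "\<dots> = (G i r * G r i) * (G i j * G j i * G i j)"
    unfolding kernel_ranges_commute[of i j r] by (simp only: mult.assoc)
  finally show ?thesis by (simp only: kernel_partial_isometry)
qed

text \<open>
  Removing the part of the kernel that factors through the index \<open>r\<close> leaves a kernel of the same
  kind, which vanishes in row and column \<open>r\<close>.
\<close>

lemma partial_isometry_kernel_cut:
  "partial_isometry_kernel (\<lambda>i j. (1 - G i r * G r i) * G i j)"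
proof -
  define p where "p i = 1 - G i r * G r i" for i
  have pp: "p i * p i = p i" for i
  proof -
    have "(G i r * G r i) * (G i r * G r i) = G i r * G r i"
      using kernel_partial_isometry[of i r] by (metis mult.assoc)
    then show ?thesis by (simp add: p_def algebra_simps)
  qed
  have pp': "p i * (p i * x) = p i * x" for i x by (metis pp mult.assoc)
  have pG: "G i j * p j = p i * G i j" for i j
    using kernel_intertwine[of i r j] by (simp add: p_def algebra_simps)
  have pG': "G i j * (p j * x) = p i * (G i j * x)" for i j x by (metis pG mult.assoc)
  have star_p: "star (p i) = p i" for i by (simp add: p_def star_diff star_mult kernel_star)
  have comm: "G i j * (G j i * (G i k * G k i)) = G i k * (G k i * (G i j * G j i))" for i j k
    using kernel_ranges_commute[of i j k] by (simp only: mult.assoc)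
  have comp: "G i j * (G j i * G i k) = G i j * G j k" for i j k
    using kernel_compose[of i j k] by (simp only: mult.assoc)
  show ?thesis
    unfolding partial_isometry_kernel_def p_def[symmetric]
    by (simp add: star_mult star_p kernel_star pG mult.assoc pG' pp' kernel_diag_right comp comm)
qed

end

text \<open>
  Positive definiteness, by induction on the finite index set: the part that factors through \<open>r\<close>
  contributes a square \<open>star g * g\<close>, and the remainder no longer sees \<open>r\<close>.
\<close>

lemma partial_isometry_kernel_pos:
  assumes "finite F" "partial_isometry_kernel G"
  shows "pos_elem (\<Sum>i\<in>F. \<Sum>j\<in>F. star (b i) * G i j * b j)"
  using assms
proof (induction F arbitrary: G)
  case (insert r F)
  note G = insert.prems
  define G' where "G' i j = (1 - G i r * G r i) * G i j" for i j
  have G': "partial_isometry_kernel G'"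
    unfolding G'_def by (rule partial_isometry_kernel_cut[OF G])
  define g where "g = (\<Sum>j\<in>insert r F. G r j * b j)"
  have split: "G i j = G i r * G r j + G' i j" for i j
  proof -
    have "G i r * G r i * G i j = G i r * G r j"
      by (rule kernel_compose[OF G, symmetric])
    then show ?thesis by (simp add: G'_def algebra_simps)
  qed
  have z1: "G' r j = 0" for j
    using kernel_diag_left[OF G, of r j] by (simp add: G'_def algebra_simps)
  have z2: "G' j r = 0" for j
    using kernel_star[OF G', of r j] by (simp add: z1)
  have "(\<Sum>i\<in>insert r F. \<Sum>j\<in>insert r F. star (b i) * G i j * b j)
      = (\<Sum>i\<in>insert r F. \<Sum>j\<in>insert r F. (star (b i) * G i r) * (G r j * b j))
        + (\<Sum>i\<in>insert r F. \<Sum>j\<in>insert r F. star (b i) * G' i j * b j)"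
    unfolding sum.distrib[symmetric]
    by (intro sum.cong refl, subst split) (simp add: algebra_simps)
  also have "(\<Sum>i\<in>insert r F. \<Sum>j\<in>insert r F. (star (b i) * G i r) * (G r j * b j)) = star g * g"
    unfolding g_def star_sum sum_product star_mult kernel_star[OF G] ..
  also have "(\<Sum>i\<in>insert r F. \<Sum>j\<in>insert r F. star (b i) * G' i j * b j)
     = (\<Sum>i\<in>F. \<Sum>j\<in>F. star (b i) * G' i j * b j)"
    using insert.hyps by (simp add: z1 z2)
  finally show ?case
    using insert.IH[OF G'] by (simp add: pos_elem_add pos_elem_star_mult_self)
qed simp

section \<open>Inner product modules\<close>

text \<open>
  Pre-Hilbert modules over a C*-algebra: the inner product \<open>form\<close> takes values in the algebra, is
  conjugate linear in the first variable and may be degenerate. Scalars act through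
  \<open>act x (c *\<^sub>C 1)\<close>.
\<close>

locale inner_product_module =
  fixes form :: "'x::ab_group_add \<Rightarrow> 'x \<Rightarrow> 'b::cstar_algebra" and act :: "'x \<Rightarrow> 'b \<Rightarrow> 'x"
  assumes form_add_right: "form x (y + z) = form x y + form x z"
    and form_act_right: "form x (act y b) = form x y * b"
    and form_star: "star (form x y) = form y x"
    and form_pos: "pos_elem (form x x)"
begin

lemma form_add_left: "form (x + y) z = form x z + form y z"
  by (metis form_add_right form_star star_add)

lemma form_act_left: "form (act x b) y = star b * form x y"
  by (metis form_act_right form_star star_mult)

lemma form_diff_right: "form x (y - z) = form x y - form x z"
  using form_add_right[of x "y - z" z] by (simp add: algebra_simps)

lemma form_diff_left: "form (x - y) z = form x z - form y z"
  using form_add_left[of "x - y" y z] by (simp add: algebra_simps)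

lemma form_zero_right [simp]: "form x 0 = 0"
  using form_diff_right[of x 0 0] by simp

lemma form_zero_left [simp]: "form 0 x = 0"
  using form_diff_left[of 0 0 x] by simp

text \<open>
  The seminorm of the module.
\<close>

definition mnorm :: "'x \<Rightarrow> real" where
  "mnorm x = sqrt (norm (form x x))"

lemma mnorm_nonneg [simp]: "0 \<le> mnorm x"
  by (simp add: mnorm_def)

lemma mnorm_square: "(mnorm x)\<^sup>2 = norm (form x x)"
  by (simp add: mnorm_def)

lemma mnorm_zero [simp]: "mnorm 0 = 0"
  by (simp add: mnorm_def)

text \<open>
  The positive element \<open>form z z\<close> for \<open>z = x (form x y) - y\<close> is at most
  \<open>form y y - star (form x y) * form x y\<close>.
\<close>

lemma Cauchy_Schwarz_unit:
  assumes "norm (form x x) \<le> 1"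
  shows "(norm (form x y))\<^sup>2 \<le> norm (form y y)"
proof -
  define a where "a = form x y"
  have "form (act x a - y) (act x a - y)
      = star a * form x x * a - star a * a - star a * a + form y y"
    using form_star[of x y]
    by (simp add: form_diff_left form_diff_right form_act_left form_act_right mult.assoc a_def algebra_simps)
  then have "pos_elem (star a * form x x * a - star a * a - star a * a + form y y)"
    using form_pos[of "act x a - y"] by simp
  moreover have "pos_elem (star a * (of_real 1 - form x x) * a)"
    by (intro pos_elem_conj pos_elem_of_real_norm_diff assms form_star)
  ultimately have "pos_elem ((star a * form x x * a - star a * a - star a * a + form y y)
      + star a * (of_real 1 - form x x) * a)"
    by (rule pos_elem_add)
  then have "pos_elem (form y y - star a * a)" by (simp add: algebra_simps)
  then have "norm (star a * a) \<le> norm (form y y)"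
    by (intro norm_mono_pos_elem pos_elem_star_mult_self)
  then show ?thesis by (simp add: cstar_identity a_def)
qed

lemma form_act_of_real:
  "form (act x (of_real r)) y = r *\<^sub>R form x y" "form y (act x (of_real r)) = r *\<^sub>R form y x"
  by (simp_all add: form_act_left form_act_right) (simp_all add: of_real_def)

lemma Cauchy_Schwarz: "norm (form x y) \<le> mnorm x * mnorm y"
proof -
  have scaled: "r\<^sup>2 * (norm (form x y))\<^sup>2 \<le> norm (form y y)" if "r\<^sup>2 * norm (form x x) \<le> 1" for r
  proof -
    have "norm (form (act x (of_real r)) (act x (of_real r))) = r\<^sup>2 * norm (form x x)"
      by (simp add: form_act_of_real power2_eq_square flip: abs_mult mult.assoc)
    then have "(norm (form (act x (of_real r)) y))\<^sup>2 \<le> norm (form y y)"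
      using that by (intro Cauchy_Schwarz_unit) simp
    then show ?thesis by (simp add: form_act_of_real power_mult_distrib)
  qed
  have "(norm (form x y))\<^sup>2 \<le> norm (form x x) * norm (form y y)"
  proof (cases "norm (form x x) = 0")
    case True
    then have *: "r\<^sup>2 * (norm (form x y))\<^sup>2 \<le> norm (form y y)" for r
      using scaled[of r] by simp
    have "(norm (form x y))\<^sup>2 = 0"
    proof (rule ccontr)
      assume "(norm (form x y))\<^sup>2 \<noteq> 0"
      then have pos: "(norm (form x y))\<^sup>2 > 0" by simp
      define r where "r = sqrt ((norm (form y y) + 1) / (norm (form x y))\<^sup>2)"
      have "r\<^sup>2 = (norm (form y y) + 1) / (norm (form x y))\<^sup>2" by (simp add: r_def)
      then have "r\<^sup>2 * (norm (form x y))\<^sup>2 = norm (form y y) + 1" using pos by simp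
      then show False using *[of r] by simp
    qed
    then show ?thesis by simp
  next
    case False
    then have pos: "norm (form x x) > 0" by simp
    define r where "r = sqrt (1 / norm (form x x))"
    have r: "r\<^sup>2 = 1 / norm (form x x)" by (simp add: r_def)
    show ?thesis using scaled[of r] pos unfolding r by (simp add: field_simps)
  qed
  then have "(norm (form x y))\<^sup>2 \<le> (mnorm x * mnorm y)\<^sup>2"
    by (simp add: mnorm_square power_mult_distrib)
  then show ?thesis by (rule power2_le_imp_le) simp
qed

lemma mnorm_add: "mnorm (x + y) \<le> mnorm x + mnorm y"
proof -
  have "(mnorm (x + y))\<^sup>2 = norm ((form x x + form x y) + (form y x + form y y))"
    by (simp add: mnorm_square form_add_left form_add_right algebra_simps)
  also have "\<dots> \<le> norm (form x x) + norm (form x y) + (norm (form y x) + norm (form y y))"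
    by (meson add_mono norm_triangle_ineq order_trans)
  also have "\<dots> \<le> (mnorm x)\<^sup>2 + mnorm x * mnorm y + (mnorm y * mnorm x + (mnorm y)\<^sup>2)"
    by (intro add_mono Cauchy_Schwarz) (simp_all add: mnorm_square)
  also have "\<dots> = (mnorm x + mnorm y)\<^sup>2" by (simp add: power2_eq_square algebra_simps)
  finally show ?thesis by (rule power2_le_imp_le) simp
qed

lemma mnorm_scale: "mnorm (act x (c *\<^sub>C 1)) = cmod c * mnorm x"
proof -
  have "form (act x (c *\<^sub>C 1)) (act x (c *\<^sub>C 1)) = (cnj c * c) *\<^sub>C form x x"
    by (simp add: form_act_left form_act_right star_scaleC scaleC_mult_left scaleC_mult_right scaleC_scaleC mult.commute)
  then show ?thesis
    by (simp add: mnorm_def norm_scaleC norm_mult real_sqrt_mult flip: power2_eq_square)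
qed

lemma mnorm_eq_zero: "(\<And>z. form x z = form y z) \<Longrightarrow> mnorm (x - y) = 0"
  by (simp add: mnorm_def form_diff_left)

end

subsection \<open>Representations by adjointable isometries\<close>

text \<open>
  Isometries \<open>U s\<close> with adjoints \<open>U' s\<close> on a pre-Hilbert module. Only the generators in \<open>X\<close> are required
  to be isometric and adjointable.
\<close>

locale isometric_module_rep = inner_product_module form act
  for form :: "'x::ab_group_add \<Rightarrow> 'x \<Rightarrow> 'b::cstar_algebra" and act +
  fixes X :: "'s set" and U U' :: "'s \<Rightarrow> 'x \<Rightarrow> 'x"
  assumes act_add: "act (x + y) b = act x b + act y b"
    and act_add_right: "act x (b + c) = act x b + act x c"
    and act_act: "act (act x b) c = act x (b * c)"
    and act_one: "act x 1 = x"
    and U_add: "U s (x + y) = U s x + U s y" "U' s (x + y) = U' s x + U' s y"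
    and U_act: "U s (act x b) = act (U s x) b" "U' s (act x b) = act (U' s x) b"
    and U_adjoint: "s \<in> X \<Longrightarrow> form (U s x) y = form x (U' s y)"
    and U_isometry: "s \<in> X \<Longrightarrow> form (U s x) (U s y) = form x y"
begin

lemma act_zero [simp]: "act 0 b = 0"
  using act_add[of 0 0 b] by simp

lemma act_zero_right [simp]: "act x 0 = 0"
  using act_add_right[of x 0 0] by simp

lemma act_sum: "act (sum f A) b = (\<Sum>i\<in>A. act (f i) b)"
  by (induction A rule: infinite_finite_induct) (simp_all add: act_add)

text \<open>
  The representation \<open>op\<close> of the free *-algebra that sends the generators to the isometries.
\<close>

fun op_letter :: "'s letter \<Rightarrow> 'x \<Rightarrow> 'x" where
  "op_letter (Gen s) = U s"
| "op_letter (Adj s) = U' s"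

fun op_list :: "'s letter list \<Rightarrow> 'x \<Rightarrow> 'x" where
  "op_list [] x = x"
| "op_list (a # l) x = op_letter a (op_list l x)"

fun op_word :: "'s star_word \<Rightarrow> 'x \<Rightarrow> 'x" where
  "op_word (Word l) = op_list l"

definition op :: "'s free_star_algebra \<Rightarrow> 'x \<Rightarrow> 'x" where
  "op p x = (\<Sum>w\<in>Poly_Mapping.keys p. act (op_word w x) (Poly_Mapping.lookup p w *\<^sub>C 1))"

lemma op_letter_add: "op_letter a (x + y) = op_letter a x + op_letter a y"
  by (cases a) (simp_all add: U_add)

lemma op_letter_act: "op_letter a (act x b) = act (op_letter a x) b"
  by (cases a) (simp_all add: U_act)

lemma op_word_add: "op_word w (x + y) = op_word w x + op_word w y"
proof (cases w)
  case (Word l)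
  have "op_list l (x + y) = op_list l x + op_list l y"
    by (induction l) (simp_all add: op_letter_add)
  then show ?thesis by (simp add: Word)
qed

lemma op_word_act: "op_word w (act x b) = act (op_word w x) b"
proof (cases w)
  case (Word l)
  have "op_list l (act x b) = act (op_list l x) b"
    by (induction l) (simp_all add: op_letter_act)
  then show ?thesis by (simp add: Word)
qed

lemma op_word_plus: "op_word (u + w) x = op_word u (op_word w x)"
proof (cases u; cases w)
  fix k l assume "u = Word k" "w = Word l"
  moreover have "op_list (k @ l) x = op_list k (op_list l x)" by (induction k) simp_all
  ultimately show ?thesis by simp
qed

lemma op_superset:
  assumes "finite K" "Poly_Mapping.keys p \<subseteq> K"
  shows "op p x = (\<Sum>w\<in>K. act (op_word w x) (Poly_Mapping.lookup p w *\<^sub>C 1))"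
  unfolding op_def
  by (rule sum.mono_neutral_left) (use assms in \<open>auto simp: in_keys_iff\<close>)

lemma op_add: "op (p + q) x = op p x + op q x"
proof -
  let ?K = "Poly_Mapping.keys p \<union> Poly_Mapping.keys q"
  show ?thesis
    using keys_add[of p q]
    by (simp add: op_superset[of ?K] lookup_add scaleC_add_left act_add_right sum.distrib)
qed

lemma op_zero [simp]: "op 0 x = 0"
  by (simp add: op_def)

lemma op_diff: "op (p - q) x = op p x - op q x"
  using op_add[of "p - q" q x] by (simp add: algebra_simps)

lemma op_single: "op (Poly_Mapping.single w c) x = act (op_word w x) (c *\<^sub>C 1)"
  by (cases "c = 0") (simp_all add: op_def)

lemma op_sum: "op (sum f A) x = (\<Sum>i\<in>A. op (f i) x)"
  by (induction A rule: infinite_finite_induct) (simp_all add: op_add)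

lemma op_one [simp]: "op 1 x = x"
  by (simp only: single_one[symmetric] op_single) (simp add: zero_star_word_def act_one)

lemma op_gen [simp]: "op (gen s) x = U s x"
  by (simp add: gen_def op_single act_one)

lemma op_fstar_gen [simp]: "op (fstar (gen s)) x = U' s x"
  by (simp add: gen_def fstar_def op_single act_one)

lemma op_add_right: "op p (x + y) = op p x + op p y"
  by (simp add: op_def op_word_add act_add sum.distrib)

lemma op_zero_right [simp]: "op p 0 = 0"
  using op_add_right[of p 0 0] by simp

lemma op_sum_right: "op p (sum f A) = (\<Sum>i\<in>A. op p (f i))"
  by (induction A rule: infinite_finite_induct) (simp_all add: op_add_right)

lemma op_act: "op p (act x b) = act (op p x) b"
  by (simp add: op_def op_word_act act_act act_sum scaleC_mult_left scaleC_mult_right)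

lemma op_mult: "op (p * q) x = op p (op q x)"
proof -
  let ?s = "Poly_Mapping.single" and ?K = "Poly_Mapping.keys" and ?l = "Poly_Mapping.lookup"
  have single: "op (?s u c * ?s w d) x = op (?s u c) (op (?s w d) x)" for u w c d
    by (simp add: mult_single op_single op_word_plus op_word_act act_act scaleC_mult_left scaleC_mult_right
        scaleC_scaleC)
  have "op (p * q) x = op ((\<Sum>u\<in>?K p. ?s u (?l p u)) * (\<Sum>w\<in>?K q. ?s w (?l q w))) x"
    by (simp flip: poly_mapping_decomp)
  also have "\<dots> = (\<Sum>u\<in>?K p. \<Sum>w\<in>?K q. op (?s u (?l p u)) (op (?s w (?l q w)) x))"
    by (simp add: sum_product op_sum single)
  also have "\<dots> = op (\<Sum>u\<in>?K p. ?s u (?l p u)) (op (\<Sum>w\<in>?K q. ?s w (?l q w)) x)"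
    by (simp add: op_sum op_sum_right) (rule sum.swap)
  finally show ?thesis by (simp flip: poly_mapping_decomp)
qed

lemma op_fscale: "op (fscale c p) x = act (op p x) (c *\<^sub>C 1)"
  unfolding fscale_def mult_map_scale_conv_mult
  by (simp add: op_mult op_single zero_star_word_def)

lemma U_contractive:
  assumes "s \<in> X" shows "mnorm (U s x) \<le> mnorm x" "mnorm (U' s x) \<le> mnorm x"
proof -
  have iso: "mnorm (U s x) = mnorm x" for x by (simp add: mnorm_def U_isometry assms)
  then show "mnorm (U s x) \<le> mnorm x" by simp
  have "(mnorm (U' s x))\<^sup>2 = norm (form (U s (U' s x)) x)"
    by (simp add: mnorm_square U_adjoint assms)
  also have "\<dots> \<le> mnorm (U' s x) * mnorm x"
    using Cauchy_Schwarz[of "U s (U' s x)" x] by (simp add: iso)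
  finally show "mnorm (U' s x) \<le> mnorm x"
    using mnorm_nonneg[of "U' s x"] by (cases "mnorm (U' s x) = 0") (simp_all add: power2_eq_square)
qed

lemma op_word_contractive:
  assumes "set_star_word w \<subseteq> X" shows "mnorm (op_word w x) \<le> mnorm x"
proof (cases w)
  case (Word l)
  have "mnorm (op_list l x) \<le> mnorm x" if "\<forall>a\<in>set l. set_letter a \<subseteq> X" for l
    using that
  proof (induction l)
    case (Cons a l)
    have "mnorm (op_letter a y) \<le> mnorm y" for y
      using Cons.prems by (cases a) (auto intro: U_contractive)
    then show ?case using Cons by (auto intro: order_trans)
  qed simp
  then show ?thesis using assms by (auto simp: Word)
qed

lemma op_word_adjoint:
  assumes "set_star_word w \<subseteq> X" shows "form (op_word w x) y = form x (op_word (word_star w) y)"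
proof (cases w)
  case (Word l)
  have app: "op_list (k @ m) z = op_list k (op_list m z)" for k m z
    by (induction k) simp_all
  have "form (op_list l x) y = form x (op_list (map letter_star (rev l)) y)"
    if "\<forall>a\<in>set l. set_letter a \<subseteq> X" for l y
    using that
  proof (induction l arbitrary: y)
    case (Cons a l)
    have "form (op_letter a z) y = form z (op_letter (letter_star a) y)" for z
    proof (cases a)
      case (Gen s)
      then show ?thesis using Cons.prems by (simp add: U_adjoint)
    next
      case (Adj s)
      then have "form (U s y) z = form y (U' s z)" using Cons.prems by (simp add: U_adjoint)
      then show ?thesis using Adj form_star[of "U s y" z] form_star[of y "U' s z"] by simp
    qed
    then show ?case using Cons by (simp add: app)
  qed simp
  then show ?thesis using assms by (auto simp: Word)
qed

lemma form_sum_left: "form (sum f A) y = (\<Sum>i\<in>A. form (f i) y)"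
  by (induction A rule: infinite_finite_induct) (simp_all add: form_add_left)

lemma form_sum_right: "form y (sum f A) = (\<Sum>i\<in>A. form y (f i))"
  by (induction A rule: infinite_finite_induct) (simp_all add: form_add_right)

lemma op_adjoint:
  assumes "p \<in> free_on X" shows "form (op p x) y = form x (op (fstar p) y)"
proof -
  have "form (op p x) y
      = (\<Sum>w\<in>Poly_Mapping.keys p. star (Poly_Mapping.lookup p w *\<^sub>C 1) * form (op_word w x) y)"
    by (simp add: op_def form_sum_left form_act_left)
  also have "\<dots> = (\<Sum>w\<in>Poly_Mapping.keys p.
      form x (op (Poly_Mapping.single (word_star w) (cnj (Poly_Mapping.lookup p w))) y))"
    using assms by (intro sum.cong refl)
      (simp add: op_word_adjoint free_on_def op_single form_act_right star_scaleC scaleC_mult_left scaleC_mult_right)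
  also have "\<dots> = form x (op (fstar p) y)"
    by (simp add: fstar_def op_sum form_sum_right)
  finally show ?thesis .
qed

lemma mnorm_sum: "mnorm (sum f A) \<le> (\<Sum>i\<in>A. mnorm (f i))"
  by (induction A rule: infinite_finite_induct) (auto intro: order_trans[OF mnorm_add])

lemma op_bounded:
  assumes "p \<in> free_on X"
  shows "mnorm (op p x) \<le> (\<Sum>w\<in>Poly_Mapping.keys p. cmod (Poly_Mapping.lookup p w)) * mnorm x"
proof -
  have "mnorm (op p x) \<le> (\<Sum>w\<in>Poly_Mapping.keys p. cmod (Poly_Mapping.lookup p w) * mnorm (op_word w x))"
    unfolding op_def by (rule order_trans[OF mnorm_sum]) (simp add: mnorm_scale)
  also have "\<dots> \<le> (\<Sum>w\<in>Poly_Mapping.keys p. cmod (Poly_Mapping.lookup p w) * mnorm x)"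
    using assms by (intro sum_mono mult_left_mono op_word_contractive) (auto simp: free_on_def)
  finally show ?thesis by (simp add: sum_distrib_right)
qed

text \<open>
  The operator seminorm; on \<open>free_on X\<close> the supremum is over a bounded set (\<open>opnorm_bdd\<close>). By
  \<open>cstar_seminorm_opnorm\<close> below it is a C*-seminorm, so it is dominated by the norm of any universal
  C*-algebra whose relations hold in the module.
\<close>

definition opnorm :: "'s free_star_algebra \<Rightarrow> real" where
  "opnorm p = (SUP x\<in>{x. mnorm x \<le> 1}. mnorm (op p x))"

context
  fixes p assumes p: "p \<in> free_on X"
begin

lemma opnorm_bdd: "bdd_above ((\<lambda>x. mnorm (op p x)) ` {x. mnorm x \<le> 1})"
proof (rule bdd_aboveI2)
  fix x assume "x \<in> {x. mnorm x \<le> 1}"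
  then have "(\<Sum>w\<in>Poly_Mapping.keys p. cmod (Poly_Mapping.lookup p w)) * mnorm x
    \<le> (\<Sum>w\<in>Poly_Mapping.keys p. cmod (Poly_Mapping.lookup p w))"
    by (intro mult_left_le) (auto intro: sum_nonneg)
  then show "mnorm (op p x) \<le> (\<Sum>w\<in>Poly_Mapping.keys p. cmod (Poly_Mapping.lookup p w))"
    using op_bounded[OF p, of x] by linarith
qed

lemma opnorm_upper: "mnorm x \<le> 1 \<Longrightarrow> mnorm (op p x) \<le> opnorm p"
  unfolding opnorm_def by (rule cSUP_upper[OF _ opnorm_bdd]) simp

lemma opnorm_least:
  assumes "\<And>x. mnorm x \<le> 1 \<Longrightarrow> mnorm (op p x) \<le> C" shows "opnorm p \<le> C"
  unfolding opnorm_def by (rule cSUP_least) (use assms in \<open>auto intro: exI[of _ 0]\<close>)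

lemma opnorm_nonneg: "0 \<le> opnorm p"
  using opnorm_upper[of 0] by simp

lemma opnorm_mult: "mnorm (op p x) \<le> opnorm p * mnorm x"
proof (cases "mnorm x = 0")
  case True
  then show ?thesis using op_bounded[OF p, of x] by simp
next
  case False
  then have pos: "mnorm x > 0" using mnorm_nonneg[of x] by linarith
  define c where "c = complex_of_real (1 / mnorm x)"
  have c: "cmod c = 1 / mnorm x" unfolding c_def norm_of_real using pos by simp
  have "mnorm (op p (act x (c *\<^sub>C 1))) \<le> opnorm p"
    by (rule opnorm_upper) (use pos in \<open>simp add: mnorm_scale c\<close>)
  then show ?thesis using pos by (simp add: op_act mnorm_scale c field_simps)
qed

end

theorem cstar_seminorm_opnorm: "cstar_seminorm_on X opnorm"
proof -
  have mult: "opnorm (p * q) \<le> opnorm p * opnorm q" if p: "p \<in> free_on X" and q: "q \<in> free_on X" for p q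
  proof (rule opnorm_least[OF free_on_mult[OF p q]])
    fix x assume x: "mnorm x \<le> 1"
    have "mnorm (op (p * q) x) \<le> opnorm p * mnorm (op q x)" by (simp add: op_mult opnorm_mult p)
    also have "\<dots> \<le> opnorm p * opnorm q"
      by (intro mult_left_mono opnorm_upper opnorm_nonneg p q x)
    finally show "mnorm (op (p * q) x) \<le> opnorm p * opnorm q" .
  qed
  have sq: "(opnorm p)\<^sup>2 \<le> opnorm (fstar p * p)" if p: "p \<in> free_on X" for p
  proof -
    have pp: "fstar p * p \<in> free_on X" using p by (intro free_on_mult free_on_fstar)
    have "opnorm p \<le> sqrt (opnorm (fstar p * p))"
    proof (rule opnorm_least[OF p])
      fix x assume x: "mnorm x \<le> 1"
      have "(mnorm (op p x))\<^sup>2 = norm (form x (op (fstar p * p) x))"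
        by (simp add: mnorm_square op_adjoint[OF p] op_mult)
      also have "\<dots> \<le> mnorm x * mnorm (op (fstar p * p) x)" by (rule Cauchy_Schwarz)
      also have "\<dots> \<le> 1 * opnorm (fstar p * p)" by (intro mult_mono opnorm_upper pp x) auto
      finally show "mnorm (op p x) \<le> sqrt (opnorm (fstar p * p))" by (simp add: real_le_rsqrt)
    qed
    then have "(opnorm p)\<^sup>2 \<le> (sqrt (opnorm (fstar p * p)))\<^sup>2"
      by (intro power_mono opnorm_nonneg p)
    then show ?thesis by (simp add: opnorm_nonneg[OF pp])
  qed
  have adj_le: "opnorm p \<le> opnorm (fstar p)" if p: "p \<in> free_on X" for p
  proof (cases "opnorm p = 0")
    case True
    then show ?thesis using opnorm_nonneg[OF free_on_fstar[OF p]] by simp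
  next
    case False
    have "opnorm p * opnorm p \<le> opnorm (fstar p) * opnorm p"
      using sq[OF p] mult[OF free_on_fstar[OF p] p] by (simp add: power2_eq_square)
    then show ?thesis using False opnorm_nonneg[OF p] by simp
  qed
  have cstar: "opnorm (fstar p * p) = (opnorm p)\<^sup>2" if p: "p \<in> free_on X" for p
  proof (rule antisym)
    have adj: "opnorm (fstar p) \<le> opnorm p"
    proof (rule opnorm_least[OF free_on_fstar[OF p]])
      fix x assume x: "mnorm x \<le> 1"
      let ?y = "op (fstar p) x"
      have "(mnorm ?y)\<^sup>2 = norm (form (op p ?y) x)"
        by (simp add: mnorm_square op_adjoint[OF p])
      also have "\<dots> \<le> mnorm (op p ?y) * mnorm x" by (rule Cauchy_Schwarz)
      also have "\<dots> \<le> (opnorm p * mnorm ?y) * 1"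
        by (intro mult_mono opnorm_mult p x mult_nonneg_nonneg opnorm_nonneg) auto
      finally have "mnorm ?y * mnorm ?y \<le> opnorm p * mnorm ?y" by (simp add: power2_eq_square)
      then show "mnorm ?y \<le> opnorm p"
        using mnorm_nonneg[of ?y] opnorm_nonneg[OF p] by (cases "mnorm ?y = 0") auto
    qed
    have "opnorm (fstar p * p) \<le> opnorm (fstar p) * opnorm p"
      by (rule mult[OF free_on_fstar[OF p] p])
    also have "\<dots> \<le> opnorm p * opnorm p" by (intro mult_right_mono adj opnorm_nonneg p)
    finally show "opnorm (fstar p * p) \<le> (opnorm p)\<^sup>2" by (simp add: power2_eq_square)
  qed (rule sq[OF p])
  show ?thesis
    unfolding cstar_seminorm_on_def
  proof (intro conjI ballI allI)
    fix p assume p: "p \<in> free_on X"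
    then show "0 \<le> opnorm p" by (rule opnorm_nonneg)
    show "opnorm (fstar p * p) = (opnorm p)\<^sup>2" by (rule cstar[OF p])
    show "opnorm (fscale c p) = cmod c * opnorm p" for c
    proof (rule antisym)
      show "opnorm (fscale c p) \<le> cmod c * opnorm p"
        by (rule opnorm_least[OF free_on_fscale[OF p]])
          (simp add: op_fscale mnorm_scale mult_left_mono opnorm_upper p)
      show "cmod c * opnorm p \<le> opnorm (fscale c p)"
      proof (cases "c = 0")
        case True
        then show ?thesis by (simp add: opnorm_nonneg free_on_fscale p)
      next
        case False
        have "opnorm p \<le> opnorm (fscale c p) / cmod c"
        proof (rule opnorm_least[OF p])
          fix x assume "mnorm x \<le> 1"
          then show "mnorm (op p x) \<le> opnorm (fscale c p) / cmod c"
            using opnorm_upper[OF free_on_fscale[OF p], of x c] False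
            by (simp add: op_fscale mnorm_scale field_simps)
        qed
        then show ?thesis using False by (simp add: field_simps)
      qed
    qed
    fix q assume q: "q \<in> free_on X"
    show "opnorm (p * q) \<le> opnorm p * opnorm q" by (rule mult[OF p q])
    show "opnorm (p + q) \<le> opnorm p + opnorm q"
    proof (rule opnorm_least[OF free_on_add[OF p q]])
      fix x assume "mnorm x \<le> 1"
      then show "mnorm (op (p + q) x) \<le> opnorm p + opnorm q"
        using mnorm_add[of "op p x" "op q x"] opnorm_upper[OF p, of x] opnorm_upper[OF q, of x]
        by (simp add: op_add)
    qed
  qed
qed

lemma opnorm_eq_zero:
  assumes "p \<in> free_on X" "\<And>x. mnorm (op p x) = 0" shows "opnorm p = 0"
  using opnorm_least[OF assms(1), of 0] opnorm_nonneg[OF assms(1)] assms(2) by fastforce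

end

section \<open>Common right multiples and the scale\<close>

context right_LCM_semigroup
begin

abbreviation pri :: "'s \<Rightarrow> 's set" where
  "pri \<equiv> principal_right_ideal S"

lemma pri_iff: "z \<in> pri s \<longleftrightarrow> (\<exists>x\<in>carrier S. z = s \<otimes> x)"
  by (auto simp: principal_right_ideal_def)

lemma pri_self: "s \<in> carrier S \<Longrightarrow> s \<in> pri s"
  unfolding pri_iff by (rule bexI[of _ \<one>]) simp_all

lemma pri_mult_subset: "s \<in> carrier S \<Longrightarrow> x \<in> carrier S \<Longrightarrow> pri (s \<otimes> x) \<subseteq> pri s"
  by (auto simp: pri_iff m_assoc) (metis m_closed)

lemma pri_mult_Int:
  assumes "r \<in> carrier S" "s \<in> carrier S" "t \<in> carrier S"
  shows "pri (r \<otimes> s) \<inter> pri (r \<otimes> t) = (\<lambda>z. r \<otimes> z) ` (pri s \<inter> pri t)"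
proof (intro equalityI subsetI)
  fix z assume "z \<in> pri (r \<otimes> s) \<inter> pri (r \<otimes> t)"
  then obtain x y where xy: "x \<in> carrier S" "y \<in> carrier S" "z = r \<otimes> s \<otimes> x" "z = r \<otimes> t \<otimes> y"
    by (auto simp: pri_iff)
  then have "s \<otimes> x = t \<otimes> y"
    using assms left_cancel[of r "s \<otimes> x" "t \<otimes> y"] by (simp add: m_assoc)
  then have "s \<otimes> x \<in> pri s \<inter> pri t" using xy(1,2) by (metis IntI pri_iff)
  moreover have "z = r \<otimes> (s \<otimes> x)" using xy assms by (simp add: m_assoc)
  ultimately show "z \<in> (\<lambda>z. r \<otimes> z) ` (pri s \<inter> pri t)" by blast
next
  fix z assume "z \<in> (\<lambda>z. r \<otimes> z) ` (pri s \<inter> pri t)"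
  then obtain x y where "x \<in> carrier S" "y \<in> carrier S" "z = r \<otimes> (s \<otimes> x)" "s \<otimes> x = t \<otimes> y"
    by (auto simp: pri_iff)
  then have "z = r \<otimes> s \<otimes> x" "z = r \<otimes> t \<otimes> y" using assms by (simp_all add: m_assoc)
  then show "z \<in> pri (r \<otimes> s) \<inter> pri (r \<otimes> t)"
    using \<open>x \<in> carrier S\<close> \<open>y \<in> carrier S\<close> by (metis IntI pri_iff)
qed

lemma pri_mult: "r \<in> carrier S \<Longrightarrow> s \<in> carrier S \<Longrightarrow> pri (r \<otimes> s) = (\<lambda>z. r \<otimes> z) ` pri s"
  using pri_mult_Int[of r s s] by simp

text \<open>
  \<open>meets s t x y\<close>: the element \<open>s \<otimes> x = t \<otimes> y\<close> is a right least common multiple of \<open>s\<close> and \<open>t\<close>, with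
  cofactors \<open>x\<close> and \<open>y\<close>. The cofactors are unique up to a common invertible factor on the right
  (\<open>meets_unique\<close>).
\<close>

definition meets :: "'s \<Rightarrow> 's \<Rightarrow> 's \<Rightarrow> 's \<Rightarrow> bool" where
  "meets s t x y \<longleftrightarrow> s \<in> carrier S \<and> t \<in> carrier S \<and> x \<in> carrier S \<and> y \<in> carrier S \<and>
     s \<otimes> x = t \<otimes> y \<and> pri s \<inter> pri t = pri (s \<otimes> x)"

lemma meets_carrier:
  "meets s t x y \<Longrightarrow> s \<in> carrier S \<and> t \<in> carrier S \<and> x \<in> carrier S \<and> y \<in> carrier S"
  by (simp add: meets_def)

lemma meets_sym: "meets s t x y \<Longrightarrow> meets t s y x"
  unfolding meets_def by (metis Int_commute)

lemma meets_self: "s \<in> carrier S \<Longrightarrow> meets s s \<one> \<one>"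
  by (simp add: meets_def)

lemma meets_one: "s \<in> carrier S \<Longrightarrow> meets s \<one> \<one> s"
  using pri_mult_subset[of \<one> s] by (simp add: meets_def Int_absorb2)

lemma disjoint_or_meets:
  assumes "s \<in> carrier S" "t \<in> carrier S"
  obtains "pri s \<inter> pri t = {}" | x y where "meets s t x y"
proof (cases "pri s \<inter> pri t = {}")
  case False
  then obtain r where r: "r \<in> carrier S" "pri s \<inter> pri t = pri r"
    using right_LCM[OF assms] by auto
  then have "r \<in> pri s" "r \<in> pri t" using pri_self[OF r(1)] by auto
  then obtain x y where "x \<in> carrier S" "y \<in> carrier S" "r = s \<otimes> x" "r = t \<otimes> y"
    by (auto simp: pri_iff)
  then have "meets s t x y" using assms r by (simp add: meets_def)
  then show thesis by (rule that(2))
qed (rule that(1))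

lemma meets_not_disjoint: "meets s t x y \<Longrightarrow> pri s \<inter> pri t \<noteq> {}"
  using pri_self[of "s \<otimes> x"] by (auto simp: meets_def)

lemma meets_factor:
  assumes m: "meets s t x y" and "a \<in> carrier S" "b \<in> carrier S" "s \<otimes> a = t \<otimes> b"
  obtains c where "c \<in> carrier S" "a = x \<otimes> c" "b = y \<otimes> c"
proof -
  have "s \<otimes> a \<in> pri s \<inter> pri t" using assms(2-4) by (metis IntI pri_iff)
  then have "s \<otimes> a \<in> pri (s \<otimes> x)" using m unfolding meets_def by blast
  then obtain c where c: "c \<in> carrier S" "s \<otimes> a = s \<otimes> x \<otimes> c"
    by (auto simp: pri_iff)
  have mc: "s \<in> carrier S" "t \<in> carrier S" "x \<in> carrier S" "y \<in> carrier S" "s \<otimes> x = t \<otimes> y"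
    using m by (simp_all add: meets_def)
  have sa: "s \<otimes> a = s \<otimes> (x \<otimes> c)" unfolding c(2) by (rule m_assoc[OF mc(1,3) c(1)])
  have "a = x \<otimes> c" by (rule left_cancel[OF mc(1) assms(2) _ sa]) (use mc c in simp)
  moreover have "t \<otimes> b = t \<otimes> (y \<otimes> c)"
    unfolding assms(4)[symmetric] c(2) mc(5) by (rule m_assoc[OF mc(2,4) c(1)])
  then have "b = y \<otimes> c" by (rule left_cancel[OF mc(2) assms(3), rotated]) (use mc c in simp)
  ultimately show thesis using that c by blast
qed

lemma meets_unique:
  assumes m: "meets s t x y" and m': "meets s t x' y'"
  obtains u u' where "u \<in> carrier S" "u' \<in> carrier S" "u \<otimes> u' = \<one>" "u' \<otimes> u = \<one>"
    "x' = x \<otimes> u" "y' = y \<otimes> u"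
proof -
  have c: "x \<in> carrier S" "y \<in> carrier S" "x' \<in> carrier S" "y' \<in> carrier S"
    "s \<otimes> x = t \<otimes> y" "s \<otimes> x' = t \<otimes> y'"
    using m m' by (auto simp: meets_def)
  obtain u where u: "u \<in> carrier S" "x' = x \<otimes> u" "y' = y \<otimes> u"
    by (rule meets_factor[OF m c(3,4,6)])
  obtain u' where u': "u' \<in> carrier S" "x = x' \<otimes> u'" "y = y' \<otimes> u'"
    by (rule meets_factor[OF m' c(1,2,5)])
  have "x \<otimes> (u \<otimes> u') = x \<otimes> u \<otimes> u'" by (rule m_assoc[OF c(1) u(1) u'(1), symmetric])
  also have "\<dots> = x \<otimes> \<one>" by (simp only: u(2)[symmetric] u'(2)[symmetric] r_one[OF c(1)])
  finally have 1: "u \<otimes> u' = \<one>" by (rule left_cancel[OF c(1), rotated 2]) (intro m_closed u u' one_closed)+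
  have "x' \<otimes> (u' \<otimes> u) = x' \<otimes> u' \<otimes> u" by (rule m_assoc[OF c(3) u'(1) u(1), symmetric])
  also have "\<dots> = x' \<otimes> \<one>" by (simp only: u(2)[symmetric] u'(2)[symmetric] r_one[OF c(3)])
  finally have 2: "u' \<otimes> u = \<one>" by (rule left_cancel[OF c(3), rotated 2]) (intro m_closed u u' one_closed)+
  show thesis by (rule that[OF u(1) u'(1) 1 2 u(2,3)])
qed

lemma meets_mult_left:
  assumes "meets s t x y" "r \<in> carrier S"
  shows "meets (r \<otimes> s) (r \<otimes> t) x y"
proof -
  have c: "s \<in> carrier S" "t \<in> carrier S" "x \<in> carrier S" "y \<in> carrier S"
    "s \<otimes> x = t \<otimes> y" "pri s \<inter> pri t = pri (s \<otimes> x)"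
    using assms by (auto simp: meets_def)
  have "pri (r \<otimes> s) \<inter> pri (r \<otimes> t) = pri (r \<otimes> (s \<otimes> x))"
    unfolding pri_mult_Int[OF assms(2) c(1,2)] c(6)
    by (rule pri_mult[symmetric]) (use c assms in auto)
  then show ?thesis using c assms by (simp add: meets_def m_assoc)
qed

lemma pri_mult_Int_meets:
  assumes "meets r t x y" "s \<in> carrier S"
  shows "pri (r \<otimes> s) \<inter> pri t = (\<lambda>z. r \<otimes> z) ` (pri s \<inter> pri x)"
proof -
  have c: "r \<in> carrier S" "x \<in> carrier S" "pri r \<inter> pri t = pri (r \<otimes> x)"
    using assms by (auto simp: meets_def)
  have "pri (r \<otimes> s) \<inter> pri t = pri (r \<otimes> s) \<inter> pri (r \<otimes> x)"
    using pri_mult_subset[OF c(1) assms(2)] c(3) by blast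
  then show ?thesis using c assms by (simp add: pri_mult_Int)
qed

text \<open>
  A common multiple of \<open>r \<otimes> s\<close> and \<open>t\<close> is found by first meeting \<open>r\<close> with \<open>t\<close> and then \<open>s\<close> with the
  cofactor of \<open>r\<close>.
\<close>

lemma meets_compose:
  assumes m: "meets r t x y" and n: "meets s x p q"
  shows "meets (r \<otimes> s) t p (y \<otimes> q)"
proof -
  have c: "r \<in> carrier S" "t \<in> carrier S" "x \<in> carrier S" "y \<in> carrier S" "r \<otimes> x = t \<otimes> y"
    "s \<in> carrier S" "p \<in> carrier S" "q \<in> carrier S" "s \<otimes> p = x \<otimes> q" "pri s \<inter> pri x = pri (s \<otimes> p)"
    using m n by (auto simp: meets_def)
  have "pri (r \<otimes> s) \<inter> pri t = pri (r \<otimes> (s \<otimes> p))"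
    using pri_mult_Int_meets[OF m c(6)] c by (simp add: pri_mult[of r])
  moreover have "r \<otimes> (s \<otimes> p) = t \<otimes> (y \<otimes> q)"
    using c by (metis m_assoc)
  ultimately show ?thesis using c by (simp add: meets_def m_assoc)
qed

end

text \<open>
  The standing hypothesis on the scale: an element of \<open>S\<close> and an element of the kernel always have a
  common multiple, and the cofactor of the former lies in the kernel.
\<close>

locale scaled_LCM_semigroup = right_LCM_semigroup S for S :: "('s, 'm) monoid_scheme" (structure) +
  fixes N :: "'s \<Rightarrow> real"
  assumes scale: "semigroup_scale S N"
    and lcm_ker: "\<lbrakk>s \<in> carrier S; t \<in> carrier (scale_kernel S N)\<rbrakk> \<Longrightarrow>
      \<exists>k\<in>carrier (scale_kernel S N).
        principal_right_ideal S s \<inter> principal_right_ideal S t = principal_right_ideal S (s \<otimes> k)"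
begin

text \<open>
  The underlying set of the kernel of the scale.
\<close>

definition K :: "'s set" where
  "K = {s \<in> carrier S. N s = 1}"

lemma kernel_simps [simp]:
  "carrier (scale_kernel S N) = K" "\<one>\<^bsub>scale_kernel S N\<^esub> = \<one>" "x \<otimes>\<^bsub>scale_kernel S N\<^esub> y = x \<otimes> y"
  by (simp_all add: scale_kernel_def K_def)

lemma scale_ge_1: "s \<in> carrier S \<Longrightarrow> 1 \<le> N s"
  using scale by (simp add: semigroup_scale_def)

lemma scale_mult: "s \<in> carrier S \<Longrightarrow> t \<in> carrier S \<Longrightarrow> N (s \<otimes> t) = N s * N t"
  using scale by (simp add: semigroup_scale_def)

lemma scale_one: "N \<one> = 1"
  using scale_mult[of \<one> \<one>] scale_ge_1[of \<one>] by simp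

lemma K_carrier: "k \<in> K \<Longrightarrow> k \<in> carrier S"
  by (simp add: K_def)

lemma one_K [simp]: "\<one> \<in> K"
  by (simp add: K_def scale_one)

lemma mult_K_iff:
  assumes "x \<in> carrier S" "y \<in> carrier S" shows "x \<otimes> y \<in> K \<longleftrightarrow> x \<in> K \<and> y \<in> K"
proof -
  have "N x * N y = 1 \<longleftrightarrow> N x = 1 \<and> N y = 1"
  proof
    assume p: "N x * N y = 1"
    have "N x * 1 \<le> N x * N y" "1 * N y \<le> N x * N y"
      using scale_ge_1[OF assms(1)] scale_ge_1[OF assms(2)] by (intro mult_mono; simp)+
    then show "N x = 1 \<and> N y = 1"
      using p scale_ge_1[OF assms(1)] scale_ge_1[OF assms(2)] by simp
  qed simp
  then show ?thesis using assms by (simp add: K_def scale_mult)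
qed

lemma meets_K:
  assumes "meets s t x y" "t \<in> K" shows "x \<in> K" "N y = N s"
proof -
  have c: "s \<in> carrier S" "t \<in> carrier S" "x \<in> carrier S" "y \<in> carrier S"
    "s \<otimes> x = t \<otimes> y" "pri s \<inter> pri t = pri (s \<otimes> x)"
    using assms by (auto simp: meets_def)
  obtain k where k: "k \<in> K" "pri s \<inter> pri t = pri (s \<otimes> k)"
    using lcm_ker[of s t] c assms(2) by auto
  have "s \<otimes> k \<in> pri (s \<otimes> x)"
    using k c pri_self[of "s \<otimes> k"] by (simp add: K_carrier)
  then obtain d where d: "d \<in> carrier S" "s \<otimes> k = s \<otimes> x \<otimes> d" by (auto simp: pri_iff)
  then have "s \<otimes> k = s \<otimes> (x \<otimes> d)" using c by (metis m_assoc)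
  then have "k = x \<otimes> d"
    using left_cancel[of s k "x \<otimes> d"] c d k by (simp add: K_carrier)
  then show x: "x \<in> K" using k d c mult_K_iff by simp
  have "N s * N x = N t * N y" using c scale_mult by metis
  then show "N y = N s" using x assms(2) by (simp add: K_def)
qed

lemma meets_K_exists:
  assumes "s \<in> carrier S" "t \<in> K" obtains x y where "meets s t x y" "x \<in> K" "N y = N s"
proof (rule disjoint_or_meets[of s t])
  assume "pri s \<inter> pri t = {}"
  moreover obtain k where "k \<in> K" "pri s \<inter> pri t = pri (s \<otimes> k)"
    using lcm_ker[of s t] assms by auto
  ultimately show thesis using pri_self[of "s \<otimes> k"] assms by (simp add: K_carrier)
next
  fix x y assume "meets s t x y"
  then show thesis using that meets_K assms by blast
qed (use assms in \<open>auto simp: K_carrier\<close>)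

lemma meets_K_both:
  assumes "meets s t x y" "s \<in> K" "t \<in> K" shows "x \<in> K" "y \<in> K"
  using meets_K[OF assms(1,3)] meets_K[OF meets_sym[OF assms(1)] assms(2)] by auto

lemma unit_K: "u \<in> carrier S \<Longrightarrow> u' \<in> carrier S \<Longrightarrow> u \<otimes> u' = \<one> \<Longrightarrow> u \<in> K"
  using mult_K_iff[of u u'] by simp

lemma pri_kernel: "x \<in> K \<Longrightarrow> principal_right_ideal (scale_kernel S N) x = pri x \<inter> K"
  by (auto simp: principal_right_ideal_def mult_K_iff K_carrier)

text \<open>
  Principal right ideals of the kernel always intersect, and their intersections are those of the
  ideals they generate in \<open>S\<close>. Hence the relations for \<open>S\<close> contain the ones for the kernel.
\<close>

lemma pri_kernel_Int:
  assumes "x \<in> K" "y \<in> K"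
  shows "principal_right_ideal (scale_kernel S N) x \<inter> principal_right_ideal (scale_kernel S N) y \<noteq> {}"
proof -
  obtain a b where m: "meets x y a b" "a \<in> K" using meets_K_exists assms by (metis K_carrier)
  have xa: "x \<otimes> a \<in> K" using m(2) assms by (simp add: mult_K_iff K_carrier)
  then have "x \<otimes> a \<in> pri x \<inter> pri y \<inter> K"
    using m(1) pri_self[OF K_carrier[OF xa]] unfolding meets_def by blast
  then show ?thesis using assms by (auto simp: pri_kernel)
qed

lemma pri_kernel_eq_lift:
  assumes K: "x \<in> K" "y \<in> K" "r \<in> K"
    and eq: "principal_right_ideal (scale_kernel S N) x \<inter> principal_right_ideal (scale_kernel S N) y
      = principal_right_ideal (scale_kernel S N) r"
  shows "pri x \<inter> pri y = pri r"
proof -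
  obtain a b where m: "meets x y a b" "a \<in> K" using meets_K_exists K by (metis K_carrier)
  have eq': "pri x \<inter> pri y \<inter> K = pri r \<inter> K" using eq K by (auto simp: pri_kernel)
  have xa: "x \<otimes> a \<in> K" "pri x \<inter> pri y = pri (x \<otimes> a)"
    using m K by (simp_all add: mult_K_iff K_carrier) (simp add: meets_def)
  have sub: "pri z \<subseteq> pri z'" if "z \<in> pri z'" "z' \<in> carrier S" for z z'
    using that pri_mult_subset[of z'] by (auto simp: pri_iff[of z])
  have "x \<otimes> a \<in> pri r" using eq' xa pri_self[of "x \<otimes> a"] K_carrier by blast
  moreover have "r \<in> pri (x \<otimes> a)" using eq' xa pri_self[of r] K K_carrier by blast
  ultimately show ?thesis using xa sub K K_carrier by blast
qed

end

section \<open>The kernel of the induced module\<close>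

text \<open>
  Any isometries \<open>w\<close> that satisfy the relations of the kernel, universal or not, define the module
  constructed below.
\<close>

locale kernel_isometries = scaled_LCM_semigroup S N for S :: "('s, 'm) monoid_scheme" (structure) and N +
  fixes w :: "'s \<Rightarrow> 'b::cstar_algebra"
  assumes w_rel: "\<forall>r\<in>lcm_relators (scale_kernel S N). eval_free w r = 0"
begin

lemma w_one: "w \<one> = 1"
  using w_rel unfolding lcm_relators_iff by simp

lemma w_mult: "x \<in> K \<Longrightarrow> y \<in> K \<Longrightarrow> w x * w y = w (x \<otimes> y)"
  using w_rel unfolding lcm_relators_iff by simp

lemma w_isometry: "x \<in> K \<Longrightarrow> star (w x) * w x = 1"
  using w_rel unfolding lcm_relators_iff by simp

lemma w_ranges:
  assumes m: "meets x y a b" and K: "x \<in> K" "y \<in> K"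
  shows "w x * star (w x) * (w y * star (w y)) = w (x \<otimes> a) * star (w (x \<otimes> a))"
proof -
  have a: "a \<in> K" by (rule meets_K_both[OF m K])
  have xa: "x \<otimes> a \<in> K" using K a by (simp add: mult_K_iff K_carrier)
  have "principal_right_ideal (scale_kernel S N) x \<inter> principal_right_ideal (scale_kernel S N) y
      = principal_right_ideal (scale_kernel S N) (x \<otimes> a)"
  proof -
    have "pri x \<inter> pri y = pri (x \<otimes> a)" using m by (simp add: meets_def)
    then show ?thesis unfolding pri_kernel[OF K(1)] pri_kernel[OF K(2)] pri_kernel[OF xa] by blast
  qed
  moreover have "\<forall>s\<in>K. \<forall>t\<in>K. \<forall>r\<in>K.
      principal_right_ideal (scale_kernel S N) s \<inter> principal_right_ideal (scale_kernel S N) t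
        = principal_right_ideal (scale_kernel S N) r \<longrightarrow>
      w s * star (w s) * w t * star (w t) = w r * star (w r)"
    using w_rel unfolding lcm_relators_iff by simp
  ultimately show ?thesis using K xa by (simp add: mult.assoc)
qed

lemma w_ranges_commute:
  assumes K: "x \<in> K" "y \<in> K"
  shows "w x * star (w x) * (w y * star (w y)) = w y * star (w y) * (w x * star (w x))"
proof -
  obtain a b where m: "meets x y a b" using meets_K_exists K by (metis K_carrier)
  then have "x \<otimes> a = y \<otimes> b" by (simp add: meets_def)
  then show ?thesis using w_ranges[OF m K] w_ranges[OF meets_sym[OF m] K(2,1)] by simp
qed

lemma w_star_mult:
  assumes m: "meets x y a b" and K: "x \<in> K" "y \<in> K"
  shows "star (w x) * w y = w a * star (w b)"
proof -
  have ab: "a \<in> K" "b \<in> K" by (rule meets_K_both[OF m K])+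
  have eq: "x \<otimes> a = y \<otimes> b" using m by (simp add: meets_def)
  have "star (w x) * w y = (star (w x) * w x) * star (w x) * (w y * (star (w y) * w y))"
    by (simp add: w_isometry K)
  also have "\<dots> = star (w x) * (w x * star (w x) * (w y * star (w y))) * w y"
    by (simp add: mult.assoc)
  also have "\<dots> = star (w x) * (w (x \<otimes> a) * star (w (y \<otimes> b))) * w y"
    by (simp only: w_ranges[OF m K] eq)
  also have "\<dots> = (star (w x) * w x) * w a * (star (w b) * (star (w y) * w y))"
    using K ab by (simp add: star_mult mult.assoc flip: w_mult)
  finally show ?thesis by (simp add: w_isometry K)
qed

lemma w_unit:
  assumes "u \<in> carrier S" "u' \<in> carrier S" "u \<otimes> u' = \<one>" "u' \<otimes> u = \<one>"
  shows "w u * star (w u) = 1"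
proof -
  have K: "u \<in> K" "u' \<in> K" using assms unit_K by blast+
  then have "w u * w u' = 1" by (simp add: w_mult assms w_one)
  then have "star (w u) = w u'"
    by (metis K(1) mult.assoc mult_1_left mult_1_right w_isometry)
  then show ?thesis by (simp add: \<open>w u * w u' = 1\<close>)
qed

text \<open>
  The entry \<open>G s t\<close> is the value that the conditional expectation will take at \<open>star (v s) * v t\<close>: this
  product is \<open>v x * star (v y)\<close> if \<open>s \<otimes> x = t \<otimes> y\<close> is a least common multiple, and \<open>0\<close> if there is none.
  So the entry is \<open>w x * star (w y)\<close> if both cofactors lie in the kernel, and \<open>0\<close> otherwise. The cofactors are picked by choice, which is harmless by \<open>G_meets\<close>. Arguments outside the carrier
  give \<open>0\<close>.
\<close>

definition G :: "'s \<Rightarrow> 's \<Rightarrow> 'b" where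
  "G s t = (if \<exists>x\<in>K. \<exists>y\<in>K. meets s t x y
     then (let (x, y) = (SOME (x, y). x \<in> K \<and> y \<in> K \<and> meets s t x y) in w x * star (w y)) else 0)"

lemma G_meets:
  assumes m: "meets s t x y"
  shows "G s t = (if x \<in> K \<and> y \<in> K then w x * star (w y) else 0)"
proof (cases "\<exists>x\<in>K. \<exists>y\<in>K. meets s t x y")
  case True
  then have "\<exists>z. case z of (x, y) \<Rightarrow> x \<in> K \<and> y \<in> K \<and> meets s t x y" by auto
  from someI_ex[OF this] obtain p q where pq: "p \<in> K" "q \<in> K" "meets s t p q"
    "(SOME (x, y). x \<in> K \<and> y \<in> K \<and> meets s t x y) = (p, q)" by (auto split: prod.splits)
  then have Gpq: "G s t = w p * star (w q)" using True by (simp add: G_def)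
  obtain u u' where u: "u \<in> carrier S" "u' \<in> carrier S" "u \<otimes> u' = \<one>" "u' \<otimes> u = \<one>"
      "x = p \<otimes> u" "y = q \<otimes> u"
    by (rule meets_unique[OF pq(3) m])
  have uK: "u \<in> K" using u unit_K by blast
  have "w x * star (w y) = w p * (w u * star (w u)) * star (w q)"
    by (simp add: u(5,6) star_mult mult.assoc pq uK flip: w_mult)
  also have "\<dots> = w p * star (w q)" by (simp add: w_unit[OF u(1-4)])
  finally show ?thesis using Gpq u uK pq by (simp add: mult_K_iff K_carrier)
next
  case False
  then have "\<not> (x \<in> K \<and> y \<in> K)" using m by blast
  moreover have "G s t = 0" unfolding G_def by (rule if_not_P[OF False])
  ultimately show ?thesis by auto
qed

lemma G_none: "\<not> (\<exists>x\<in>K. \<exists>y\<in>K. meets s t x y) \<Longrightarrow> G s t = 0"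
  unfolding G_def by (rule if_not_P)

lemma G_outside: "s \<notin> carrier S \<or> t \<notin> carrier S \<Longrightarrow> G s t = 0"
  by (rule G_none) (auto simp: meets_def)

lemma G_disjoint: "pri s \<inter> pri t = {} \<Longrightarrow> G s t = 0"
  by (rule G_none) (use meets_not_disjoint in blast)

lemma G_star: "star (G s t) = G t s"
proof (cases "\<exists>x\<in>K. \<exists>y\<in>K. meets s t x y")
  case True
  then obtain x y where "x \<in> K" "y \<in> K" "meets s t x y" by blast
  then show ?thesis
    using G_meets[of s t x y] G_meets[of t s y x] meets_sym by (simp add: star_mult star_star)
next
  case False
  then have "\<not> (\<exists>x\<in>K. \<exists>y\<in>K. meets t s x y)" using meets_sym by blast
  then show ?thesis using False by (simp add: G_none)
qed

lemma G_diag: "s \<in> carrier S \<Longrightarrow> G s s = 1"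
  using G_meets[OF meets_self] by (simp add: w_one)

lemma G_mult_left:
  assumes "r \<in> carrier S" "s \<in> carrier S" "t \<in> carrier S" shows "G (r \<otimes> s) (r \<otimes> t) = G s t"
  using assms(2,3)
proof (rule disjoint_or_meets)
  assume "pri s \<inter> pri t = {}"
  then show ?thesis using assms by (simp add: G_disjoint pri_mult_Int)
next
  fix x y assume "meets s t x y"
  then show ?thesis using G_meets meets_mult_left[OF _ assms(1)] by metis
qed

text \<open>
  This identity makes left multiplication by \<open>r\<close> adjointable on the induced module.
\<close>

lemma G_adjoint:
  assumes m: "meets r t x y" and s: "s \<in> carrier S"
  shows "G (r \<otimes> s) t = (if y \<in> K then G s x * star (w y) else 0)"
proof -
  have c: "x \<in> carrier S" "y \<in> carrier S" using m by (auto simp: meets_def)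
  from s c(1) show ?thesis
  proof (rule disjoint_or_meets)
    assume "pri s \<inter> pri x = {}"
    then show ?thesis using pri_mult_Int_meets[OF m s] by (simp add: G_disjoint)
  next
    fix p q assume n: "meets s x p q"
    have q: "q \<in> carrier S" using n by (simp add: meets_def)
    show ?thesis
      unfolding G_meets[OF meets_compose[OF m n]] G_meets[OF n]
      using q c by (auto simp: mult_K_iff star_mult mult.assoc simp flip: w_mult)
  qed
qed

lemma G_adjoint_disjoint:
  assumes "pri r \<inter> pri t = {}" "r \<in> carrier S" "s \<in> carrier S" shows "G (r \<otimes> s) t = 0"
  using pri_mult_subset[OF assms(2,3)] assms(1) by (intro G_disjoint) blast

text \<open>
  Translation by the kernel acts on \<open>G\<close> through the isometries of \<open>w\<close>. The hypothesis on the scale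
  enters here: for \<open>x \<notin> K\<close> it forces \<open>G k x = 0\<close>.
\<close>

lemma G_covariant:
  assumes k: "k \<in> K" and s: "s \<in> carrier S" shows "G (s \<otimes> k) t = star (w k) * G s t"
proof (cases "t \<in> carrier S")
  case True
  with s show ?thesis
  proof (rule disjoint_or_meets)
    assume "pri s \<inter> pri t = {}"
    then show ?thesis using G_adjoint_disjoint[of s t k] k s by (simp add: G_disjoint K_carrier)
  next
    fix x y assume m: "meets s t x y"
    have x: "x \<in> carrier S" using m by (simp add: meets_def)
    obtain q p where n: "meets x k q p" "q \<in> K" "N p = N x"
      by (rule meets_K_exists[OF x k])
    have p: "p \<in> carrier S" using n by (simp add: meets_def)
    have "G k x = (if x \<in> K then star (w k) * w x else 0)"
    proof (cases "x \<in> K")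
      case True
      then show ?thesis
        using G_meets[OF meets_sym[OF n(1)]] w_star_mult[OF meets_sym[OF n(1)] k True] n p x
        by (simp add: K_def)
    next
      case False
      then show ?thesis using G_meets[OF meets_sym[OF n(1)]] n(3) x by (simp add: K_def)
    qed
    then show ?thesis
      unfolding G_adjoint[OF m K_carrier[OF k]] G_meets[OF m] by (simp add: mult.assoc)
  qed
qed (simp add: G_outside)

lemma G_cases:
  obtains "G s t = 0" | x y where "meets s t x y" "x \<in> K" "y \<in> K" "G s t = w x * star (w y)"
proof (cases "\<exists>x\<in>K. \<exists>y\<in>K. meets s t x y")
  case True
  then show thesis using that(2) G_meets by metis
qed (use that(1) G_none in blast)

theorem partial_isometry_kernel_G: "partial_isometry_kernel G"
  unfolding partial_isometry_kernel_def
proof (intro conjI allI)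
  fix i j k
  show "star (G i j) = G j i" by (rule G_star)
  show "G i j * G j j = G i j"
    by (cases "j \<in> carrier S") (simp_all add: G_diag G_outside)
  have range: "G i j * G j i = w x * star (w x)"
    if "G i j = w x * star (w y)" "y \<in> K" for i j x y
  proof -
    have "G j i = w y * star (w x)"
      using G_star[of i j] by (simp add: that star_mult star_star)
    then have "G i j * G j i = w x * (star (w y) * w y) * star (w x)"
      using that by (simp add: mult.assoc)
    then show ?thesis using that by (simp add: w_isometry)
  qed
  show "G i j * G j k = G i j * G j i * G i k"
  proof (rule G_cases[of i j])
    fix x y assume m: "meets i j x y" "x \<in> K" "y \<in> K" and Gij: "G i j = w x * star (w y)"
    then have c: "i \<in> carrier S" "j \<in> carrier S" "i \<otimes> x = j \<otimes> y" by (auto simp: meets_def)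
    have "star (w y) * G j k = star (w x) * G i k"
      using G_covariant[OF m(3) c(2), of k] G_covariant[OF m(2) c(1), of k] c(3) by simp
    then show ?thesis unfolding range[OF Gij m(3)] by (simp add: Gij mult.assoc)
  qed simp
  show "(G i j * G j i) * (G i k * G k i) = (G i k * G k i) * (G i j * G j i)"
  proof (rule G_cases[of i j])
    fix x y assume j: "x \<in> K" "y \<in> K" "G i j = w x * star (w y)"
    show ?thesis
    proof (rule G_cases[of i k])
      fix x' y' assume k: "x' \<in> K" "y' \<in> K" "G i k = w x' * star (w y')"
      show ?thesis
        unfolding range[OF j(3,2)] range[OF k(3,2)] by (rule w_ranges_commute[OF j(1) k(1)])
    qed simp
  qed simp
qed

end

section \<open>The induced module\<close>

subsection \<open>Additive maps on finitely supported functions\<close>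

text \<open>
  The additive extension to finitely supported functions of a map given on the functions with
  one-point support; \<open>f\<close> has to be additive in its second argument.
\<close>

definition pm_lift :: "('s \<Rightarrow> 'b::zero \<Rightarrow> 'c::comm_monoid_add) \<Rightarrow> ('s \<Rightarrow>\<^sub>0 'b) \<Rightarrow> 'c" where
  "pm_lift f x = (\<Sum>s\<in>Poly_Mapping.keys x. f s (Poly_Mapping.lookup x s))"

lemma additive_zero:
  fixes f :: "'b::monoid_add \<Rightarrow> 'c::ab_group_add"
  assumes "\<And>a b. f (a + b) = f a + f b" shows "f 0 = 0"
  using assms[of 0 0] by simp

lemma pm_lift_add:
  fixes f :: "'s \<Rightarrow> 'b::comm_monoid_add \<Rightarrow> 'c::ab_group_add"
  assumes f: "\<And>s a b. f s (a + b) = f s a + f s b"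
  shows "pm_lift f (x + y) = pm_lift f x + pm_lift f y"
proof -
  let ?K = "Poly_Mapping.keys x \<union> Poly_Mapping.keys y"
  have f0: "f s 0 = 0" for s by (rule additive_zero[of "f s", OF f])
  have sup: "pm_lift f z = (\<Sum>s\<in>?K. f s (Poly_Mapping.lookup z s))" if "Poly_Mapping.keys z \<subseteq> ?K" for z
    unfolding pm_lift_def by (rule sum.mono_neutral_left) (use that in \<open>auto simp: in_keys_iff f0\<close>)
  show ?thesis using keys_add[of x y] by (simp add: sup lookup_add f sum.distrib)
qed

lemma pm_lift_single:
  fixes f :: "'s \<Rightarrow> 'b::comm_monoid_add \<Rightarrow> 'c::ab_group_add"
  assumes f: "\<And>s a b. f s (a + b) = f s a + f s b"
  shows "pm_lift f (Poly_Mapping.single s b) = f s b"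
  using additive_zero[of "f s", OF f] by (cases "b = 0") (simp_all add: pm_lift_def)

lemma additive_ext:
  fixes F H :: "('s \<Rightarrow>\<^sub>0 'b::comm_monoid_add) \<Rightarrow> 'c::ab_group_add"
  assumes F: "\<And>x y. F (x + y) = F x + F y" and H: "\<And>x y. H (x + y) = H x + H y"
    and eq: "\<And>s b. F (Poly_Mapping.single s b) = H (Poly_Mapping.single s b)"
  shows "F x = H x"
proof -
  have sum: "F (sum g A) = (\<Sum>i\<in>A. F (g i))" "H (sum g A) = (\<Sum>i\<in>A. H (g i))" for g and A :: "'s set"
    by (induction A rule: infinite_finite_induct) (simp_all add: additive_zero[of F, OF F] additive_zero[of H, OF H] F H)
  have x: "x = (\<Sum>w\<in>Poly_Mapping.keys x. Poly_Mapping.single w (Poly_Mapping.lookup x w))"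
    by (rule poly_mapping_eqI) (simp add: lookup_sum lookup_single when_def in_keys_iff)
  show ?thesis by (subst (1 2) x) (simp only: sum eq)
qed

lemma biadditive_ext:
  fixes f g :: "('s \<Rightarrow>\<^sub>0 'b::comm_monoid_add) \<Rightarrow> ('s \<Rightarrow>\<^sub>0 'b) \<Rightarrow> 'c::ab_group_add"
  assumes "\<And>x y z. f (x + y) z = f x z + f y z" "\<And>x y z. f z (x + y) = f z x + f z y"
    "\<And>x y z. g (x + y) z = g x z + g y z" "\<And>x y z. g z (x + y) = g z x + g z y"
    and eq: "\<And>s b t c. f (Poly_Mapping.single s b) (Poly_Mapping.single t c)
      = g (Poly_Mapping.single s b) (Poly_Mapping.single t c)"
  shows "f x y = g x y"
proof (rule additive_ext[of "\<lambda>x. f x y" "\<lambda>x. g x y"])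
  fix s b
  show "f (Poly_Mapping.single s b) y = g (Poly_Mapping.single s b) y"
    by (rule additive_ext[of "f (Poly_Mapping.single s b)" "g (Poly_Mapping.single s b)"])
      (rule assms)+
qed (rule assms)+

subsection \<open>The module and its representation\<close>

context kernel_isometries
begin

text \<open>
  The module consists of the finitely supported functions on \<open>S\<close> with values in the algebra of the
  kernel, with inner product given by \<open>G\<close>; \<open>delta s b\<close> stands for \<open>v s * b\<close>.
\<close>

abbreviation delta :: "'s \<Rightarrow> 'b \<Rightarrow> 's \<Rightarrow>\<^sub>0 'b" where
  "delta \<equiv> Poly_Mapping.single"

text \<open>
  The inner product with kernel \<open>G\<close>, and the right action of the algebra of the kernel.
\<close>

definition kform :: "('s \<Rightarrow>\<^sub>0 'b) \<Rightarrow> ('s \<Rightarrow>\<^sub>0 'b) \<Rightarrow> 'b" where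
  "kform x y = pm_lift (\<lambda>s b. pm_lift (\<lambda>t c. star b * G s t * c) y) x"

definition kact :: "('s \<Rightarrow>\<^sub>0 'b) \<Rightarrow> 'b \<Rightarrow> ('s \<Rightarrow>\<^sub>0 'b)" where
  "kact x b = pm_lift (\<lambda>s c. delta s (c * b)) x"

text \<open>
  \<open>hit r t\<close> says that \<open>r\<close> and \<open>t\<close> have a least common multiple for which the cofactor of \<open>t\<close> is in the
  kernel; \<open>mate r t\<close> is a chosen pair of such cofactors.
\<close>

definition hit :: "'s \<Rightarrow> 's \<Rightarrow> bool" where
  "hit r t \<longleftrightarrow> (\<exists>x. \<exists>y\<in>K. meets r t x y)"

definition mate :: "'s \<Rightarrow> 's \<Rightarrow> 's \<times> 's" where
  "mate r t = (SOME z. snd z \<in> K \<and> meets r t (fst z) (snd z))"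

text \<open>
  Left multiplication by \<open>v r\<close> and its adjoint. For \<open>r \<otimes> x = t \<otimes> y\<close> the product \<open>star (v r) * v t\<close> is
  \<open>v x * star (v y)\<close>, which maps \<open>b\<close> to \<open>v x * (star (w y) * b)\<close> if \<open>y\<close> is in the kernel; otherwise
  the adjoint is set to \<open>0\<close>. The choice made by \<open>mate\<close> only matters up to null vectors.
\<close>

definition left_mult :: "'s \<Rightarrow> ('s \<Rightarrow>\<^sub>0 'b) \<Rightarrow> ('s \<Rightarrow>\<^sub>0 'b)" where
  "left_mult r = pm_lift (\<lambda>s b. if s \<in> carrier S then delta (r \<otimes> s) b else 0)"

definition left_div :: "'s \<Rightarrow> ('s \<Rightarrow>\<^sub>0 'b) \<Rightarrow> ('s \<Rightarrow>\<^sub>0 'b)" where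
  "left_div r = pm_lift (\<lambda>t b. if hit r t
     then delta (fst (mate r t)) (star (w (snd (mate r t))) * b) else 0)"

lemma mate: "hit r t \<Longrightarrow> snd (mate r t) \<in> K \<and> meets r t (fst (mate r t)) (snd (mate r t))"
  unfolding mate_def by (rule someI_ex) (auto simp: hit_def)

lemma hit_iff:
  assumes m: "meets r t x y" shows "hit r t \<longleftrightarrow> y \<in> K"
proof
  assume "hit r t"
  then have n: "snd (mate r t) \<in> K" "meets r t (fst (mate r t)) (snd (mate r t))" using mate by auto
  obtain u u' where u: "u \<in> carrier S" "u' \<in> carrier S" "u \<otimes> u' = \<one>" "u' \<otimes> u = \<one>"
      "y = snd (mate r t) \<otimes> u"
    by (rule meets_unique[OF n(2) m])
  then show "y \<in> K" using n(1) unit_K mult_K_iff K_carrier by blast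
qed (use m in \<open>auto simp: hit_def\<close>)

lemma kform_inner_add:
  "pm_lift (\<lambda>t c. star b * G s t * c) (x + y)
    = pm_lift (\<lambda>t c. star b * G s t * c) x + pm_lift (\<lambda>t c. star b * G s t * c) y"
  by (rule pm_lift_add) (simp add: distrib_left)

lemma kform_outer_add:
  "pm_lift (\<lambda>t c. star (a + b) * G s t * c) y
    = pm_lift (\<lambda>t c. star a * G s t * c) y + pm_lift (\<lambda>t c. star b * G s t * c) y"
  by (simp add: pm_lift_def star_add distrib_right sum.distrib)

lemma kform_add_right: "kform x (y + z) = kform x y + kform x z"
  unfolding kform_def kform_inner_add by (simp add: pm_lift_def sum.distrib)

lemma kform_add_left: "kform (x + y) z = kform x z + kform y z"
  unfolding kform_def by (rule pm_lift_add) (rule kform_outer_add)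

lemma kform_single: "kform (delta s b) (delta t c) = star b * G s t * c"
  unfolding kform_def
  by (subst pm_lift_single, rule kform_outer_add, rule pm_lift_single) (simp add: distrib_left)

lemma kact_add: "kact (x + y) b = kact x b + kact y b"
  unfolding kact_def by (rule pm_lift_add) (simp add: distrib_right single_add)

lemma kact_single: "kact (delta s c) b = delta s (c * b)"
  unfolding kact_def by (rule pm_lift_single) (simp add: distrib_right single_add)

lemma left_mult_add: "left_mult r (x + y) = left_mult r x + left_mult r y"
  unfolding left_mult_def by (rule pm_lift_add) (simp add: single_add)

lemma left_mult_single: "left_mult r (delta s b) = (if s \<in> carrier S then delta (r \<otimes> s) b else 0)"
  unfolding left_mult_def by (rule pm_lift_single) (simp add: single_add)

lemma left_div_add: "left_div r (x + y) = left_div r x + left_div r y"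
  unfolding left_div_def by (rule pm_lift_add) (simp add: distrib_left single_add)

lemma left_div_single:
  "left_div r (delta t b) = (if hit r t then delta (fst (mate r t)) (star (w (snd (mate r t))) * b) else 0)"
  unfolding left_div_def by (rule pm_lift_single) (simp add: distrib_left single_add)

lemma kform_zero [simp]: "kform 0 y = 0" "kform x 0 = 0"
  using kform_add_left[of 0 0 y] kform_add_right[of x 0 0] by simp_all

lemma kform_adjoint:
  assumes r: "r \<in> carrier S" shows "kform (left_mult r x) y = kform x (left_div r y)"
proof (rule biadditive_ext[of "\<lambda>x y. kform (left_mult r x) y" "\<lambda>x y. kform x (left_div r y)"])
  fix s b t c
  show "kform (left_mult r (delta s b)) (delta t c) = kform (delta s b) (left_div r (delta t c))"
  proof (cases "s \<in> carrier S \<and> t \<in> carrier S")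
    case True
    then have s: "s \<in> carrier S" and t: "t \<in> carrier S" by auto
    from r t show ?thesis
    proof (rule disjoint_or_meets)
      assume d: "pri r \<inter> pri t = {}"
      then have "\<not> hit r t" using meets_not_disjoint unfolding hit_def by blast
      then show ?thesis
        using G_adjoint_disjoint[OF d r s] s by (simp add: left_mult_single left_div_single kform_single)
    next
      fix x y assume m: "meets r t x y"
      show ?thesis
      proof (cases "hit r t")
        case True
        then have "snd (mate r t) \<in> K" "meets r t (fst (mate r t)) (snd (mate r t))"
          using mate by auto
        then show ?thesis
          using G_adjoint[OF _ s] s True by (simp add: left_mult_single left_div_single kform_single mult.assoc)
      next
        case False
        then show ?thesis
          using G_adjoint[OF m s] s hit_iff[OF m] by (simp add: left_mult_single left_div_single kform_single)
      qed
    qed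
  next
    case False
    show ?thesis
    proof (cases "s \<in> carrier S")
      case True
      then have t: "t \<notin> carrier S" using False by simp
      then have "\<not> hit r t" by (auto simp: hit_def meets_def)
      then show ?thesis using t by (simp add: left_mult_single left_div_single kform_single G_outside)
    next
      case False
      then show ?thesis by (simp add: left_mult_single left_div_single kform_single G_outside)
    qed
  qed
qed (simp_all add: kform_add_left kform_add_right left_mult_add left_div_add)

lemma kform_isometry:
  assumes r: "r \<in> carrier S" shows "kform (left_mult r x) (left_mult r y) = kform x y"
proof (rule biadditive_ext[of "\<lambda>x y. kform (left_mult r x) (left_mult r y)" kform])
  fix s b t c
  show "kform (left_mult r (delta s b)) (left_mult r (delta t c)) = kform (delta s b) (delta t c)"
    using r by (simp add: left_mult_single kform_single G_mult_left G_outside)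
qed (simp_all add: kform_add_left kform_add_right left_mult_add)

sublocale isometric_module_rep kform kact "carrier S" left_mult left_div
proof
  fix x y z :: "'s \<Rightarrow>\<^sub>0 'b" and b c :: 'b and s :: 's
  show "kform x (y + z) = kform x y + kform x z" by (rule kform_add_right)
  show "kform x (kact y b) = kform x y * b"
    by (rule biadditive_ext[of "\<lambda>x y. kform x (kact y b)" "\<lambda>x y. kform x y * b"])
      (simp_all add: kform_add_left kform_add_right kact_add distrib_right kact_single kform_single mult.assoc)
  show "star (kform x y) = kform y x"
    by (rule biadditive_ext[of "\<lambda>x y. star (kform x y)" "\<lambda>x y. kform y x"])
      (simp_all add: kform_add_left kform_add_right star_add kform_single star_mult star_star G_star mult.assoc)
  show "pos_elem (kform x x)"
    unfolding kform_def pm_lift_def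
    by (rule partial_isometry_kernel_pos[OF finite_keys partial_isometry_kernel_G])
  show "kact (x + y) b = kact x b + kact y b" by (rule kact_add)
  show "kact x (b + c) = kact x b + kact x c"
    by (simp add: kact_def pm_lift_def distrib_left single_add sum.distrib)
  show "kact (kact x b) c = kact x (b * c)"
    by (rule additive_ext[of "\<lambda>x. kact (kact x b) c" "\<lambda>x. kact x (b * c)"])
      (simp_all add: kact_add kact_single mult.assoc)
  show "kact x 1 = x"
    by (rule additive_ext[of "\<lambda>x. kact x 1" "\<lambda>x. x"]) (simp_all add: kact_add kact_single)
  show "left_mult s (x + y) = left_mult s x + left_mult s y" by (rule left_mult_add)
  show "left_div s (x + y) = left_div s x + left_div s y" by (rule left_div_add)
  have kact0: "kact 0 b = 0" using kact_add[of 0 0 b] by simp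
  show "left_mult s (kact x b) = kact (left_mult s x) b"
    by (rule additive_ext[of "\<lambda>x. left_mult s (kact x b)" "\<lambda>x. kact (left_mult s x) b"])
      (simp_all add: kact_add left_mult_add kact_single left_mult_single kact0)
  show "left_div s (kact x b) = kact (left_div s x) b"
    by (rule additive_ext[of "\<lambda>x. left_div s (kact x b)" "\<lambda>x. kact (left_div s x) b"])
      (simp_all add: kact_add left_div_add kact_single left_div_single kact0 mult.assoc)
  show "s \<in> carrier S \<Longrightarrow> kform (left_mult s x) y = kform x (left_div s y)" by (rule kform_adjoint)
  show "s \<in> carrier S \<Longrightarrow> kform (left_mult s x) (left_mult s y) = kform x y" by (rule kform_isometry)
qed

lemma kform_adjoint': "r \<in> carrier S \<Longrightarrow> kform (left_div r x) y = kform x (left_mult r y)"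
  by (metis form_star kform_adjoint)

subsection \<open>The relations of the semigroup algebra\<close>

text \<open>
  The projection by which \<open>left_mult r (left_div r _)\<close> acts on \<open>delta t b\<close> modulo null vectors. The
  relations for range projections thereby reduce to identities in the algebra of the kernel.
\<close>

definition rng :: "'s \<Rightarrow> 's \<Rightarrow> 'b" where
  "rng r t = (if hit r t then w (snd (mate r t)) * star (w (snd (mate r t))) else 0)"

lemma rng_meets:
  assumes m: "meets r t x y"
  shows "rng r t = (if y \<in> K then w y * star (w y) else 0)"
proof (cases "hit r t")
  case True
  then have n: "snd (mate r t) \<in> K" "meets r t (fst (mate r t)) (snd (mate r t))" using mate by auto
  obtain u u' where u: "u \<in> carrier S" "u' \<in> carrier S" "u \<otimes> u' = \<one>" "u' \<otimes> u = \<one>"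
      "y = snd (mate r t) \<otimes> u"
    by (rule meets_unique[OF n(2) m])
  have uK: "u \<in> K" using u unit_K by blast
  have "w y * star (w y) = w (snd (mate r t)) * (w u * star (w u)) * star (w (snd (mate r t)))"
    by (simp add: u(5) star_mult mult.assoc n uK flip: w_mult)
  then show ?thesis using True hit_iff[OF m] by (simp add: rng_def w_unit[OF u(1-4)])
next
  case False
  then show ?thesis using hit_iff[OF m] by (simp add: rng_def)
qed

lemma rng_none: "\<not> hit r t \<Longrightarrow> rng r t = 0"
  by (simp add: rng_def)

lemma kform_range:
  assumes s: "s \<in> carrier S"
  shows "kform (left_mult s (left_div s (delta u b))) z = kform (delta u (rng s u * b)) z"
proof (rule additive_ext[of "kform (left_mult s (left_div s (delta u b)))"])
  fix v c
  show "kform (left_mult s (left_div s (delta u b))) (delta v c) = kform (delta u (rng s u * b)) (delta v c)"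
  proof (cases "hit s u")
    case True
    define x y where "x = fst (mate s u)" and "y = snd (mate s u)"
    have m: "y \<in> K" "meets s u x y" using True mate by (auto simp: x_def y_def)
    then have c: "x \<in> carrier S" "u \<in> carrier S" "s \<otimes> x = u \<otimes> y" by (auto simp: meets_def)
    have ld: "left_div s (delta u b) = delta x (star (w y) * b)"
      using True by (simp add: left_div_single x_def y_def)
    show ?thesis
      unfolding ld rng_meets[OF m(2)]
      by (simp add: left_mult_single c kform_single m G_covariant star_mult star_star mult.assoc)
  next
    case False
    then show ?thesis using left_mult_add[of s 0 0] by (simp add: left_div_single rng_none)
  qed
qed (rule kform_add_right)+

text \<open>
  Both sides encode the intersection of the ideals of \<open>s\<close>, \<open>t\<close> and \<open>u\<close>.
\<close>

lemma rng_mult: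
  assumes st: "s \<in> carrier S" "t \<in> carrier S" and r: "r \<in> carrier S" "pri s \<inter> pri t = pri r"
  shows "rng s u * rng t u = rng r u"
proof (cases "hit s u \<and> hit t u")
  case True
  then obtain x y x' y' where m: "meets s u x y" "y \<in> K" "meets t u x' y'" "y' \<in> K"
    by (auto simp: hit_def)
  obtain a b where n: "meets y y' a b" "a \<in> K"
    by (rule meets_K_exists[OF K_carrier[OF m(2)] m(4)])
  have c: "u \<in> carrier S" "y \<in> carrier S" "y' \<in> carrier S" "a \<in> carrier S"
      "pri s \<inter> pri u = pri (s \<otimes> x)" "s \<otimes> x = u \<otimes> y" "pri t \<inter> pri u = pri (t \<otimes> x')" "t \<otimes> x' = u \<otimes> y'"
      "pri y \<inter> pri y' = pri (y \<otimes> a)"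
    using m n by (simp_all add: meets_def)
  have ya: "y \<otimes> a \<in> K" using m n c by (simp add: mult_K_iff)
  have "pri r \<inter> pri u = (pri s \<inter> pri u) \<inter> (pri t \<inter> pri u)" using r by blast
  also have "\<dots> = pri (u \<otimes> y) \<inter> pri (u \<otimes> y')" by (simp only: c)
  also have "\<dots> = pri (u \<otimes> (y \<otimes> a))"
    unfolding pri_mult_Int[OF c(1-3)] c(9) by (rule pri_mult[symmetric]) (use c in auto)
  finally have ru: "pri r \<inter> pri u = pri (u \<otimes> (y \<otimes> a))" .
  then have "u \<otimes> (y \<otimes> a) \<in> pri r" using pri_self[of "u \<otimes> (y \<otimes> a)"] c by auto
  then obtain z where z: "z \<in> carrier S" "u \<otimes> (y \<otimes> a) = r \<otimes> z" by (auto simp: pri_iff)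
  then have "meets r u z (y \<otimes> a)" using ru r c by (simp add: meets_def)
  then show ?thesis
    using w_ranges[OF n(1) m(2,4)] rng_meets[OF m(1)] rng_meets[OF m(3)] m ya rng_meets by simp
next
  case False
  have "\<not> hit r u"
  proof
    assume "hit r u"
    then obtain z y where m: "meets r u z y" "y \<in> K" by (auto simp: hit_def)
    then have c: "u \<in> carrier S" "z \<in> carrier S" "y \<in> carrier S" "r \<otimes> z = u \<otimes> y"
      by (simp_all add: meets_def)
    have "hit q u" if q: "q \<in> carrier S" "r \<in> pri q" for q
    proof -
      obtain p where p: "p \<in> carrier S" "r = q \<otimes> p" using q by (auto simp: pri_iff)
      from q(1) c(1) show ?thesis
      proof (rule disjoint_or_meets)
        assume "pri q \<inter> pri u = {}"
        moreover have "r \<otimes> z \<in> pri q"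
        proof -
          have "r \<otimes> z \<in> pri r" using c(2) by (auto simp: pri_iff)
          then show ?thesis using pri_mult_subset[OF q(1) p(1)] unfolding p(2)[symmetric] by blast
        qed
        moreover have "r \<otimes> z \<in> pri u" using c by (auto simp: pri_iff)
        ultimately show ?thesis by blast
      next
        fix x' y' assume m': "meets q u x' y'"
        have "q \<otimes> (p \<otimes> z) = u \<otimes> y" using p c q by (simp add: m_assoc)
        then obtain d where "d \<in> carrier S" "y = y' \<otimes> d"
          using meets_factor[OF m' m_closed[OF p(1) c(2)] c(3)] by blast
        then have "y' \<in> K" using m(2) mult_K_iff meets_carrier[OF m'] by blast
        then show ?thesis using m' by (auto simp: hit_def)
      qed
    qed
    then show False using False st r pri_self[OF r(1)] by blast
  qed
  then show ?thesis using False by (auto simp: rng_none)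
qed

lemma rng_mult_disjoint:
  assumes st: "s \<in> carrier S" "t \<in> carrier S" and d: "pri s \<inter> pri t = {}"
  shows "rng s u * rng t u = 0"
proof (cases "hit s u \<and> hit t u")
  case True
  then obtain x y x' y' where m: "meets s u x y" "y \<in> K" "meets t u x' y'" "y' \<in> K"
    by (auto simp: hit_def)
  obtain a b where n: "meets y y' a b"
    using meets_K_exists[OF K_carrier[OF m(2)] m(4)] by blast
  have c: "u \<in> carrier S" "x \<in> carrier S" "y \<in> carrier S" "x' \<in> carrier S" "y' \<in> carrier S"
    "a \<in> carrier S" "b \<in> carrier S" "s \<otimes> x = u \<otimes> y" "t \<otimes> x' = u \<otimes> y'" "y \<otimes> a = y' \<otimes> b"
    using m n by (simp_all add: meets_def)
  have "s \<otimes> (x \<otimes> a) = u \<otimes> (y \<otimes> a)"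
    unfolding m_assoc[OF st(1) c(2,6), symmetric] c(8) by (rule m_assoc[OF c(1,3,6)])
  moreover have "t \<otimes> (x' \<otimes> b) = u \<otimes> (y' \<otimes> b)"
    unfolding m_assoc[OF st(2) c(4,7), symmetric] c(9) by (rule m_assoc[OF c(1,5,7)])
  ultimately have "s \<otimes> (x \<otimes> a) = t \<otimes> (x' \<otimes> b)" using c(10) by simp
  then have "s \<otimes> (x \<otimes> a) \<in> pri s \<inter> pri t" using c m_closed by (metis IntI pri_iff)
  then show ?thesis using d by blast
qed (auto simp: rng_none)

lemma kform_ranges:
  assumes s: "s \<in> carrier S" and t: "t \<in> carrier S"
  shows "kform (left_mult s (left_div s (left_mult t (left_div t (delta u b))))) z
    = kform (delta u (rng s u * rng t u * b)) z"
proof -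
  have sym: "kform (left_mult s (left_div s x)) z = kform x (left_mult s (left_div s z))" for x
    by (simp add: kform_adjoint kform_adjoint' s)
  show ?thesis
    by (simp only: sym kform_range[OF t]) (simp only: sym[symmetric] kform_range[OF s] mult.assoc)
qed

lemma opnorm_zeroI:
  assumes "p \<in> free_on (carrier S)" "q \<in> free_on (carrier S)"
    and "\<And>u b z. kform (op p (delta u b)) z = kform (op q (delta u b)) z"
  shows "opnorm (p - q) = 0"
proof (rule opnorm_eq_zero)
  show "p - q \<in> free_on (carrier S)" using assms free_on_diff by blast
  have "kform (op p x) z = kform (op q x) z" for x z
    by (rule additive_ext[of "\<lambda>x. kform (op p x) z" "\<lambda>x. kform (op q x) z"])
      (simp_all add: op_add_right kform_add_left assms(3))
  then show "mnorm (op (p - q) x) = 0" for x by (simp add: op_diff mnorm_eq_zero)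
qed

lemma opnorm_relators:
  assumes "p \<in> lcm_relators S" shows "opnorm p = 0"
proof -
  note fr = free_on_gen free_on_fstar free_on_mult free_on_one
  have free0: "0 \<in> free_on (carrier S)" by (simp add: free_on_def)
  have g: "gen s \<in> free_on (carrier S)" if "s \<in> carrier S" for s using that by (rule free_on_gen)
  from assms show ?thesis
    unfolding lcm_relators_def
  proof (elim UnE)
    assume "p \<in> {gen \<one> - 1}"
    then have 1: "p = gen \<one> - 1" by simp
    show ?thesis unfolding 1
    proof (rule opnorm_zeroI)
      fix u b z
      show "kform (op (gen \<one>) (delta u b)) z = kform (op 1 (delta u b)) z"
      proof (cases "u \<in> carrier S")
        case False
        have "kform (delta u b) z = 0"
          by (rule additive_ext[of "kform (delta u b)" "\<lambda>_. 0"])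
            (simp_all add: kform_add_right kform_single G_outside False)
        then show ?thesis using False by (simp add: left_mult_single)
      qed (simp add: left_mult_single)
    qed (intro fr one_closed)+
  next
    assume "p \<in> {gen s * gen t - gen (s \<otimes> t) | s t. s \<in> carrier S \<and> t \<in> carrier S}"
    then obtain s t where 2: "s \<in> carrier S" "t \<in> carrier S" and p: "p = gen s * gen t - gen (s \<otimes> t)"
      by blast
    show ?thesis unfolding p
    proof (rule opnorm_zeroI)
      fix u b z
      show "kform (op (gen s * gen t) (delta u b)) z = kform (op (gen (s \<otimes> t)) (delta u b)) z"
        using 2 left_mult_add[of s 0 0] by (simp add: op_mult left_mult_single m_assoc)
    qed (intro fr m_closed 2)+
  next
    assume "p \<in> {fstar (gen s) * gen s - 1 | s. s \<in> carrier S}"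
    then obtain s where 3: "s \<in> carrier S" and p: "p = fstar (gen s) * gen s - 1" by blast
    show ?thesis unfolding p
    proof (rule opnorm_zeroI)
      fix u b z
      show "kform (op (fstar (gen s) * gen s) (delta u b)) z = kform (op 1 (delta u b)) z"
        using 3 by (simp add: op_mult kform_adjoint' kform_isometry)
    qed (intro fr 3)+
  next
    assume "p \<in> {gen s * fstar (gen s) * gen t * fstar (gen t) - gen r * fstar (gen r) | s t r.
        s \<in> carrier S \<and> t \<in> carrier S \<and> r \<in> carrier S \<and> pri s \<inter> pri t = pri r}"
    then obtain s t r where 4: "s \<in> carrier S" "t \<in> carrier S" "r \<in> carrier S" "pri s \<inter> pri t = pri r"
        and p: "p = gen s * fstar (gen s) * gen t * fstar (gen t) - gen r * fstar (gen r)"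
      by blast
    show ?thesis unfolding p
    proof (rule opnorm_zeroI)
      fix u b z
      show "kform (op (gen s * fstar (gen s) * gen t * fstar (gen t)) (delta u b)) z
          = kform (op (gen r * fstar (gen r)) (delta u b)) z"
        using 4(1-3) by (simp add: op_mult kform_ranges kform_range rng_mult[OF 4(1-4)])
    qed (intro fr 4)+
  next
    assume "p \<in> {gen s * fstar (gen s) * gen t * fstar (gen t) | s t.
        s \<in> carrier S \<and> t \<in> carrier S \<and> pri s \<inter> pri t = {}}"
    then obtain s t where 5: "s \<in> carrier S" "t \<in> carrier S" "pri s \<inter> pri t = {}"
        and p: "p = gen s * fstar (gen s) * gen t * fstar (gen t)"
      by blast
    have "opnorm (p - 0) = 0" unfolding p
    proof (rule opnorm_zeroI)
      fix u b z
      show "kform (op (gen s * fstar (gen s) * gen t * fstar (gen t)) (delta u b)) z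
          = kform (op 0 (delta u b)) z"
        using 5(1-3) by (simp add: op_mult kform_ranges rng_mult_disjoint)
    qed (intro fr 5 free0)+
    then show ?thesis by simp
  qed
qed

end

section \<open>Bounded extensions from the free algebra\<close>

lemma contractive_continuous:
  fixes E :: "'a::real_normed_vector \<Rightarrow> 'b::real_normed_vector"
  assumes add: "\<And>x y. E (x + y) = E x + E y" and le: "\<And>x. norm (E x) \<le> norm x"
  shows "continuous_on A E"
proof -
  have diff: "E (x - y) = E x - E y" for x y
    using add[of "x - y" y] by (simp add: algebra_simps)
  have "dist (E x) (E y) \<le> dist x y" for x y
    using le[of "x - y"] by (simp add: dist_norm diff)
  then show ?thesis
    unfolding continuous_on_iff by (metis order_le_less_trans)
qed

lemma free_dense_induct:
  assumes "closure (eval_free v ` free_on X) = UNIV" "closed {y. P y}"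
    and "\<And>p. p \<in> free_on X \<Longrightarrow> P (eval_free v p)"
  shows "P y"
proof -
  have "eval_free v ` free_on X \<subseteq> {y. P y}" using assms(3) by blast
  then have "closure (eval_free v ` free_on X) \<subseteq> {y. P y}" by (rule closure_minimal[OF _ assms(2)])
  then show ?thesis using assms(1) by blast
qed

lemma continuous_scaleC: "continuous_on A f \<Longrightarrow> continuous_on A (\<lambda>x. c *\<^sub>C (f x :: 'a::cstar_algebra))"
proof -
  have "continuous_on UNIV (\<lambda>x::'a. c *\<^sub>C x)"
    by (simp add: continuous_on_eq_continuous_at isCont_scaleC)
  then show "continuous_on A f \<Longrightarrow> continuous_on A (\<lambda>x. c *\<^sub>C f x)"
    by (rule continuous_on_compose2) auto
qed

lemma free_bounded_extension:
  fixes v :: "'s \<Rightarrow> 'a::cstar_algebra" and \<Phi> :: "'s free_star_algebra \<Rightarrow> 'b::cstar_algebra"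
  assumes dense: "closure (eval_free v ` free_on X) = UNIV"
    and add: "\<And>p q. \<Phi> (p + q) = \<Phi> p + \<Phi> q"
    and scale: "\<And>c p. \<Phi> (fscale c p) = c *\<^sub>C \<Phi> p"
    and le: "\<And>p. p \<in> free_on X \<Longrightarrow> norm (\<Phi> p) \<le> norm (eval_free v p)"
  obtains E where "clinear_map E" "\<And>x. norm (E x) \<le> norm x"
    "\<And>p. p \<in> free_on X \<Longrightarrow> E (eval_free v p) = \<Phi> p"
proof -
  let ?D = "eval_free v ` free_on X"
  have diff: "\<Phi> (p - q) = \<Phi> p - \<Phi> q" for p q
    using add[of "p - q" q] by (simp add: algebra_simps)
  define g where "g y = \<Phi> (SOME p. p \<in> free_on X \<and> eval_free v p = y)" for y
  have g: "g (eval_free v p) = \<Phi> p" if "p \<in> free_on X" for p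
  proof -
    define q where "q = (SOME q. q \<in> free_on X \<and> eval_free v q = eval_free v p)"
    have q: "q \<in> free_on X \<and> eval_free v q = eval_free v p"
      unfolding q_def by (rule someI[of _ p]) (use that in simp)
    then have "norm (\<Phi> (q - p)) \<le> 0"
      using le[of "q - p"] that by (simp add: free_on_diff eval_free_diff)
    then show ?thesis by (simp add: g_def diff flip: q_def)
  qed
  have "dist (g y) (g z) \<le> dist y z" if "y \<in> ?D" "z \<in> ?D" for y z
  proof -
    from that obtain p q where pq: "p \<in> free_on X" "q \<in> free_on X"
        "y = eval_free v p" "z = eval_free v q"
      by blast
    then show ?thesis
      using le[OF free_on_diff[OF pq(1,2)]] by (simp add: g dist_norm eval_free_diff diff)
  qed
  then have "uniformly_continuous_on ?D g"
    unfolding uniformly_continuous_on_def by (metis order_le_less_trans)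
  from uniformly_continuous_on_extension_on_closure[OF this] obtain E where
      uc: "uniformly_continuous_on UNIV E" and Eg: "\<And>y. y \<in> ?D \<Longrightarrow> g y = E y"
    unfolding dense by metis
  have cont: "continuous_on UNIV E" by (rule uniformly_continuous_imp_continuous[OF uc])
  note cont' = continuous_on_compose2[OF cont _ subset_UNIV]
  have E: "E (eval_free v p) = \<Phi> p" if "p \<in> free_on X" for p
    using g[OF that] Eg[of "eval_free v p"] that by simp
  have "norm (E x) \<le> norm x" for x
  proof (rule free_dense_induct[OF dense, where P = "\<lambda>x. norm (E x) \<le> norm x"])
    show "closed {x. norm (E x) \<le> norm x}"
      by (intro closed_Collect_le continuous_intros cont)
  qed (simp add: E le)
  moreover have "E (x + y) = E x + E y" for x y
  proof (rule free_dense_induct[OF dense, where P = "\<lambda>x. E (x + y) = E x + E y"])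
    show "closed {x. E (x + y) = E x + E y}"
      by (intro closed_Collect_eq continuous_intros cont cont')
    fix p assume p: "p \<in> free_on X"
    show "E (eval_free v p + y) = E (eval_free v p) + E y"
    proof (rule free_dense_induct[OF dense, where P = "\<lambda>y. E (eval_free v p + y) = E (eval_free v p) + E y"])
      show "closed {y. E (eval_free v p + y) = E (eval_free v p) + E y}"
        by (intro closed_Collect_eq continuous_intros cont cont')
      fix q assume "q \<in> free_on X"
      then show "E (eval_free v p + eval_free v q) = E (eval_free v p) + E (eval_free v q)"
        using E[OF free_on_add[OF p]] by (simp add: E p add flip: eval_free_add)
    qed
  qed
  moreover have "E (c *\<^sub>C x) = c *\<^sub>C E x" for c x
  proof (rule free_dense_induct[OF dense, where P = "\<lambda>x. E (c *\<^sub>C x) = c *\<^sub>C E x"])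
    show "closed {x. E (c *\<^sub>C x) = c *\<^sub>C E x}"
      by (intro closed_Collect_eq continuous_scaleC cont cont' continuous_on_id)
    fix p assume p: "p \<in> free_on X"
    show "E (c *\<^sub>C eval_free v p) = c *\<^sub>C E (eval_free v p)"
      using E[OF free_on_fscale[OF p]] by (simp add: E p scale flip: eval_free_fscale)
  qed
  ultimately show thesis using that[of E] E by (simp add: clinear_map_def)
qed

section \<open>The conditional expectation\<close>

text \<open>
  The universal algebras of \<open>S\<close> and of the kernel, with generating isometries \<open>v\<close> and \<open>w\<close>.
\<close>

locale lcm_algebra_pair = scaled_LCM_semigroup S N for S :: "('s, 'm) monoid_scheme" (structure) and N +
  fixes v :: "'s \<Rightarrow> 'a::cstar_algebra" and w :: "'s \<Rightarrow> 'b::cstar_algebra"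
  assumes v: "lcm_cstar S v" and w: "lcm_cstar (scale_kernel S N) w"

sublocale lcm_algebra_pair \<subseteq> kernel_isometries S N w
  by unfold_locales (use w in \<open>simp add: lcm_cstar_def universal_cstar_def\<close>)

context lcm_algebra_pair
begin

lemma v_rel: "\<forall>r\<in>lcm_relators S. eval_free v r = 0"
  using v by (simp add: lcm_cstar_def universal_cstar_def)

lemma v_dense: "closure (eval_free v ` free_on (carrier S)) = UNIV"
  using v by (simp add: lcm_cstar_def universal_cstar_def)

lemma w_dense: "closure (eval_free w ` free_on K) = UNIV"
  using w by (simp add: lcm_cstar_def universal_cstar_def)

lemma v_one: "v \<one> = 1"
  using v_rel unfolding lcm_relators_iff by simp

lemma v_mult: "s \<in> carrier S \<Longrightarrow> t \<in> carrier S \<Longrightarrow> v s * v t = v (s \<otimes> t)"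
  using v_rel unfolding lcm_relators_iff by simp

lemma v_isometry: "s \<in> carrier S \<Longrightarrow> star (v s) * v s = 1"
  using v_rel unfolding lcm_relators_iff by simp

lemma v_ranges:
  "s \<in> carrier S \<Longrightarrow> t \<in> carrier S \<Longrightarrow> r \<in> carrier S \<Longrightarrow> pri s \<inter> pri t = pri r \<Longrightarrow>
    v s * star (v s) * v t * star (v t) = v r * star (v r)"
  using v_rel unfolding lcm_relators_iff by blast

lemma v_ranges_disjoint:
  "s \<in> carrier S \<Longrightarrow> t \<in> carrier S \<Longrightarrow> pri s \<inter> pri t = {} \<Longrightarrow>
    v s * star (v s) * v t * star (v t) = 0"
  using v_rel unfolding lcm_relators_iff by blast

lemma opnorm_le: "p \<in> free_on (carrier S) \<Longrightarrow> opnorm p \<le> norm (eval_free v p)"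
  using v cstar_seminorm_opnorm opnorm_relators unfolding lcm_cstar_def universal_cstar_def by blast

text \<open>
  The cyclic unit vector of the induced module.
\<close>

definition vac :: "'s \<Rightarrow>\<^sub>0 'b" where
  "vac = delta \<one> 1"

lemma mnorm_vac: "mnorm vac = 1"
  by (simp add: mnorm_def vac_def kform_single G_diag)

lemma mnorm_op_vac: "p \<in> free_on (carrier S) \<Longrightarrow> mnorm (op p vac) \<le> norm (eval_free v p)"
  using opnorm_upper[of p vac] opnorm_le[of p] by (simp add: mnorm_vac)

text \<open>
  The vector functional at \<open>vac\<close>, with values in the algebra of the kernel. It is the conditional
  expectation on the level of the free *-algebra.
\<close>

definition \<Phi> :: "'s free_star_algebra \<Rightarrow> 'b" where
  "\<Phi> p = kform vac (op p vac)"

lemma norm_\<Phi>: "p \<in> free_on (carrier S) \<Longrightarrow> norm (\<Phi> p) \<le> norm (eval_free v p)"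
  using Cauchy_Schwarz[of vac "op p vac"] mnorm_op_vac[of p] by (simp add: \<Phi>_def mnorm_vac)

lemma ex_E: "\<exists>E. clinear_map E \<and> (\<forall>x. norm (E x) \<le> norm x) \<and>
    (\<forall>p\<in>free_on (carrier S). E (eval_free v p) = \<Phi> p)"
proof -
  obtain E where "clinear_map E" "\<And>x. norm (E x) \<le> norm x"
    "\<And>p. p \<in> free_on (carrier S) \<Longrightarrow> E (eval_free v p) = \<Phi> p"
    by (rule free_bounded_extension[OF v_dense, of \<Phi>])
      (simp_all add: \<Phi>_def op_add form_add_right op_fscale form_act_right scaleC_mult_right norm_\<Phi>[unfolded \<Phi>_def])
  then show ?thesis by blast
qed

text \<open>
  The conditional expectation is the contractive extension of \<open>\<Phi>\<close> to the universal C*-algebra.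
\<close>

definition E :: "'a \<Rightarrow> 'b" where
  "E = (SOME E. clinear_map E \<and> (\<forall>x. norm (E x) \<le> norm x) \<and>
    (\<forall>p\<in>free_on (carrier S). E (eval_free v p) = \<Phi> p))"

lemma E_clinear: "clinear_map E" and norm_E: "norm (E x) \<le> norm x"
  and E_eval: "p \<in> free_on (carrier S) \<Longrightarrow> E (eval_free v p) = \<Phi> p"
  using someI_ex[OF ex_E] unfolding E_def[symmetric] by blast+

lemma E_add: "E (x + y) = E x + E y" and E_scaleC: "E (c *\<^sub>C x) = c *\<^sub>C E x"
  using E_clinear by (auto simp: clinear_map_def)

lemma E_continuous: "continuous_on A E"
  by (rule contractive_continuous[OF E_add norm_E])

lemma E_continuous': "continuous_on A f \<Longrightarrow> continuous_on A (\<lambda>x. E (f x))"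
  by (rule continuous_on_compose2[OF E_continuous[of UNIV]]) auto

lemma star_continuous': "continuous_on A f \<Longrightarrow> continuous_on A (\<lambda>x. star (f x :: 'c::cstar_algebra))"
  by (rule continuous_on_compose2[OF continuous_star[of UNIV]]) auto

lemma E_pos: "pos_elem (E (star y * y))"
proof (rule free_dense_induct[OF v_dense, where P = "\<lambda>y. pos_elem (E (star y * y))"])
  have "closed ((\<lambda>y. E (star y * y)) -` {h. pos_elem h})"
    by (intro closed_vimage closed_pos_elem E_continuous' continuous_on_mult star_continuous' continuous_on_id)
  then show "closed {y. pos_elem (E (star y * y))}" by (simp add: vimage_def)
  fix p assume p: "p \<in> free_on (carrier S)"
  have "E (star (eval_free v p) * eval_free v p) = \<Phi> (fstar p * p)"
    using E_eval[OF free_on_mult[OF free_on_fstar[OF p] p]] by (simp add: eval_free_mult eval_free_fstar)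
  also have "\<dots> = kform (op p vac) (op p vac)"
    by (simp add: \<Phi>_def op_mult op_adjoint[OF p, symmetric])
  finally show "pos_elem (E (star (eval_free v p) * eval_free v p))" by (simp add: form_pos)
qed

lemma E_star: "E (star y) = star (E y)"
proof (rule free_dense_induct[OF v_dense, where P = "\<lambda>y. E (star y) = star (E y)"])
  show "closed {y. E (star y) = star (E y)}"
    by (intro closed_Collect_eq E_continuous' star_continuous' continuous_on_id)
  fix p assume p: "p \<in> free_on (carrier S)"
  have "E (star (eval_free v p)) = \<Phi> (fstar p)"
    using E_eval[OF free_on_fstar[OF p]] by (simp add: eval_free_fstar)
  also have "\<dots> = star (\<Phi> p)"
    by (simp add: \<Phi>_def op_adjoint[OF p, symmetric] form_star)
  finally show "E (star (eval_free v p)) = star (E (eval_free v p))" by (simp add: E_eval p)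
qed

lemma kform_left_div_one:
  assumes t: "t \<in> carrier S"
  shows "kform (left_div t (delta \<one> b)) z = (if t \<in> K then kform (delta \<one> (star (w t) * b)) z else 0)"
proof -
  have "kform (left_div t (delta \<one> b)) z = kform (delta \<one> (if t \<in> K then star (w t) * b else 0)) z"
  proof (rule additive_ext[of "kform (left_div t (delta \<one> b))"])
    fix q c
    show "kform (left_div t (delta \<one> b)) (delta q c)
        = kform (delta \<one> (if t \<in> K then star (w t) * b else 0)) (delta q c)"
    proof (cases "q \<in> carrier S")
      case True
      have "G \<one> (t \<otimes> q) = star (G (t \<otimes> q) \<one>)" by (simp add: G_star)
      also have "\<dots> = (if t \<in> K then w t * G \<one> q else 0)"
        by (simp add: G_adjoint[OF meets_one[OF t] True] star_mult star_star G_star)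
      finally show ?thesis
        using True by (simp add: kform_adjoint' t left_mult_single kform_single star_mult star_star mult.assoc)
    next
      case False
      then show ?thesis by (simp add: kform_adjoint' t left_mult_single kform_single G_outside)
    qed
  qed (rule kform_add_right)+
  then show ?thesis by simp
qed

lemma kform_delta_one: "kform (delta \<one> b) z = star b * kform vac z"
  unfolding vac_def
  by (rule additive_ext[of "kform (delta \<one> b)" "\<lambda>z. star b * kform (delta \<one> 1) z"])
    (simp_all add: kform_add_right distrib_left kform_single mult.assoc)

lemma E_word:
  assumes s: "s \<in> carrier S" and t: "t \<in> carrier S"
  shows "E (v s * star (v t)) = (if s \<in> K \<and> t \<in> K then w s * star (w t) else 0)"
proof -
  have fr: "gen s * fstar (gen t) \<in> free_on (carrier S)"
    by (intro free_on_mult free_on_fstar free_on_gen s t)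
  have "E (v s * star (v t)) = \<Phi> (gen s * fstar (gen t))"
    using E_eval[OF fr] by (simp add: eval_free_mult eval_free_fstar)
  also have "\<dots> = kform (left_div s (delta \<one> 1)) (left_div t (delta \<one> 1))"
    by (simp add: \<Phi>_def op_mult kform_adjoint' s vac_def)
  also have "\<dots> = (if s \<in> K then kform (delta \<one> (star (w s))) (left_div t (delta \<one> 1)) else 0)"
    by (simp add: kform_left_div_one s)
  also have "kform (delta \<one> (star (w s))) (left_div t (delta \<one> 1))
      = star (kform (left_div t (delta \<one> 1)) (delta \<one> (star (w s))))"
    by (rule form_star[symmetric])
  also have "\<dots> = (if t \<in> K then w s * star (w t) else 0)"
    by (simp add: kform_left_div_one t kform_single G_diag star_mult star_star)
  finally show ?thesis by simp
qed

lemma kform_vac_kernel: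
  assumes k: "k \<in> K"
  shows "kform vac (left_mult k z) = w k * kform vac z"
    "kform vac (left_div k z) = star (w k) * kform vac z"
proof -
  have kc: "k \<in> carrier S" by (rule K_carrier[OF k])
  have "kform vac (left_mult k z) = kform (left_div k (delta \<one> 1)) z"
    by (simp add: kform_adjoint' kc vac_def)
  also have "\<dots> = w k * kform vac z"
    by (simp add: kform_left_div_one kc k kform_delta_one star_star)
  finally show "kform vac (left_mult k z) = w k * kform vac z" .
  have "kform vac (left_div k z) = kform (delta k 1) z"
    by (simp add: kform_adjoint[symmetric] kc vac_def left_mult_single)
  also have "\<dots> = star (w k) * kform vac z"
    unfolding vac_def
    by (rule additive_ext[of "kform (delta k 1)" "\<lambda>z. star (w k) * kform (delta \<one> 1) z"])
      (use G_covariant[OF k one_closed] kc in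
        \<open>simp_all add: kform_add_right distrib_left kform_single mult.assoc\<close>)
  finally show "kform vac (left_div k z) = star (w k) * kform vac z" .
qed

text \<open>
  The cyclic vector intertwines the two representations of the free *-algebra over the kernel; this
  is the module property of the expectation.
\<close>

lemma kform_vac_op:
  assumes q: "q \<in> free_on K" shows "kform vac (op q z) = eval_free w q * kform vac z"
proof -
  have list: "kform vac (op_list l z) = prod_list (map (eval_letter w) l) * kform vac z"
    if "\<forall>a\<in>set l. set_letter a \<subseteq> K" for l z
    using that
  proof (induction l)
    case (Cons a l)
    then show ?case by (cases a) (simp_all add: kform_vac_kernel mult.assoc)
  qed simp
  have word: "kform vac (op_word u z) = eval_word w u * kform vac z" if "set_star_word u \<subseteq> K" for u
  proof (cases u)
    case (Word l)
    then show ?thesis using that list[of l z] by auto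
  qed
  have "kform vac (op q z)
      = (\<Sum>u\<in>Poly_Mapping.keys q. kform vac (op_word u z) * (Poly_Mapping.lookup q u *\<^sub>C 1))"
    by (simp add: op_def form_sum_right form_act_right)
  also have "\<dots> = (\<Sum>u\<in>Poly_Mapping.keys q. Poly_Mapping.lookup q u *\<^sub>C eval_word w u * kform vac z)"
    using q by (intro sum.cong refl) (simp add: word free_on_def scaleC_mult_left scaleC_mult_right)
  finally show ?thesis by (simp add: eval_free_def sum_distrib_right)
qed

lemma free_on_K: "q \<in> free_on K \<Longrightarrow> q \<in> free_on (carrier S)"
  unfolding free_on_def using K_carrier by blast

lemma E_mult_eval:
  assumes q: "q \<in> free_on K" shows "E (eval_free v q * x) = eval_free w q * E x"
proof (rule free_dense_induct[OF v_dense, where P = "\<lambda>x. E (eval_free v q * x) = eval_free w q * E x"])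
  show "closed {x. E (eval_free v q * x) = eval_free w q * E x}"
    by (intro closed_Collect_eq E_continuous' continuous_intros)
  fix p assume p: "p \<in> free_on (carrier S)"
  have "E (eval_free v q * eval_free v p) = \<Phi> (q * p)"
    using E_eval[OF free_on_mult[OF free_on_K[OF q] p]] by (simp add: eval_free_mult)
  then show "E (eval_free v q * eval_free v p) = eval_free w q * E (eval_free v p)"
    by (simp add: \<Phi>_def op_mult kform_vac_op[OF q] E_eval[OF p])
qed

lemma v_kernel_rel: "\<forall>r\<in>lcm_relators (scale_kernel S N). eval_free v r = 0"
  unfolding lcm_relators_iff
proof (intro conjI ballI impI; simp?)
  show "v \<one> = 1" by (rule v_one)
  fix s t assume s: "s \<in> K" and t: "t \<in> K"
  show "v s * v t = v (s \<otimes> t)" using s t by (simp add: v_mult K_carrier)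
  {
    fix r assume "r \<in> K" "principal_right_ideal (scale_kernel S N) s \<inter> principal_right_ideal (scale_kernel S N) t
      = principal_right_ideal (scale_kernel S N) r"
    then show "v s * star (v s) * v t * star (v t) = v r * star (v r)"
      using pri_kernel_eq_lift s t by (intro v_ranges) (auto simp: K_carrier)
  }
  assume "principal_right_ideal (scale_kernel S N) s \<inter> principal_right_ideal (scale_kernel S N) t = {}"
  then show "v s * star (v s) * v t * star (v t) = 0" using pri_kernel_Int[OF s t] by simp
next
  fix s assume "s \<in> K"
  then show "star (v s) * v s = 1" by (simp add: v_isometry K_carrier)
qed

lemma ex_iota: "\<exists>f. star_hom f \<and> (\<forall>s\<in>K. f (w s) = v s)"
  using universal_property[OF w[unfolded lcm_cstar_def] v_kernel_rel] by auto

text \<open>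
  The canonical map from the C*-algebra of the kernel. It is injective because \<open>E\<close> is a left inverse.
\<close>

definition iota :: "'b \<Rightarrow> 'a" where
  "iota = (SOME f. star_hom f \<and> (\<forall>s\<in>K. f (w s) = v s))"

lemma iota_hom: "star_hom iota" and iota_w: "s \<in> K \<Longrightarrow> iota (w s) = v s"
  using someI_ex[OF ex_iota] unfolding iota_def[symmetric] by blast+

lemma iota_simps:
  "iota (x + y) = iota x + iota y" "iota (c *\<^sub>C x) = c *\<^sub>C iota x" "iota (x * y) = iota x * iota y"
  "iota (star x) = star (iota x)" "iota 1 = 1"
  using iota_hom by (auto simp: star_hom_def clinear_map_def)

lemma iota_continuous': "continuous_on A f \<Longrightarrow> continuous_on A (\<lambda>x. iota (f x))"
  by (rule continuous_on_compose2[OF contractive_continuous[of iota UNIV]])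
    (auto simp: iota_simps star_hom_norm[OF iota_hom])

lemma iota_eval: "q \<in> free_on K \<Longrightarrow> iota (eval_free w q) = eval_free v q"
  using star_hom_eval[OF iota_hom, of w q] eval_free_cong[of q K "\<lambda>s. iota (w s)" v] iota_w by simp

lemma E_module_left: "E (iota b * x) = b * E x"
proof (rule free_dense_induct[OF w_dense, where P = "\<lambda>b. E (iota b * x) = b * E x"])
  show "closed {b. E (iota b * x) = b * E x}"
    by (intro closed_Collect_eq E_continuous' iota_continuous' continuous_intros)
qed (simp add: iota_eval E_mult_eval)

lemma E_module_right: "E (x * iota c) = E x * c"
  using arg_cong[OF E_module_left[of "star c" "star x"], of star]
  by (simp add: star_mult star_star iota_simps flip: E_star)

lemma E_iota: "E (iota b) = b"
proof -
  have "E 1 = 1" using E_word[of \<one> \<one>] by (simp add: v_one w_one)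
  then show ?thesis using E_module_left[of b 1] by simp
qed

lemma inj_iota: "inj iota"
  by (rule inj_on_inverseI[where g = E]) (rule E_iota)

theorem conditional_expectation_E: "conditional_expectation iota E"
  unfolding conditional_expectation_def
  using E_clinear E_pos norm_E E_iota
  by (auto simp: E_module_left E_module_right mult.assoc simp flip: pos_elem_iff_star_mult)

lemma iota_E_word:
  assumes "s \<in> carrier S" "t \<in> carrier S"
  shows "iota (E (v s * star (v t))) = (if s \<in> K \<and> t \<in> K then v s * star (v t) else 0)"
proof -
  have "iota 0 = 0" using iota_simps(1)[of 0 0] by simp
  then show ?thesis by (simp add: E_word assms iota_simps iota_w)
qed

end

section \<open>Bounded functions on the upper half-plane\<close>

text \<open>
  By Schwarz reflection, a function that is holomorphic in the upper half-plane and continuous up to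
  the real line vanishes as soon as it vanishes on the real line.
\<close>

lemma upper_half_plane_zero:
  assumes hol: "F holomorphic_on {z. 0 < Im z}" and cont: "continuous_on {z. 0 \<le> Im z} F"
    and real: "\<And>t. F (of_real t) = 0" and z: "0 \<le> Im z"
  shows "F z = 0"
proof -
  have real': "F z = 0" if "z \<in> \<real>" for z
    using that real by (auto elim!: Reals_cases)
  define R where "R z = (if 0 \<le> Im z then F z else cnj (F (cnj z)))" for z
  have R: "R holomorphic_on UNIV"
    unfolding R_def
    by (rule Schwarz_reflection) (use hol cont real' in auto)
  have lim: "0 islimpt (\<real> :: complex set)"
    unfolding islimpt_approachable
  proof (intro allI impI)
    fix e :: real assume "0 < e"
    then show "\<exists>x\<in>\<real>. x \<noteq> (0::complex) \<and> dist x 0 < e"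
      by (intro bexI[of _ "of_real (e / 2)"]) auto
  qed
  have "R z = 0"
    by (rule analytic_continuation[OF R, of \<real> 0]) (use lim real' in \<open>auto simp: R_def complex_is_Real_iff\<close>)
  then show ?thesis using z by (simp add: R_def)
qed

text \<open>
  If functions \<open>Fs n\<close> satisfy the bound for an approximating sequence \<open>b n\<close> and approximate \<open>F\<close> on the real
  line only, then \<open>F\<close> satisfies the limiting bound on the upper half-plane: the \<open>Fs n\<close> converge uniformly
  there, and the limit agrees with \<open>F\<close> on the real line.
\<close>

lemma upper_half_plane_bound:
  fixes b :: "nat \<Rightarrow> 'a::real_normed_vector"
  assumes F: "F holomorphic_on UNIV" and Fs: "\<And>n. Fs n holomorphic_on UNIV"
    and b: "b \<longlonglongrightarrow> l" and C: "0 \<le> C"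
    and diff: "\<And>n m z. 0 \<le> Im z \<Longrightarrow> cmod (Fs n z - Fs m z) \<le> C * norm (b n - b m)"
    and bound: "\<And>n z. 0 \<le> Im z \<Longrightarrow> cmod (Fs n z) \<le> C * norm (b n)"
    and real: "\<And>t. (\<lambda>n. Fs n (of_real t)) \<longlonglongrightarrow> F (of_real t)"
    and z: "0 \<le> Im z"
  shows "cmod (F z) \<le> C * norm l"
proof -
  have "\<exists>h. (\<lambda>n. Fs n z) \<longlonglongrightarrow> h" if z: "0 \<le> Im z" for z
  proof -
    have "Cauchy (\<lambda>n. Fs n z)"
    proof (rule CauchyI)
      fix e :: real assume e: "0 < e"
      then obtain M where M: "\<And>m n. M \<le> m \<Longrightarrow> M \<le> n \<Longrightarrow> norm (b m - b n) < e / (C + 1)"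
        using CauchyD[OF LIMSEQ_imp_Cauchy[OF b], of "e / (C + 1)"] C by auto
      have "cmod (Fs m z - Fs n z) < e" if "M \<le> m" "M \<le> n" for m n
      proof -
        have "C * norm (b m - b n) \<le> C * (e / (C + 1))"
          using M[OF that] C by (intro mult_left_mono) auto
        also have "\<dots> < e" using C e by (simp add: field_simps)
        finally show ?thesis using diff[OF z, of m n] by simp
      qed
      then show "\<exists>M. \<forall>m\<ge>M. \<forall>n\<ge>M. norm (Fs m z - Fs n z) < e" by blast
    qed
    then show ?thesis by (simp add: Cauchy_convergent_iff convergent_def)
  qed
  then have "\<forall>z. \<exists>h. 0 \<le> Im z \<longrightarrow> (\<lambda>n. Fs n z) \<longlonglongrightarrow> h" by blast
  from choice[OF this] obtain H where H: "\<And>z. 0 \<le> Im z \<Longrightarrow> (\<lambda>n. Fs n z) \<longlonglongrightarrow> H z" by blast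
  have FH: "cmod (Fs n z - H z) \<le> C * norm (b n - l)" if z: "0 \<le> Im z" for n z
  proof (rule tendsto_le[OF sequentially_bot])
    show "(\<lambda>m. C * norm (b n - b m)) \<longlonglongrightarrow> C * norm (b n - l)" by (intro tendsto_intros b)
    show "(\<lambda>m. cmod (Fs n z - Fs m z)) \<longlonglongrightarrow> cmod (Fs n z - H z)" by (intro tendsto_intros H z)
  qed (simp add: diff[OF z])
  have to0: "(\<lambda>n. C * norm (b n - l)) \<longlonglongrightarrow> 0"
    using tendsto_mult[OF tendsto_const[of C] tendsto_norm[OF tendsto_diff[OF b tendsto_const[of l]]]] by simp
  have unif: "uniform_limit {z. 0 \<le> Im z} Fs H sequentially"
  proof (rule uniform_limitI)
    fix e :: real assume "0 < e"
    then have "\<forall>\<^sub>F n in sequentially. C * norm (b n - l) < e" by (rule order_tendstoD(2)[OF to0])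
    then show "\<forall>\<^sub>F n in sequentially. \<forall>z\<in>{z. 0 \<le> Im z}. dist (Fs n z) (H z) < e"
      by eventually_elim (use FH in \<open>auto simp: dist_norm intro: order_le_less_trans\<close>)
  qed
  have contH: "continuous_on {z. 0 \<le> Im z} H"
  proof (rule uniform_limit_theorem[OF _ unif])
    show "\<forall>\<^sub>F n in sequentially. continuous_on {z. 0 \<le> Im z} (Fs n)"
      by (intro always_eventually allI holomorphic_on_imp_continuous_on
          holomorphic_on_subset[OF Fs] subset_UNIV)
  qed simp
  have holH: "H holomorphic_on {z. 0 < Im z}"
  proof (rule holomorphic_uniform_sequence[where f = Fs])
    show op: "open {z. 0 < Im z}" by (rule open_halfspace_Im_gt)
    show "Fs n holomorphic_on {z. 0 < Im z}" for n by (rule holomorphic_on_subset[OF Fs]) simp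
    fix x assume "x \<in> {z. 0 < Im z}"
    then obtain d where d: "0 < d" "cball x d \<subseteq> {z. 0 < Im z}"
      using op open_contains_cball by blast
    moreover have "{z. 0 < Im z} \<subseteq> {z. 0 \<le> Im z}" by auto
    ultimately show "\<exists>d>0. cball x d \<subseteq> {z. 0 < Im z} \<and> uniform_limit (cball x d) Fs H sequentially"
      using uniform_limit_on_subset[OF unif] by blast
  qed
  have "F z - H z = 0"
  proof (rule upper_half_plane_zero[of "\<lambda>z. F z - H z"])
    show "(\<lambda>z. F z - H z) holomorphic_on {z. 0 < Im z}"
      by (intro holomorphic_on_diff holH holomorphic_on_subset[OF F]) simp
    show "continuous_on {z. 0 \<le> Im z} (\<lambda>z. F z - H z)"
      by (intro continuous_on_diff contH holomorphic_on_imp_continuous_on holomorphic_on_subset[OF F]) simp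
    show "F (of_real t) - H (of_real t) = 0" for t
      using LIMSEQ_unique[OF real[of t] H[of "of_real t"]] by simp
  qed (rule z)
  then have "F z = H z" by simp
  moreover have "cmod (H z) \<le> C * norm l"
  proof (rule tendsto_le[OF sequentially_bot])
    show "(\<lambda>n. C * norm (b n)) \<longlonglongrightarrow> C * norm l" by (intro tendsto_intros b)
    show "(\<lambda>n. cmod (Fs n z)) \<longlonglongrightarrow> cmod (H z)" by (intro tendsto_intros H z)
  qed (simp add: bound[OF z])
  ultimately show ?thesis by simp
qed

section \<open>States\<close>

lemma scaleC_diff_left: "(c - d) *\<^sub>C x = c *\<^sub>C x - d *\<^sub>C (x :: 'a::cstar_algebra)"
  using scaleC_add_left[of "c - d" d x] by simp

lemma scaleC_diff_right: "c *\<^sub>C (x - y) = c *\<^sub>C x - c *\<^sub>C (y :: 'a::cstar_algebra)"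
  using scaleC_add_right[of c "x - y" y] by (simp add: algebra_simps)

context
  fixes \<phi> :: "'a::cstar_algebra \<Rightarrow> complex"
  assumes st: "\<phi> \<in> states"
begin

lemma state_add: "\<phi> (x + y) = \<phi> x + \<phi> y" and state_scaleC: "\<phi> (c *\<^sub>C x) = c * \<phi> x"
  and state_pos: "\<phi> (star x * x) \<in> \<real>\<^sub>\<ge>\<^sub>0" and state_one: "\<phi> 1 = 1"
  using st by (auto simp: states_def clinear_map_def scaleC_complex_def)

lemma state_diff: "\<phi> (x - y) = \<phi> x - \<phi> y"
  using state_add[of "x - y" y] by (simp add: algebra_simps)

lemma state_zero: "\<phi> 0 = 0"
  using state_add[of 0 0] by simp

lemma state_sum: "\<phi> (sum f A) = (\<Sum>i\<in>A. \<phi> (f i))"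
  by (induction A rule: infinite_finite_induct) (simp_all add: state_zero state_add)

lemma state_star: "\<phi> (star x) = cnj (\<phi> x)"
proof -
  have im: "Im (\<phi> (star y * y)) = 0" for y
    using state_pos[of y] by (auto simp: nonneg_Reals_def)
  have "star (x + 1) * (x + 1) = star x * x + star x + x + 1"
    by (simp add: star_add algebra_simps)
  then have 1: "Im (\<phi> (star x)) + Im (\<phi> x) = 0"
    using im[of "x + 1"] im[of x] by (simp add: state_add state_one)
  have "star (\<i> *\<^sub>C x + 1) * (\<i> *\<^sub>C x + 1) = star x * x + (- \<i>) *\<^sub>C star x + \<i> *\<^sub>C x + 1"
    by (simp add: star_add star_scaleC algebra_simps scaleC_mult_left scaleC_mult_right scaleC_scaleC
        scaleC_add_right)
  then have 2: "- Re (\<phi> (star x)) + Re (\<phi> x) = 0"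
    using im[of "\<i> *\<^sub>C x + 1"] im[of x] by (simp add: state_add state_one state_scaleC)
  show ?thesis using 1 2 by (simp add: complex_eq_iff)
qed

lemma state_norm: "cmod (\<phi> x) \<le> norm x"
proof -
  \<comment> \<open>Positivity at \<open>x - \<phi> x\<close> yields \<open>|\<phi> x|^2 \<le> \<phi> (star x * x)\<close>.\<close>
  define l where "l = \<phi> x"
  have re: "0 \<le> Re (\<phi> (star y * y))" for y
    using state_pos[of y] by (auto simp: nonneg_Reals_def)
  have eq: "star (x - l *\<^sub>C 1) * (x - l *\<^sub>C 1) = star x * x - l *\<^sub>C star x - cnj l *\<^sub>C x + (cnj l * l) *\<^sub>C 1"
    by (simp add: star_diff star_scaleC algebra_simps scaleC_mult_left scaleC_mult_right scaleC_scaleC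
        scaleC_diff_right)
  have "\<phi> (star (x - l *\<^sub>C 1) * (x - l *\<^sub>C 1)) = \<phi> (star x * x) - l * cnj l"
    unfolding eq by (simp add: state_add state_diff state_scaleC state_star state_one l_def algebra_simps)
  then have "Re (l * cnj l) \<le> Re (\<phi> (star x * x))" using re[of "x - l *\<^sub>C 1"] by simp
  then have 1: "(cmod l)\<^sup>2 \<le> Re (\<phi> (star x * x))" by (simp add: complex_norm_square[symmetric])
  have "pos_elem (of_real ((norm x)\<^sup>2) - star x * x)"
    by (rule pos_elem_of_real_norm_diff) (simp_all add: star_mult star_star cstar_identity)
  then obtain y where y: "of_real ((norm x)\<^sup>2) - star x * x = star y * y"
    by (auto simp: pos_elem_iff_star_mult)
  have "of_real ((norm x)\<^sup>2) = complex_of_real ((norm x)\<^sup>2) *\<^sub>C (1::'a)"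
    unfolding scaleC_of_real by (simp add: of_real_def)
  then have "\<phi> (of_real ((norm x)\<^sup>2)) = complex_of_real ((norm x)\<^sup>2)"
    by (simp only: state_scaleC state_one mult_1_right)
  then have "Re (\<phi> (star x * x)) \<le> (norm x)\<^sup>2"
    using re[of y] by (simp add: state_diff flip: y)
  then have "(cmod l)\<^sup>2 \<le> (norm x)\<^sup>2" using 1 by (rule order_trans[rotated])
  then show ?thesis unfolding l_def by (rule power2_le_imp_le) simp
qed

lemma state_continuous: "continuous_on A \<phi>"
  by (rule contractive_continuous[OF state_add state_norm])

end

lemma tendsto_scaleC_left:
  fixes x :: "'a::cstar_algebra"
  assumes "(k \<longlongrightarrow> d) G" shows "((\<lambda>h. k h *\<^sub>C x) \<longlongrightarrow> d *\<^sub>C x) G"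
proof -
  have "((\<lambda>h. cmod (k h - d) * norm x) \<longlongrightarrow> 0) G"
    by (rule tendsto_mult_left_zero[OF tendsto_norm_zero[OF LIM_zero[OF assms]]])
  then have "((\<lambda>h. norm (k h *\<^sub>C x - d *\<^sub>C x)) \<longlongrightarrow> 0) G"
    by (simp add: norm_scaleC flip: scaleC_diff_left)
  then show ?thesis by (rule LIM_zero_cancel[OF tendsto_norm_zero_cancel])
qed

lemma entire_map_exp_scaleC: "entire_map (\<lambda>z. exp (c * z) *\<^sub>C (x :: 'a::cstar_algebra))"
  unfolding entire_map_def
proof
  fix z
  have "((\<lambda>z. exp (c * z)) has_field_derivative c * exp (c * z)) (at z)"
    by (auto intro!: derivative_eq_intros)
  then have "((\<lambda>h. (exp (c * (z + h)) - exp (c * z)) / h) \<longlongrightarrow> c * exp (c * z)) (at 0)"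
    by (simp add: DERIV_def)
  then have "((\<lambda>h. ((exp (c * (z + h)) - exp (c * z)) / h) *\<^sub>C x) \<longlongrightarrow> (c * exp (c * z)) *\<^sub>C x) (at 0)"
    by (rule tendsto_scaleC_left)
  moreover have "((exp (c * (z + h)) - exp (c * z)) / h) *\<^sub>C x
      = inverse h *\<^sub>C (exp (c * (z + h)) *\<^sub>C x - exp (c * z) *\<^sub>C x)" for h
    by (simp add: scaleC_scaleC divide_inverse mult.commute flip: scaleC_diff_left)
  ultimately show "\<exists>D. ((\<lambda>h. inverse h *\<^sub>C (exp (c * (z + h)) *\<^sub>C x - exp (c * z) *\<^sub>C x)) \<longlongrightarrow> D) (at 0)"
    by auto
qed

lemma entire_map_functional_holomorphic:
  fixes f :: "complex \<Rightarrow> 'a::cstar_algebra" and \<eta> :: "'a \<Rightarrow> complex"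
  assumes f: "entire_map f" and add: "\<And>x y. \<eta> (x + y) = \<eta> x + \<eta> y"
    and scale: "\<And>c x. \<eta> (c *\<^sub>C x) = c * \<eta> x" and cont: "continuous_on UNIV \<eta>"
  shows "(\<lambda>z. \<eta> (f z)) holomorphic_on UNIV"
proof -
  have diff: "\<eta> (x - y) = \<eta> x - \<eta> y" for x y
    using add[of "x - y" y] by (simp add: algebra_simps)
  have "\<exists>D. ((\<lambda>z. \<eta> (f z)) has_field_derivative D) (at z)" for z
  proof -
    obtain D where D: "((\<lambda>h. inverse h *\<^sub>C (f (z + h) - f z)) \<longlongrightarrow> D) (at 0)"
      using f unfolding entire_map_def by blast
    have "isCont \<eta> D" using cont by (simp add: continuous_on_eq_continuous_at)
    then have "((\<lambda>h. \<eta> (inverse h *\<^sub>C (f (z + h) - f z))) \<longlongrightarrow> \<eta> D) (at 0)"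
      by (rule isCont_tendsto_compose[OF _ D])
    then have "((\<lambda>h. (\<eta> (f (z + h)) - \<eta> (f z)) / h) \<longlongrightarrow> \<eta> D) (at 0)"
      by (simp add: scale diff divide_inverse mult.commute)
    then show ?thesis by (auto simp: DERIV_def)
  qed
  then show ?thesis
    unfolding holomorphic_on_def field_differentiable_def by simp
qed

section \<open>The dynamics\<close>

context lcm_algebra_pair
begin

text \<open>
  \<open>wt z s\<close> is \<open>N s\<close> to the power \<open>\<i> z\<close>, and \<open>twist z\<close> is the dynamics at the complex time \<open>z\<close> on the free
  *-algebra: every word is multiplied by its weight.
\<close>

definition wt :: "complex \<Rightarrow> 's \<Rightarrow> complex" where
  "wt z s = exp (\<i> * of_real (ln (N s)) * z)"

fun wt_letter :: "complex \<Rightarrow> 's letter \<Rightarrow> complex" where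
  "wt_letter z (Gen s) = wt z s"
| "wt_letter z (Adj s) = wt (- z) s"

fun wt_word :: "complex \<Rightarrow> 's star_word \<Rightarrow> complex" where
  "wt_word z (Word l) = prod_list (map (wt_letter z) l)"

definition twist :: "complex \<Rightarrow> 's free_star_algebra \<Rightarrow> 's free_star_algebra" where
  "twist z p = (\<Sum>u\<in>Poly_Mapping.keys p. Poly_Mapping.single u (wt_word z u * Poly_Mapping.lookup p u))"

lemma wt_mult: "s \<in> carrier S \<Longrightarrow> t \<in> carrier S \<Longrightarrow> wt z (s \<otimes> t) = wt z s * wt z t"
  using scale_ge_1[of s] scale_ge_1[of t]
  by (simp add: wt_def scale_mult ln_mult exp_add[symmetric] algebra_simps)

lemma wt_minus: "wt (- z) s = inverse (wt z s)"
  by (simp add: wt_def exp_minus)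

lemma wt_nonzero: "wt z s \<noteq> 0"
  by (simp add: wt_def)

lemma wt_one: "wt z \<one> = 1"
  by (simp add: wt_def scale_one)

lemma norm_wt: "cmod (wt z s) = exp (- (ln (N s) * Im z))"
  by (simp add: wt_def)

lemma twist_free: "p \<in> free_on X \<Longrightarrow> twist z p \<in> free_on X"
  unfolding twist_def by (intro free_on_sum free_on_single) (auto simp: free_on_def)

lemma twist_diff: "twist z (p - q) = twist z p - twist z q"
proof -
  have l: "Poly_Mapping.lookup (twist z p) u = wt_word z u * Poly_Mapping.lookup p u" for p u
    by (simp add: twist_def lookup_sum lookup_single when_def in_keys_iff)
  show ?thesis by (rule poly_mapping_eqI) (simp add: l lookup_minus algebra_simps)
qed

text \<open>
  The dynamics given by \<open>N\<close> on the algebra of \<open>S\<close>.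
\<close>

definition dyn :: "real \<Rightarrow> 'a \<Rightarrow> 'a" where
  "dyn = dynamics S N v"

lemma dyn_hom: "star_hom (dyn t)" and dyn_v: "s \<in> carrier S \<Longrightarrow> dyn t (v s) = wt (of_real t) s *\<^sub>C v s"
proof -
  have "right_LCM_semigroup S" by unfold_locales
  from theI'[OF dynamics_well_defined[OF this scale v, of t]]
  have *: "star_hom (dyn t)" "\<And>s. s \<in> carrier S \<Longrightarrow> dyn t (v s) = (of_real (N s) powr (\<i> * of_real t)) *\<^sub>C v s"
    unfolding dyn_def dynamics_def by auto
  show "star_hom (dyn t)" by (rule *)
  show "dyn t (v s) = wt (of_real t) s *\<^sub>C v s" if s: "s \<in> carrier S"
    using *(2)[OF s] scale_ge_1[OF s] by (simp add: wt_def powr_def Ln_of_real algebra_simps)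
qed

lemma dyn_eval:
  assumes p: "p \<in> free_on (carrier S)"
  shows "dyn t (eval_free v p) = eval_free v (twist (of_real t) p)"
proof -
  define c where "c = wt (of_real t)"
  have "dyn t (eval_free v p) = eval_free (\<lambda>s. dyn t (v s)) p"
    by (rule star_hom_eval[OF dyn_hom])
  also have "\<dots> = eval_free (\<lambda>s. c s *\<^sub>C v s) p"
    by (rule eval_free_cong[OF p]) (simp add: dyn_v c_def)
  also have "\<dots> = eval_free v (twist (of_real t) p)"
  proof -
    have adj: "cnj (c s) = wt (- of_real t) s" for s
      by (simp add: c_def wt_def exp_cnj)
    have "prod_list (map (eval_letter (\<lambda>s. c s *\<^sub>C v s)) l)
        = prod_list (map (wt_letter (of_real t)) l) *\<^sub>C prod_list (map (eval_letter v) l)" for l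
    proof (induction l)
      case (Cons a l)
      have "eval_letter (\<lambda>s. c s *\<^sub>C v s) a = wt_letter (of_real t) a *\<^sub>C eval_letter v a"
        by (cases a) (simp_all add: star_scaleC adj, simp add: c_def)
      then show ?case
        by (simp add: Cons scaleC_mult_left scaleC_mult_right scaleC_scaleC mult.commute)
    qed simp
    then have "eval_word (\<lambda>s. c s *\<^sub>C v s) u = wt_word (of_real t) u *\<^sub>C eval_word v u" for u
      by (cases u) simp
    then show ?thesis
      by (simp add: twist_def eval_free_sum) (simp add: eval_free_def scaleC_scaleC mult.commute)
  qed
  finally show ?thesis .
qed

subsection \<open>Contractions of the induced module\<close>

text \<open>
  Pointwise multiplication by a function on \<open>S\<close>.
\<close>

definition dil :: "('s \<Rightarrow> complex) \<Rightarrow> ('s \<Rightarrow>\<^sub>0 'b) \<Rightarrow> ('s \<Rightarrow>\<^sub>0 'b)" where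
  "dil d = pm_lift (\<lambda>s b. delta s (d s *\<^sub>C b))"

lemma dil_add: "dil d (x + y) = dil d x + dil d y"
  unfolding dil_def by (rule pm_lift_add) (simp add: scaleC_add_right single_add)

lemma dil_single: "dil d (delta s b) = delta s (d s *\<^sub>C b)"
  unfolding dil_def by (rule pm_lift_single) (simp add: scaleC_add_right single_add)

lemma dil_zero [simp]: "dil d 0 = 0"
  using dil_add[of d 0 0] by simp

lemma dil_sum: "dil d (sum f A) = (\<Sum>i\<in>A. dil d (f i))"
  by (induction A rule: infinite_finite_induct) (simp_all add: dil_add)

lemma dil_act: "dil d (kact x b) = kact (dil d x) b"
  by (rule additive_ext[of "\<lambda>x. dil d (kact x b)" "\<lambda>x. kact (dil d x) b"])
    (simp_all add: dil_add kact_add dil_single kact_single scaleC_mult_left)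

lemma G_nonzero_scale:
  assumes "G s t \<noteq> 0" shows "s \<in> carrier S" "t \<in> carrier S" "N s = N t"
proof -
  obtain x y where m: "meets s t x y" "x \<in> K" "y \<in> K" using G_none assms by blast
  show c: "s \<in> carrier S" "t \<in> carrier S" using m by (auto simp: meets_def)
  have "N s * N x = N t * N y"
    using m scale_mult unfolding meets_def by metis
  then show "N s = N t" using m by (simp add: K_def)
qed

text \<open>
  Functions of \<open>N\<close> that are bounded by \<open>1\<close> act as contractions, since \<open>G s t\<close> vanishes unless \<open>N s = N t\<close>.
  Multiplication by \<open>sqrt (1 - |d|^2)\<close> accounts for the difference of the inner products.
\<close>

lemma mnorm_dil:
  assumes d: "\<And>s t. s \<in> carrier S \<Longrightarrow> t \<in> carrier S \<Longrightarrow> N s = N t \<Longrightarrow> d s = d t"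
    and le: "\<And>s. s \<in> carrier S \<Longrightarrow> cmod (d s) \<le> 1"
  shows "mnorm (dil d x) \<le> mnorm x"
proof -
  define d' where "d' s = complex_of_real (sqrt (1 - (cmod (d s))\<^sup>2))" for s
  have "kform (dil d x) (dil d y) + kform (dil d' x) (dil d' y) = kform x y" for x y
  proof (rule biadditive_ext[of "\<lambda>x y. kform (dil d x) (dil d y) + kform (dil d' x) (dil d' y)" kform])
    fix s b t c
    show "kform (dil d (delta s b)) (dil d (delta t c)) + kform (dil d' (delta s b)) (dil d' (delta t c))
        = kform (delta s b) (delta t c)"
    proof (cases "G s t = 0")
      case False
      note G_nonzero_scale[OF False]
      then have eq: "d s = d t" "d' s = d' t" and "cmod (d t) \<le> 1"
        using d[of s t] le by (auto simp: d'_def)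
      then have le1: "(cmod (d t))\<^sup>2 \<le> 1" by (simp add: power_le_one)
      have "cnj (d t) * d t = of_real ((cmod (d t))\<^sup>2)"
        unfolding complex_norm_square by (rule mult.commute)
      moreover have "cnj (d' t) * d' t = of_real (1 - (cmod (d t))\<^sup>2)"
        using le1 by (simp add: d'_def flip: of_real_mult)
      ultimately have "cnj (d t) * d t + cnj (d' t) * d' t = 1"
        by (simp only: of_real_add[symmetric]) simp
      then show ?thesis
        by (simp add: dil_single kform_single star_scaleC scaleC_mult_left scaleC_mult_right scaleC_scaleC eq
            mult.commute flip: scaleC_add_left)
    qed (simp add: dil_single kform_single)
  qed (simp_all add: dil_add kform_add_left kform_add_right)
  from this[of x x, symmetric]
  have "pos_elem (kform x x - kform (dil d x) (dil d x))" by (simp add: form_pos)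
  then have "norm (kform (dil d x) (dil d x)) \<le> norm (kform x x)"
    by (rule norm_mono_pos_elem[OF form_pos])
  then show ?thesis by (simp add: mnorm_def)
qed

lemma dil_left_mult:
  assumes r: "r \<in> carrier S"
  shows "dil (wt z) (left_mult r x) = kact (left_mult r (dil (wt z) x)) (wt z r *\<^sub>C 1)"
  by (rule additive_ext[of "\<lambda>x. dil (wt z) (left_mult r x)" "\<lambda>x. kact (left_mult r (dil (wt z) x)) (wt z r *\<^sub>C 1)"])
    (simp_all add: dil_add left_mult_add kact_add left_mult_single dil_single kact_single wt_mult r
      scaleC_mult_left scaleC_mult_right scaleC_scaleC)

lemma dil_left_div:
  assumes r: "r \<in> carrier S"
  shows "dil (wt z) (left_div r x) = kact (left_div r (dil (wt z) x)) (wt (- z) r *\<^sub>C 1)"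
proof (rule additive_ext[of "\<lambda>x. dil (wt z) (left_div r x)" "\<lambda>x. kact (left_div r (dil (wt z) x)) (wt (- z) r *\<^sub>C 1)"])
  fix t b
  show "dil (wt z) (left_div r (delta t b)) = kact (left_div r (dil (wt z) (delta t b))) (wt (- z) r *\<^sub>C 1)"
  proof (cases "hit r t")
    case True
    define x y where "x = fst (mate r t)" and "y = snd (mate r t)"
    have m: "y \<in> K" "meets r t x y" using mate[OF True] by (auto simp: x_def y_def)
    have c: "t \<in> carrier S" "x \<in> carrier S" "y \<in> carrier S" "r \<otimes> x = t \<otimes> y"
      using m by (simp_all add: meets_def)
    have "wt z y = 1" using m(1) by (simp add: wt_def K_def)
    then have "wt z r * wt z x = wt z t" using c r wt_mult by (metis mult_1_right)
    then have "wt z x = wt z t * wt (- z) r"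
      using wt_nonzero[of z r] by (simp add: wt_minus field_simps)
    then show ?thesis
      using True by (simp add: left_div_single dil_single kact_single scaleC_mult_left scaleC_mult_right
          scaleC_scaleC mult.commute flip: x_def y_def)
  qed (simp add: left_div_single dil_single)
qed (simp_all add: dil_add left_div_add kact_add)

lemma op_twist: 
  assumes p: "p \<in> free_on (carrier S)"
  shows "op (twist z p) vac = dil (wt z) (op p vac)"
proof -
  have list: "dil (wt z) (op_list l vac) = kact (op_list l vac) (prod_list (map (wt_letter z) l) *\<^sub>C 1)"
    if "\<forall>a\<in>set l. set_letter a \<subseteq> carrier S" for l
    using that
  proof (induction l)
    case Nil
    show ?case by (simp add: vac_def dil_single wt_one kact_single)
  next
    case (Cons a l)
    have "dil (wt z) (op_letter a x) = kact (op_letter a (dil (wt z) x)) (wt_letter z a *\<^sub>C 1)" for x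
      using Cons.prems by (cases a) (simp_all add: dil_left_mult dil_left_div)
    then show ?case
      using Cons by (simp add: op_letter_act act_act scaleC_mult_left scaleC_scaleC mult.commute)
  qed
  have word: "dil (wt z) (op_word u vac) = kact (op_word u vac) (wt_word z u *\<^sub>C 1)"
    if "set_star_word u \<subseteq> carrier S" for u
  proof (cases u)
    case (Word l)
    then show ?thesis using that list[of l] by auto
  qed
  have "op (twist z p) vac = (\<Sum>u\<in>Poly_Mapping.keys p.
      kact (op_word u vac) ((wt_word z u * Poly_Mapping.lookup p u) *\<^sub>C 1))"
    by (simp add: twist_def op_sum op_single)
  also have "\<dots> = (\<Sum>u\<in>Poly_Mapping.keys p. dil (wt z) (kact (op_word u vac) (Poly_Mapping.lookup p u *\<^sub>C 1)))"
    using p by (intro sum.cong refl)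
      (simp add: dil_act word act_act scaleC_mult_left scaleC_scaleC free_on_def)
  finally show ?thesis by (simp add: op_def dil_sum)
qed

text \<open>
  On the module, the dynamics at time \<open>z\<close> applied to the cyclic vector is multiplication by \<open>wt z\<close>, a
  contraction for \<open>0 \<le> Im z\<close>. This bound is uniform in \<open>z\<close>.
\<close>

lemma norm_E_twist:
  assumes p: "p \<in> free_on (carrier S)" and z: "0 \<le> Im z"
  shows "norm (E (a * eval_free v (twist z p))) \<le> norm a * norm (eval_free v p)"
proof (rule free_dense_induct[OF v_dense,
    where P = "\<lambda>a. norm (E (a * eval_free v (twist z p))) \<le> norm a * norm (eval_free v p)"])
  show "closed {a. norm (E (a * eval_free v (twist z p))) \<le> norm a * norm (eval_free v p)}"
    by (intro closed_Collect_le continuous_intros E_continuous')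
  fix q assume q: "q \<in> free_on (carrier S)"
  have "E (eval_free v q * eval_free v (twist z p)) = \<Phi> (q * twist z p)"
    using E_eval[OF free_on_mult[OF q twist_free[OF p]]] by (simp add: eval_free_mult)
  also have "\<dots> = kform (op (fstar q) vac) (dil (wt z) (op p vac))"
  proof -
    have "kform vac (op q y) = kform (op (fstar q) vac) y" for y
      by (metis form_star op_adjoint[OF q])
    then show ?thesis by (simp add: \<Phi>_def op_mult op_twist[OF p])
  qed
  finally have "norm (E (eval_free v q * eval_free v (twist z p)))
      \<le> mnorm (op (fstar q) vac) * mnorm (dil (wt z) (op p vac))"
    by (simp only: Cauchy_Schwarz)
  also have "mnorm (op (fstar q) vac) * mnorm (dil (wt z) (op p vac))
      \<le> norm (eval_free v (fstar q)) * mnorm (op p vac)"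
  proof (rule mult_mono)
    show "mnorm (op (fstar q) vac) \<le> norm (eval_free v (fstar q))"
      by (rule mnorm_op_vac[OF free_on_fstar[OF q]])
    show "mnorm (dil (wt z) (op p vac)) \<le> mnorm (op p vac)"
    proof (rule mnorm_dil)
      show "cmod (wt z s) \<le> 1" if "s \<in> carrier S" for s
        using scale_ge_1[OF that] z by (simp add: norm_wt)
    qed (simp add: wt_def)
  qed simp_all
  also have "norm (eval_free v (fstar q)) * mnorm (op p vac) \<le> norm (eval_free v q) * norm (eval_free v p)"
    unfolding eval_free_fstar norm_star by (rule mult_left_mono[OF mnorm_op_vac[OF p] norm_ge_zero])
  finally show "norm (E (eval_free v q * eval_free v (twist z p))) \<le> norm (eval_free v q) * norm (eval_free v p)" .
qed

section \<open>Ground states\<close>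

lemma state_comp_E: assumes \<psi>: "\<psi> \<in> states" shows "\<psi> \<circ> E \<in> states"
proof -
  have "\<psi> (E (star x * x)) \<in> \<real>\<^sub>\<ge>\<^sub>0" for x
    using E_pos[of x] state_pos[OF \<psi>] by (auto simp: pos_elem_iff_star_mult)
  moreover have "E 1 = 1" using E_iota[of 1] by (simp add: iota_simps)
  ultimately show ?thesis
    using E_add E_scaleC state_add[OF \<psi>] state_scaleC[OF \<psi>] state_one[OF \<psi>]
    by (simp add: states_def clinear_map_def scaleC_complex_def)
qed

lemma state_comp_iota: assumes \<phi>: "\<phi> \<in> states" shows "\<phi> \<circ> iota \<in> states"
  using state_add[OF \<phi>] state_scaleC[OF \<phi>] state_one[OF \<phi>] state_pos[OF \<phi>]
  by (simp add: states_def clinear_map_def scaleC_complex_def iota_simps)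

text \<open>
  Analytic elements need not lie in the image of the free *-algebra, so \<open>b\<close> is approximated and
  \<open>upper_half_plane_bound\<close> transports the estimate.
\<close>

lemma ground_state_comp_E:
  assumes \<psi>: "\<psi> \<in> states" shows "\<psi> \<circ> E \<in> ground_states dyn"
  unfolding ground_states_def
proof (intro CollectI conjI allI impI)
  show st: "\<psi> \<circ> E \<in> states" by (rule state_comp_E[OF \<psi>])
  fix a b f assume "analytic_extension dyn b f"
  then have f: "entire_map f" "\<And>t. f (of_real t) = dyn t b" by (auto simp: analytic_extension_def)
  have "\<exists>p. (\<forall>n. p n \<in> free_on (carrier S)) \<and> (\<lambda>n. eval_free v (p n)) \<longlonglongrightarrow> b"
  proof -
    obtain s where s: "\<And>n. s n \<in> eval_free v ` free_on (carrier S)" "s \<longlonglongrightarrow> b"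
      using closure_sequential[of b "eval_free v ` free_on (carrier S)"] v_dense by auto
    then have "\<forall>n. \<exists>x. x \<in> free_on (carrier S) \<and> s n = eval_free v x" by blast
    from choice[OF this] obtain x where x: "\<forall>n. x n \<in> free_on (carrier S) \<and> s n = eval_free v (x n)" ..
    then have "s = (\<lambda>n. eval_free v (x n))" by blast
    then show ?thesis using s(2) x by blast
  qed
  then obtain p where p: "\<And>n. p n \<in> free_on (carrier S)" and lim: "(\<lambda>n. eval_free v (p n)) \<longlonglongrightarrow> b"
    by blast
  define \<eta> where "\<eta> x = \<psi> (E (a * x))" for x
  have \<eta>: "\<eta> (x + y) = \<eta> x + \<eta> y" "\<eta> (c *\<^sub>C x) = c * \<eta> x" for x y c
    by (simp_all add: \<eta>_def distrib_left E_add state_add[OF \<psi>] scaleC_mult_right E_scaleC state_scaleC[OF \<psi>])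
  have \<eta>_sum: "\<eta> (sum g A) = (\<Sum>i\<in>A. \<eta> (g i))" for g and A :: "'s star_word set"
    using \<eta>(2)[of 0] by (induction A rule: infinite_finite_induct) (simp_all add: \<eta>(1))
  have \<eta>_diff: "\<eta> (x - y) = \<eta> x - \<eta> y" for x y
    using \<eta>(1)[of "x - y" y] by (simp add: algebra_simps)
  have cont: "continuous_on UNIV \<eta>"
    unfolding \<eta>_def
    by (intro continuous_on_compose2[OF state_continuous[OF \<psi>, of UNIV]] E_continuous' continuous_intros) auto
  have bound: "cmod (\<eta> (eval_free v (twist z q))) \<le> norm a * norm (eval_free v q)"
    if "q \<in> free_on (carrier S)" "0 \<le> Im z" for q z
    unfolding \<eta>_def using state_norm[OF \<psi>] norm_E_twist[OF that] by (rule order_trans)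
  have "cmod (\<eta> (f z)) \<le> norm a * norm b" if z: "0 \<le> Im z" for z
  proof (rule upper_half_plane_bound[where Fs = "\<lambda>n z. \<eta> (eval_free v (twist z (p n)))" and z = z])
    show "(\<lambda>z. \<eta> (f z)) holomorphic_on UNIV"
      by (rule entire_map_functional_holomorphic[OF f(1) \<eta> cont])
    show "(\<lambda>z. \<eta> (eval_free v (twist z (p n)))) holomorphic_on UNIV" for n
    proof -
      have "(\<lambda>z. prod_list (map (wt_letter z) l)) holomorphic_on UNIV" for l
      proof (induction l)
        case (Cons a l)
        have "(\<lambda>z. wt_letter z a) holomorphic_on UNIV"
          by (cases a) (simp_all add: wt_def holomorphic_intros)
        then show ?case using Cons by (simp add: holomorphic_on_mult)
      qed simp
      then have "(\<lambda>z. wt_word z u) holomorphic_on UNIV" for u by (cases u) simp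
      then show ?thesis
        by (simp add: twist_def eval_free_sum \<eta>_sum \<eta>) (intro holomorphic_intros)
    qed
    show "cmod (\<eta> (eval_free v (twist z (p n))) - \<eta> (eval_free v (twist z (p m))))
        \<le> norm a * norm (eval_free v (p n) - eval_free v (p m))" if "0 \<le> Im z" for n m z
      using bound[OF free_on_diff[OF p p] that, of n m] by (simp add: twist_diff eval_free_diff \<eta>_diff)
    show "(\<lambda>n. \<eta> (eval_free v (twist (of_real t) (p n)))) \<longlonglongrightarrow> \<eta> (f (of_real t))" for t
    proof -
      have "continuous_on UNIV (dyn t)"
        using dyn_hom[of t] star_hom_norm[OF dyn_hom, of t]
        by (intro contractive_continuous) (auto simp: star_hom_def clinear_map_def)
      then have "continuous_on UNIV (\<lambda>x. \<eta> (dyn t x))"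
        by (intro continuous_on_compose2[OF cont]) auto
      then have "isCont (\<lambda>x. \<eta> (dyn t x)) b" by (simp add: continuous_on_eq_continuous_at)
      from isCont_tendsto_compose[OF this lim] show ?thesis by (simp add: dyn_eval p f(2))
    qed
  qed (use lim z bound[OF p] in auto)
  then show "bounded ((\<lambda>z. (\<psi> \<circ> E) (a * f z)) ` {z. 0 < Im z})"
    unfolding bounded_iff \<eta>_def by (intro exI[of _ "norm a * norm b"]) auto
qed

lemma analytic_v: 
  assumes "s \<in> carrier S"
  shows "analytic_extension dyn (v s) (\<lambda>z. wt z s *\<^sub>C v s)"
    "analytic_extension dyn (star (v s)) (\<lambda>z. wt (- z) s *\<^sub>C star (v s))"
proof -
  show "analytic_extension dyn (v s) (\<lambda>z. wt z s *\<^sub>C v s)"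
    unfolding analytic_extension_def wt_def
    using entire_map_exp_scaleC dyn_v[OF assms, unfolded wt_def] by simp
  have "dyn t (star (v s)) = wt (- of_real t) s *\<^sub>C star (v s)" for t
  proof -
    have "dyn t (star (v s)) = star (dyn t (v s))" using dyn_hom by (simp add: star_hom_def)
    then show ?thesis by (simp add: dyn_v assms star_scaleC wt_def exp_cnj)
  qed
  moreover have "entire_map (\<lambda>z. wt (- z) s *\<^sub>C star (v s))"
    using entire_map_exp_scaleC[of "- (\<i> * of_real (ln (N s)))" "star (v s)"] by (simp add: wt_def)
  ultimately show "analytic_extension dyn (star (v s)) (\<lambda>z. wt (- z) s *\<^sub>C star (v s))"
    by (simp add: analytic_extension_def)
qed

text \<open>
  At time \<open>\<i> y\<close> the element \<open>star (v t)\<close> is multiplied by \<open>N t\<close> to the power \<open>y\<close>, which is unbounded for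
  \<open>N t > 1\<close>.
\<close>

lemma ground_state_vanishes:
  assumes \<phi>: "\<phi> \<in> ground_states dyn" and s: "s \<in> carrier S" and t: "t \<in> carrier S" "t \<notin> K"
  shows "\<phi> (v s * star (v t)) = 0"
proof (rule ccontr)
  assume ne: "\<phi> (v s * star (v t)) \<noteq> 0"
  have st: "\<phi> \<in> states" using \<phi> by (simp add: ground_states_def)
  have N: "1 < N t" using scale_ge_1[OF t(1)] t by (auto simp: K_def)
  then have ln: "0 < ln (N t)" by simp
  have "bounded ((\<lambda>z. \<phi> (v s * wt (- z) t *\<^sub>C star (v t))) ` {z. 0 < Im z})"
    using \<phi> analytic_v(1)[OF s] analytic_v(2)[OF t(1)]
    unfolding ground_states_def analytic_element_def by blast
  then obtain B where B: "\<And>z. 0 < Im z \<Longrightarrow> cmod (\<phi> (v s * wt (- z) t *\<^sub>C star (v t))) \<le> B"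
    unfolding bounded_iff by auto
  define c where "c = cmod (\<phi> (v s * star (v t)))"
  have c: "0 < c" using ne by (simp add: c_def)
  have bd: "exp (ln (N t) * y) * c \<le> B" if "0 < y" for y
    using B[of "\<i> * of_real y"] that
    by (simp add: scaleC_mult_right state_scaleC[OF st] norm_mult norm_wt c_def)
  define y where "y = (\<bar>B\<bar> / c + 1) / ln (N t)"
  have "0 < y" using c ln by (simp add: y_def add_nonneg_pos)
  then have "exp (ln (N t) * y) \<le> B / c" using bd[of y] c by (simp add: field_simps)
  moreover have "ln (N t) * y = \<bar>B\<bar> / c + 1" using ln by (simp add: y_def)
  moreover have "\<bar>B\<bar> / c + 1 < exp (\<bar>B\<bar> / c + 1)"
    using exp_ge_add_one_self[of "\<bar>B\<bar> / c + 1"] by linarith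
  moreover have "B / c \<le> \<bar>B\<bar> / c" using c by (simp add: divide_right_mono)
  ultimately show False by simp
qed

lemma v_star_mult:
  assumes m: "meets r s x y"
  shows "star (v r) * v s = v x * star (v y)"
proof -
  have c: "r \<in> carrier S" "s \<in> carrier S" "x \<in> carrier S" "y \<in> carrier S" "r \<otimes> x = s \<otimes> y"
    "pri r \<inter> pri s = pri (r \<otimes> x)"
    using m by (simp_all add: meets_def)
  have rx: "v r * star (v r) * v s * star (v s) = v (r \<otimes> x) * star (v (s \<otimes> y))"
    using v_ranges[OF c(1,2) m_closed[OF c(1,3)] c(6)] by (simp add: c(5))
  have "star (v r) * v s = (star (v r) * v r) * star (v r) * (v s * (star (v s) * v s))"
    by (simp add: v_isometry c)
  also have "\<dots> = star (v r) * (v r * star (v r) * v s * star (v s)) * v s"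
    by (simp add: mult.assoc)
  also have "\<dots> = (star (v r) * v r) * v x * (star (v y) * (star (v s) * v s))"
    unfolding rx by (simp add: c(1-4) star_mult mult.assoc flip: v_mult)
  finally show ?thesis by (simp add: v_isometry c)
qed

lemma v_star_mult_disjoint:
  assumes "r \<in> carrier S" "s \<in> carrier S" "pri r \<inter> pri s = {}"
  shows "star (v r) * v s = 0"
proof -
  have "star (v r) * v s = (star (v r) * v r) * star (v r) * (v s * (star (v s) * v s))"
    by (simp add: v_isometry assms)
  also have "\<dots> = star (v r) * (v r * star (v r) * v s * star (v s)) * v s"
    by (simp add: mult.assoc)
  finally show ?thesis by (simp add: v_ranges_disjoint[OF assms])
qed

text \<open>
  The elements \<open>v s * star (v t)\<close> span a dense subspace, because every word in the generators reduces
  to such an element or to \<open>0\<close>.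
\<close>

lemma eval_word_form:
  assumes "set_star_word u \<subseteq> carrier S"
  shows "eval_word v u = 0 \<or> (\<exists>s\<in>carrier S. \<exists>t\<in>carrier S. eval_word v u = v s * star (v t))"
proof (cases u)
  case (Word l)
  have "prod_list (map (eval_letter v) l) = 0 \<or>
      (\<exists>s\<in>carrier S. \<exists>t\<in>carrier S. prod_list (map (eval_letter v) l) = v s * star (v t))"
    if "\<forall>a\<in>set l. set_letter a \<subseteq> carrier S" for l
    using that
  proof (induction l)
    case Nil
    have "1 = v \<one> * star (v \<one>)" by (simp add: v_one)
    then show ?case using one_closed by auto
  next
    case (Cons a l)
    show ?case
    proof (cases "prod_list (map (eval_letter v) l) = 0")
      case False
      then obtain s t where st: "s \<in> carrier S" "t \<in> carrier S"
          "prod_list (map (eval_letter v) l) = v s * star (v t)"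
        using Cons by auto
      show ?thesis
      proof (cases a)
        case (Gen r)
        then have r: "r \<in> carrier S" using Cons.prems by simp
        have "v r * (v s * star (v t)) = v (r \<otimes> s) * star (v t)"
          using v_mult[OF r st(1)] by (simp flip: mult.assoc)
        then show ?thesis using r st by (auto simp: Gen)
      next
        case (Adj r)
        then have r: "r \<in> carrier S" using Cons.prems by simp
        from r st(1) show ?thesis
        proof (rule disjoint_or_meets)
          assume "pri r \<inter> pri s = {}"
          then have "star (v r) * (v s * star (v t)) = 0"
            using v_star_mult_disjoint[OF r st(1)] by (simp flip: mult.assoc)
          then show ?thesis by (simp add: Adj st)
        next
          fix x y assume m: "meets r s x y"
          have c: "x \<in> carrier S" "y \<in> carrier S" using m by (simp_all add: meets_def)
          have "star (v r) * (v s * star (v t)) = v x * star (v (t \<otimes> y))"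
            using v_star_mult[OF m] v_mult[OF st(2) c(2)] by (simp add: star_mult[symmetric] mult.assoc flip: mult.assoc[of "star (v r)"])
          then show ?thesis using c st by (auto simp: Adj)
        qed
      qed
    qed simp
  qed
  then show ?thesis using assms by (auto simp: Word)
qed

lemma ground_state_factor:
  assumes \<phi>: "\<phi> \<in> ground_states dyn" shows "\<phi> (iota (E y)) = \<phi> y"
proof -
  have st: "\<phi> \<in> states" using \<phi> by (simp add: ground_states_def)
  have base: "\<phi> (iota (E (v s * star (v t)))) = \<phi> (v s * star (v t))"
    if s: "s \<in> carrier S" and t: "t \<in> carrier S" for s t
  proof (cases "s \<in> K \<and> t \<in> K")
    case False
    have "\<phi> (v s * star (v t)) = 0"
    proof (cases "t \<in> K")
      case True
      then have "\<phi> (v t * star (v s)) = 0" using ground_state_vanishes[OF \<phi> t s] False by simp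
      then show ?thesis using state_star[OF st, of "v t * star (v s)"] by (simp add: star_mult star_star)
    qed (rule ground_state_vanishes[OF \<phi> s t])
    then show ?thesis using False by (simp add: iota_E_word s t state_zero[OF st])
  qed (simp add: iota_E_word s t)
  have lin: "E 0 = 0" "iota 0 = 0" using E_add[of 0 0] iota_simps(1)[of 0 0] by simp_all
  have word: "\<phi> (iota (E (eval_word v u))) = \<phi> (eval_word v u)" if "set_star_word u \<subseteq> carrier S" for u
    using eval_word_form[OF that] base lin by auto
  show ?thesis
  proof (rule free_dense_induct[OF v_dense, where P = "\<lambda>y. \<phi> (iota (E y)) = \<phi> y"])
    show "closed {y. \<phi> (iota (E y)) = \<phi> y}"
      by (intro closed_Collect_eq state_continuous[OF st]
          continuous_on_compose2[OF state_continuous[OF st, of UNIV]] iota_continuous' E_continuous) auto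
    fix p assume p: "p \<in> free_on (carrier S)"
    have "\<phi> (iota (E (sum g A))) = (\<Sum>i\<in>A. \<phi> (iota (E (g i))))" for g and A :: "'s star_word set"
      by (induction A rule: infinite_finite_induct)
        (simp_all add: lin state_zero[OF st] E_add iota_simps state_add[OF st])
    then have "\<phi> (iota (E (eval_free v p)))
        = (\<Sum>u\<in>Poly_Mapping.keys p. Poly_Mapping.lookup p u * \<phi> (iota (E (eval_word v u))))"
      by (simp add: eval_free_def E_scaleC iota_simps state_scaleC[OF st])
    also have "\<dots> = (\<Sum>u\<in>Poly_Mapping.keys p. Poly_Mapping.lookup p u * \<phi> (eval_word v u))"
      using p by (intro sum.cong refl) (simp add: word free_on_def)
    finally show "\<phi> (iota (E (eval_free v p))) = \<phi> (eval_free v p)"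
      by (simp add: eval_free_def state_sum[OF st] state_scaleC[OF st])
  qed
qed

lemma continuous_map_weak_star:
  assumes "F ` X \<subseteq> Y" "\<And>y. \<exists>x. \<forall>\<psi>\<in>X. F \<psi> y = \<psi> x"
  shows "continuous_map (weak_star_topology X) (weak_star_topology Y) F"
proof -
  have top: "topspace (weak_star_topology X) = X" by (simp add: weak_star_topology_def)
  have "continuous_map (weak_star_topology X) (product_topology (\<lambda>_. euclidean) UNIV) F"
    unfolding continuous_map_componentwise_UNIV
  proof
    fix y
    obtain x where x: "\<forall>\<psi>\<in>X. F \<psi> y = \<psi> x" using assms(2) by blast
    have "continuous_map (weak_star_topology X) euclidean (\<lambda>\<psi>. \<psi> x)"
      unfolding weak_star_topology_def
      by (intro continuous_map_from_subtopology continuous_map_product_projection) simp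
    then show "continuous_map (weak_star_topology X) euclidean (\<lambda>\<psi>. F \<psi> y)"
      by (rule continuous_map_eq) (use x top in auto)
  qed
  then show ?thesis
    using assms(1) top unfolding weak_star_topology_def[of Y] continuous_map_in_subtopology by auto
qed

theorem homeomorphic_map_ground_states:
  "homeomorphic_map (weak_star_topology (states :: ('b \<Rightarrow> complex) set))
     (weak_star_topology (ground_states dyn)) (\<lambda>\<psi>. \<psi> \<circ> E)"
  unfolding homeomorphic_map_maps homeomorphic_maps_def
proof (intro exI[of _ "\<lambda>\<phi>. \<phi> \<circ> iota"] conjI ballI)
  show "continuous_map (weak_star_topology (states :: ('b \<Rightarrow> complex) set))
      (weak_star_topology (ground_states dyn)) (\<lambda>\<psi>. \<psi> \<circ> E)"
    by (rule continuous_map_weak_star) (auto simp: ground_state_comp_E)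
  show "continuous_map (weak_star_topology (ground_states dyn))
      (weak_star_topology (states :: ('b \<Rightarrow> complex) set)) (\<lambda>\<phi>. \<phi> \<circ> iota)"
    by (rule continuous_map_weak_star) (auto simp: ground_states_def intro: state_comp_iota)
  show "\<psi> \<circ> E \<circ> iota = \<psi>" for \<psi> :: "'b \<Rightarrow> complex" by (simp add: fun_eq_iff E_iota)
  fix \<phi> assume "\<phi> \<in> topspace (weak_star_topology (ground_states dyn))"
  then have "\<phi> \<in> ground_states dyn" by (simp add: weak_star_topology_def)
  then show "\<phi> \<circ> iota \<circ> E = \<phi>" by (simp add: fun_eq_iff ground_state_factor)
qed

end

theorem proposition4p10:
  fixes S :: "('s, 'm) monoid_scheme" (structure)
    and N :: "'s \<Rightarrow> real"
    and v :: "'s \<Rightarrow> 'a::cstar_algebra"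
    and w :: "'s \<Rightarrow> 'b::cstar_algebra"
  assumes S: "right_LCM_semigroup S" "countable (carrier S)"
    and N: "semigroup_scale S N"
    and lcm_ker: "\<And>s t. \<lbrakk>s \<in> carrier S; t \<in> carrier (scale_kernel S N)\<rbrakk> \<Longrightarrow>
      \<exists>k\<in>carrier (scale_kernel S N).
        principal_right_ideal S s \<inter> principal_right_ideal S t = principal_right_ideal S (s \<otimes> k)"
    and v: "lcm_cstar S v"
    and w: "lcm_cstar (scale_kernel S N) w"
  shows "\<exists>\<iota> E.
    star_hom \<iota> \<and> inj \<iota> \<and> (\<forall>s\<in>carrier (scale_kernel S N). \<iota> (w s) = v s) \<and>
    conditional_expectation \<iota> E \<and>
    (\<forall>s\<in>carrier S. \<forall>t\<in>carrier S. \<iota> (E (v s * star (v t))) =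
      (if s \<in> carrier (scale_kernel S N) \<and> t \<in> carrier (scale_kernel S N) then v s * star (v t) else 0)) \<and>
    homeomorphic_map (weak_star_topology (states :: ('b \<Rightarrow> complex) set))
      (weak_star_topology (ground_states (dynamics S N v))) (\<lambda>\<psi>. \<psi> \<circ> E) \<and>
    affine_on (states :: ('b \<Rightarrow> complex) set) (\<lambda>\<psi>. \<psi> \<circ> E)"
proof -
  interpret right_LCM_semigroup S by (rule S)
  interpret L: lcm_algebra_pair S N v w
  proof
    show "semigroup_scale S N" by (rule N)
    show "lcm_cstar S v" by (rule v)
    show "lcm_cstar (scale_kernel S N) w" by (rule w)
  qed (rule lcm_ker)
  show ?thesis
  proof (intro exI[of _ L.iota] exI[of _ L.E] conjI)
    show "star_hom L.iota" by (rule L.iota_hom)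
    show "inj L.iota" by (rule L.inj_iota)
    show "\<forall>s\<in>carrier (scale_kernel S N). L.iota (w s) = v s" by (simp add: L.iota_w)
    show "conditional_expectation L.iota L.E" by (rule L.conditional_expectation_E)
    show "\<forall>s\<in>carrier S. \<forall>t\<in>carrier S. L.iota (L.E (v s * star (v t))) =
        (if s \<in> carrier (scale_kernel S N) \<and> t \<in> carrier (scale_kernel S N) then v s * star (v t) else 0)"
      by (simp add: L.iota_E_word)
    show "homeomorphic_map (weak_star_topology (states :: ('b \<Rightarrow> complex) set))
        (weak_star_topology (ground_states (dynamics S N v))) (\<lambda>\<psi>. \<psi> \<circ> L.E)"
      using L.homeomorphic_map_ground_states by (simp only: L.dyn_def)
    show "affine_on (states :: ('b \<Rightarrow> complex) set) (\<lambda>\<psi>. \<psi> \<circ> L.E)"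
      by (simp add: affine_on_def fun_eq_iff)
  qed
qed

end
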